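(* Let $L/K/k$ be a tower of number fields with $L/k$ Galois, and set $G=\mathrm{Gal}(L/k)$ and $H=\mathrm{Gal}(L/K)$. Then there is a canonical isomorphism \[\mathfrak{F}_{nr}(L/K/k) = (H\cap [G,G])/\Phi^G(H),\] where $\Phi^G(H)$ denotes the focal subgroup of $H$ in $G$.
   Context: For an extension $K/k$ of number fields, $R^1_{K/k}\mathbb{G}_m$ denotes the norm one torus, i.e. the kernel of the norm map $N_{K/k}:R_{K/k}\mathbb{G}_m\to\mathbb{G}_{m,k}$ (with $R_{K/k}$ the Weil restriction). For an abelian group $M$, $M^\sim=\mathrm{Hom}(M,\mathbb{Q}/\mathbb{Z})$. For a variety $X$ over $k$, $\overline{X}$ is its base change to an algebraic closure of $k$. Let $T=R^1_{K/k}\mathbb{G}_m$ and $T_0=R^1_{L/k}\mathbb{G}_m$, with smooth compactifications $X$ and $X_0$ over $k$. The norm map $N_{L/K}:T_0\to T$ induces a canonical map $f_{L/K}:\mathrm{H}^1(k,\mathrm{Pic}\,\overline{X_0})^\sim\to \mathrm{H}^1(k,\mathrm{Pic}\,\overline{X})^\sim$. It may be described as follows: for a $k$-torus $S$ split by $L$ with character module $\widehat{S}$ and smooth compactification $Y$, Colliot-Thélène and Sansuc give a canonical identification $\mathrm{H}^1(k,\mathrm{Pic}\,\overline{Y})=\mathrm{Sha}^2_\omega(G,\widehat{S}):=\mathrm{Ker}\bigl(\mathrm{H}^2(G,\widehat{S})\to\prod_{g\in G}\mathrm{H}^2(\langle g\rangle,\widehat{S})\bigr)$, and $f_{L/K}$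 is the $\mathbb{Q}/\mathbb{Z}$-dual of the map $\mathrm{Sha}^2_\omega(G,\widehat{T})\to\mathrm{Sha}^2_\omega(G,\widehat{T_0})$ induced by $N_{L/K}$ on characters. The "unramified cover of the first obstruction to the Hasse norm principle for $K/k$ corresponding to the tower $L/K/k$" is $\mathfrak{F}_{nr}(L/K/k)=\mathrm{Coker}(f_{L/K})$. For a subgroup $H$ of a finite group $G$, the focal subgroup of $H$ in $G$ is $\Phi^G(H)=\langle h_1^{-1}h_2\mid h_1,h_2\in H,\ h_2 \text{ is } G\text{-conjugate to } h_1\rangle=\langle [h,x]\mid h\in H\cap xHx^{-1},\ x\in G\rangle\trianglelefteq H$, where $[h,x]=h^{-1}x^{-1}hx$. $[G,G]$ is the derived subgroup. *)

theory Defs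
  imports "HOL-Algebra.Algebra" "HOL-Algebra.Algebraic_Closure_Type"
begin

section \<open>Focal subgroups\<close>

definition focal_subgroup :: "('g, 'x) monoid_scheme \<Rightarrow> 'g set \<Rightarrow> 'g set" where
  "focal_subgroup G H = generate G
     {inv\<^bsub>G\<^esub> h1 \<otimes>\<^bsub>G\<^esub> h2 | h1 h2. h1 \<in> H \<and> h2 \<in> H \<and>
        (\<exists>x \<in> carrier G. h2 = inv\<^bsub>G\<^esub> x \<otimes>\<^bsub>G\<^esub> h1 \<otimes>\<^bsub>G\<^esub> x)}"


section \<open>The dual of an abelian group\<close>

definition rational_group :: "rat monoid" where
  "rational_group = \<lparr>carrier = UNIV, monoid.mult = (+), one = 0\<rparr>"

definition QmodZ :: "rat set monoid" where
  "QmodZ = rational_group Mod \<int>"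

definition QZ_dual :: "('m, 'x) monoid_scheme \<Rightarrow> ('m \<Rightarrow> rat set) monoid" where
  "QZ_dual M = (product_group (carrier M) (\<lambda>_. QmodZ))
     \<lparr>carrier := hom M QmodZ \<inter> extensional (carrier M)\<rparr>"


section \<open>Second cohomology groups\<close>

text \<open>
  Inhomogeneous cochains.  The module \<open>M\<close> is an abelian group, written multiplicatively as
  everywhere in HOL-Algebra, and \<open>act g\<close> is the action of \<open>g\<close> on it.
\<close>

definition cochains2 ::
  "('g, 'x) monoid_scheme \<Rightarrow> ('m, 'y) monoid_scheme \<Rightarrow> ('g \<times> 'g \<Rightarrow> 'm) monoid" where
  "cochains2 G M = product_group (carrier G \<times> carrier G) (\<lambda>_. M)"

definition cocycles2 ::
  "('g, 'x) monoid_scheme \<Rightarrow> ('m, 'y) monoid_scheme \<Rightarrow> ('g \<Rightarrow> 'm \<Rightarrow> 'm) \<Rightarrow> ('g \<times> 'g \<Rightarrow> 'm) set" where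
  "cocycles2 G M act = {c \<in> carrier (cochains2 G M).
     \<forall>g1 \<in> carrier G. \<forall>g2 \<in> carrier G. \<forall>g3 \<in> carrier G.
       act g1 (c (g2, g3)) \<otimes>\<^bsub>M\<^esub> c (g1, g2 \<otimes>\<^bsub>G\<^esub> g3) = c (g1 \<otimes>\<^bsub>G\<^esub> g2, g3) \<otimes>\<^bsub>M\<^esub> c (g1, g2)}"

definition coboundaries2 ::
  "('g, 'x) monoid_scheme \<Rightarrow> ('m, 'y) monoid_scheme \<Rightarrow> ('g \<Rightarrow> 'm \<Rightarrow> 'm) \<Rightarrow> ('g \<times> 'g \<Rightarrow> 'm) set" where
  "coboundaries2 G M act =
     (\<lambda>b. \<lambda>(g1, g2) \<in> carrier G \<times> carrier G.
        act g1 (b g2) \<otimes>\<^bsub>M\<^esub> inv\<^bsub>M\<^esub> (b (g1 \<otimes>\<^bsub>G\<^esub> g2)) \<otimes>\<^bsub>M\<^esub> b g1) ` (carrier G \<rightarrow>\<^sub>E carrier M)"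

definition cohom2 ::
  "('g, 'x) monoid_scheme \<Rightarrow> ('m, 'y) monoid_scheme \<Rightarrow> ('g \<Rightarrow> 'm \<Rightarrow> 'm) \<Rightarrow> ('g \<times> 'g \<Rightarrow> 'm) set monoid" where
  "cohom2 G M act =
     (cochains2 G M) \<lparr>carrier := cocycles2 G M act\<rparr> Mod coboundaries2 G M act"

definition cohom2_class ::
  "('g, 'x) monoid_scheme \<Rightarrow> ('m, 'y) monoid_scheme \<Rightarrow> ('g \<Rightarrow> 'm \<Rightarrow> 'm) \<Rightarrow>
     ('g \<times> 'g \<Rightarrow> 'm) \<Rightarrow> ('g \<times> 'g \<Rightarrow> 'm) set" where
  "cohom2_class G M act c = coboundaries2 G M act #>\<^bsub>cochains2 G M\<^esub> c"

text \<open>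
  In the next two maps all members of the union agree when \<open>\<xi>\<close> is a cohomology class, so the
  union is the class of the image of any representative.
\<close>

definition cohom2_res ::
  "('g, 'x) monoid_scheme \<Rightarrow> ('m, 'y) monoid_scheme \<Rightarrow> ('g \<Rightarrow> 'm \<Rightarrow> 'm) \<Rightarrow> 'g set \<Rightarrow>
     ('g \<times> 'g \<Rightarrow> 'm) set \<Rightarrow> ('g \<times> 'g \<Rightarrow> 'm) set" where
  "cohom2_res G M act S \<xi> =
     (\<Union>c\<in>\<xi>. cohom2_class (G\<lparr>carrier := S\<rparr>) M act (\<lambda>p \<in> S \<times> S. c p))"

definition cohom2_map ::
  "('g, 'x) monoid_scheme \<Rightarrow> ('n, 'y) monoid_scheme \<Rightarrow> ('g \<Rightarrow> 'n \<Rightarrow> 'n) \<Rightarrow> ('m \<Rightarrow> 'n) \<Rightarrow>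
     ('g \<times> 'g \<Rightarrow> 'm) set \<Rightarrow> ('g \<times> 'g \<Rightarrow> 'n) set" where
  "cohom2_map G N actN \<phi> \<xi> =
     (\<Union>c\<in>\<xi>. cohom2_class G N actN (\<lambda>p \<in> carrier G \<times> carrier G. \<phi> (c p)))"

definition Sha2_omega ::
  "('g, 'x) monoid_scheme \<Rightarrow> ('m, 'y) monoid_scheme \<Rightarrow> ('g \<Rightarrow> 'm \<Rightarrow> 'm) \<Rightarrow> ('g \<times> 'g \<Rightarrow> 'm) set monoid" where
  "Sha2_omega G M act = (cohom2 G M act)
     \<lparr>carrier := {\<xi> \<in> carrier (cohom2 G M act). \<forall>g \<in> carrier G.
        cohom2_res G M act (generate G {g}) \<xi> =
          \<one>\<^bsub>cohom2 (G\<lparr>carrier := generate G {g}\<rparr>) M act\<^esub>}\<rparr>"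


section \<open>Number fields and Galois groups\<close>

text \<open>
  All fields are subfields of an ambient field given by a type of class \<^class>\<open>field_char_0\<close>
  (for instance the complex numbers), viewed as a ring in the sense of HOL-Algebra.
\<close>

abbreviation ambient :: "'a::field ring" where
  "ambient \<equiv> ring_of_type_algebra"

definition number_field :: "'a::field_char_0 set \<Rightarrow> bool" where
  "number_field L \<longleftrightarrow> subfield L ambient \<and> ring.finite_dimension ambient \<rat> L"

definition embeddings :: "'a::field_char_0 set \<Rightarrow> 'a set \<Rightarrow> 'a set \<Rightarrow> ('a \<Rightarrow> 'a) set" where
  "embeddings k K L = {\<sigma> \<in> ring_hom (ambient\<lparr>carrier := K\<rparr>) (ambient\<lparr>carrier := L\<rparr>) \<inter> extensional K.
     \<forall>x\<in>k. \<sigma> x = x}"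

definition Gal :: "'a::field_char_0 set \<Rightarrow> 'a set \<Rightarrow> ('a \<Rightarrow> 'a) monoid" where
  "Gal L k = (BijGroup L)\<lparr>carrier := Bij L \<inter> embeddings k L L\<rparr>"

definition galois_ext :: "'a::field_char_0 set \<Rightarrow> 'a set \<Rightarrow> bool" where
  "galois_ext L k \<longleftrightarrow> k \<subseteq> L \<and> {x \<in> L. \<forall>\<sigma> \<in> carrier (Gal L k). \<sigma> x = x} = k"


section \<open>Norm one tori and their characters\<close>

text \<open>
  Let \<open>k \<subseteq> K \<subseteq> L\<close> with \<open>L/k\<close> finite Galois, so that \<open>embeddings k K L\<close> is the set of all
  \<open>k\<close>-embeddings of \<open>K\<close> into an algebraic closure of \<open>L\<close>.  Following Weil, the restriction of
  scalars \<open>R_{K/k} G_m\<close> is the product of copies of \<open>G_m\<close> indexed by these embeddings, with the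
  descent datum \<open>galois_point\<close> below.  Under
  \<open>K \<otimes>\<^sub>k L \<cong> \<Prod>\<^sub>\<sigma> L\<close>, \<open>a \<otimes> l \<mapsto> (\<sigma>(a) l)\<^sub>\<sigma>\<close>, the group of \<open>L\<close>-points below is
  \<open>(K \<otimes>\<^sub>k L)\<^sup>\<times>\<close>, the Galois action is the one on the factor \<open>L\<close>, and the norm to \<open>L\<close> is
  the product of the components.  The tori are split by the infinite field \<open>L\<close>, so
  their \<open>L\<close>-points are Zariski dense and a character (all are defined over \<open>L\<close>) is
  determined by the function it induces on \<open>L\<close>-points.
\<close>

abbreviation mult_group :: "'a::field_char_0 set \<Rightarrow> 'a monoid" where
  "mult_group L \<equiv> units_of (ambient\<lparr>carrier := L\<rparr>)"

definition res_Gm :: "'a::field_char_0 set \<Rightarrow> 'a set \<Rightarrow> 'a set \<Rightarrow> (('a \<Rightarrow> 'a) \<Rightarrow> 'a) monoid" where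
  "res_Gm k K L = product_group (embeddings k K L) (\<lambda>_. mult_group L)"

definition norm_one_torus ::
  "'a::field_char_0 set \<Rightarrow> 'a set \<Rightarrow> 'a set \<Rightarrow> (('a \<Rightarrow> 'a) \<Rightarrow> 'a) monoid" where
  "norm_one_torus k K L = (res_Gm k K L)
     \<lparr>carrier := kernel (res_Gm k K L) (mult_group L) (\<lambda>y. \<Prod>\<sigma>\<in>embeddings k K L. y \<sigma>)\<rparr>"

definition galois_point ::
  "'a::field_char_0 set \<Rightarrow> 'a set \<Rightarrow> 'a set \<Rightarrow> ('a \<Rightarrow> 'a) \<Rightarrow> (('a \<Rightarrow> 'a) \<Rightarrow> 'a) \<Rightarrow> (('a \<Rightarrow> 'a) \<Rightarrow> 'a)" where
  "galois_point k K L g y =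
     (\<lambda>\<sigma> \<in> embeddings k K L. g (y (compose K (inv\<^bsub>Gal L k\<^esub> g) \<sigma>)))"

text \<open>
  Regular functions over \<open>L\<close> on \<open>R_{K/k} G_m\<close>, i.e. Laurent polynomials in the coordinates.
  Regular functions on the norm one torus, which is closed, are their restrictions.
\<close>

inductive_set regular_functions ::
  "'a::field_char_0 set \<Rightarrow> 'a set \<Rightarrow> 'a set \<Rightarrow> ((('a \<Rightarrow> 'a) \<Rightarrow> 'a) \<Rightarrow> 'a) set"
  for k K L where
  const: "c \<in> L \<Longrightarrow> (\<lambda>y. c) \<in> regular_functions k K L"
| coord: "\<sigma> \<in> embeddings k K L \<Longrightarrow> (\<lambda>y. y \<sigma>) \<in> regular_functions k K L"
| inv_coord: "\<sigma> \<in> embeddings k K L \<Longrightarrow> (\<lambda>y. inverse (y \<sigma>)) \<in> regular_functions k K L"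
| add: "f \<in> regular_functions k K L \<Longrightarrow> g \<in> regular_functions k K L \<Longrightarrow>
          (\<lambda>y. f y + g y) \<in> regular_functions k K L"
| mult: "f \<in> regular_functions k K L \<Longrightarrow> g \<in> regular_functions k K L \<Longrightarrow>
          (\<lambda>y. f y * g y) \<in> regular_functions k K L"

definition torus_characters ::
  "'a::field_char_0 set \<Rightarrow> 'a set \<Rightarrow> 'a set \<Rightarrow> ((('a \<Rightarrow> 'a) \<Rightarrow> 'a) \<Rightarrow> 'a) monoid" where
  "torus_characters k K L =
     (product_group (carrier (norm_one_torus k K L)) (\<lambda>_. mult_group L))
     \<lparr>carrier := {\<chi> \<in> hom (norm_one_torus k K L) (mult_group L) \<inter> extensional (carrier (norm_one_torus k K L)).
        \<exists>f \<in> regular_functions k K L. \<forall>y \<in> carrier (norm_one_torus k K L). \<chi> y = f y}\<rparr>"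

definition character_act ::
  "'a::field_char_0 set \<Rightarrow> 'a set \<Rightarrow> 'a set \<Rightarrow> ('a \<Rightarrow> 'a) \<Rightarrow>
     ((('a \<Rightarrow> 'a) \<Rightarrow> 'a) \<Rightarrow> 'a) \<Rightarrow> ((('a \<Rightarrow> 'a) \<Rightarrow> 'a) \<Rightarrow> 'a)" where
  "character_act k K L g \<chi> =
     (\<lambda>y \<in> carrier (norm_one_torus k K L). g (\<chi> (galois_point k K L (inv\<^bsub>Gal L k\<^esub> g) y)))"

text \<open>
  The norm \<open>N_{L/K}\<close> from \<open>R_{L/k} G_m\<close> to \<open>R_{K/k} G_m\<close> on \<open>L\<close>-points: the component at \<open>\<sigma>\<close> is
  the product of the components at the embeddings of \<open>L\<close> extending \<open>\<sigma>\<close>.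
\<close>

definition norm_points ::
  "'a::field_char_0 set \<Rightarrow> 'a set \<Rightarrow> 'a set \<Rightarrow> (('a \<Rightarrow> 'a) \<Rightarrow> 'a) \<Rightarrow> (('a \<Rightarrow> 'a) \<Rightarrow> 'a)" where
  "norm_points k K L y =
     (\<lambda>\<sigma> \<in> embeddings k K L. \<Prod>\<tau> | \<tau> \<in> embeddings k L L \<and> restrict \<tau> K = \<sigma>. y \<tau>)"

definition norm_on_characters ::
  "'a::field_char_0 set \<Rightarrow> 'a set \<Rightarrow> 'a set \<Rightarrow>
     ((('a \<Rightarrow> 'a) \<Rightarrow> 'a) \<Rightarrow> 'a) \<Rightarrow> ((('a \<Rightarrow> 'a) \<Rightarrow> 'a) \<Rightarrow> 'a)" where
  "norm_on_characters k K L \<chi> =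
     (\<lambda>y \<in> carrier (norm_one_torus k L L). \<chi> (norm_points k K L y))"


section \<open>The unramified cover of the first obstruction\<close>

text \<open>
  For a smooth compactification \<open>X\<close> of \<open>R^1_{K/k} G_m\<close>, the group \<open>H^1(k, Pic X)\<close>, with \<open>X\<close>
  base-changed to an algebraic closure, enters through its identification with \<open>Sha^2_\<omega>\<close> of
  the character module, due to Colliot-Thelene and Sansuc.
\<close>

definition Sha_torus where
  "Sha_torus k K L = Sha2_omega (Gal L k) (torus_characters k K L) (character_act k K L)"

definition Sha_norm where
  "Sha_norm k K L =
     cohom2_map (Gal L k) (torus_characters k L L) (character_act k L L) (norm_on_characters k K L)"

definition f_norm where
  "f_norm k K L l = (\<lambda>\<xi> \<in> carrier (Sha_torus k K L). l (Sha_norm k K L \<xi>))"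

definition F_nr where
  "F_nr k K L =
     QZ_dual (Sha_torus k K L) Mod (f_norm k K L ` carrier (QZ_dual (Sha_torus k L L)))"


section \<open>The pairing that makes the isomorphism canonical\<close>

definition permutation_module ::
  "'a::field_char_0 set \<Rightarrow> 'a set \<Rightarrow> 'a set \<Rightarrow> (('a \<Rightarrow> 'a) \<Rightarrow> int) monoid" where
  "permutation_module k K L = product_group (embeddings k K L) (\<lambda>_. integer_group)"

definition permutation_act ::
  "'a::field_char_0 set \<Rightarrow> 'a set \<Rightarrow> 'a set \<Rightarrow> ('a \<Rightarrow> 'a) \<Rightarrow> (('a \<Rightarrow> 'a) \<Rightarrow> int) \<Rightarrow> (('a \<Rightarrow> 'a) \<Rightarrow> int)" where
  "permutation_act k K L g m = (\<lambda>\<sigma> \<in> embeddings k K L. m (compose K (inv\<^bsub>Gal L k\<^esub> g) \<sigma>))"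

definition monomial_character ::
  "'a::field_char_0 set \<Rightarrow> 'a set \<Rightarrow> 'a set \<Rightarrow> (('a \<Rightarrow> 'a) \<Rightarrow> int) \<Rightarrow> ((('a \<Rightarrow> 'a) \<Rightarrow> 'a) \<Rightarrow> 'a)" where
  "monomial_character k K L m =
     (\<lambda>y \<in> carrier (norm_one_torus k K L). \<Prod>\<sigma>\<in>embeddings k K L. y \<sigma> powi m \<sigma>)"

text \<open>
  With \<open>G = Gal(L/k)\<close>, \<open>H = Gal(L/K)\<close> and \<open>T\<close> the norm one torus of \<open>K/k\<close>, the relation below says
  that \<open>\<xi>\<close> is the image of \<open>\<chi>\<close> under the composite
  \<open>Hom(H, \<rat>/\<int>) \<rightarrow> H\<^sup>2(H, \<int>) \<cong> H\<^sup>2(G, \<int>[G/H]) \<rightarrow> H\<^sup>2(G, T^)\<close>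
  of the connecting map, the inverse of the Shapiro isomorphism (restriction to \<open>H\<close> followed by
  the coefficient at the trivial coset, i.e. at the inclusion of \<open>K\<close> in \<open>L\<close>), and
  the map induced by restricting characters of \<open>R_{K/k} G_m\<close> to \<open>T\<close>.
  Here \<open>q\<close> is a lift of \<open>\<chi>\<close> to \<open>\<rat>\<close> and \<open>a\<close> is a cocycle whose Shapiro image is the
  coboundary of \<open>q\<close>.  The classes arising from some \<open>\<chi>\<close> form the kernel of
  \<open>H\<^sup>2(G, T^) \<rightarrow> H\<^sup>2(G, T\<^sub>0^)\<close>, \<open>T\<^sub>0\<close> being the norm one torus of \<open>L/k\<close>.
\<close>

definition transferred_class ::
  "'a::field_char_0 set \<Rightarrow> 'a set \<Rightarrow> 'a set \<Rightarrow> (('a \<Rightarrow> 'a) \<Rightarrow> rat set) \<Rightarrow>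
     (('a \<Rightarrow> 'a) \<times> ('a \<Rightarrow> 'a) \<Rightarrow> ((('a \<Rightarrow> 'a) \<Rightarrow> 'a) \<Rightarrow> 'a)) set \<Rightarrow> bool" where
  "transferred_class k K L \<chi> \<xi> \<longleftrightarrow>
     (\<exists>q a. a \<in> cocycles2 (Gal L k) (permutation_module k K L) (permutation_act k K L) \<and>
        (\<forall>h \<in> carrier (Gal L K). \<chi> h = \<int> #>\<^bsub>rational_group\<^esub> q h) \<and>
        (\<forall>h1 \<in> carrier (Gal L K). \<forall>h2 \<in> carrier (Gal L K).
           of_int (a (h1, h2) (\<lambda>x\<in>K. x)) = q h1 + q h2 - q (h1 \<otimes>\<^bsub>Gal L K\<^esub> h2)) \<and>
        \<xi> = cohom2_class (Gal L k) (torus_characters k K L) (character_act k K L)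
              (\<lambda>p \<in> carrier (Gal L k) \<times> carrier (Gal L k). monomial_character k K L (a p)))"

end

theory Submission
  imports Defs
begin

text \<open>
  Let \<open>J\<close> and \<open>J\<^sub>0\<close> be the quotients of \<open>\<int>[G/H]\<close> and \<open>\<int>[G]\<close> by the constants.  By Dedekind's
  independence of characters every character of a norm one torus is a monomial, so these are the
  character modules of the tori of \<open>K/k\<close> and \<open>L/k\<close>.  As \<open>\<rat>/\<int>\<close> is injective, the cokernel is dual to the
  kernel \<open>C\<close> of \<open>Sha(J) \<rightarrow> Sha(J\<^sub>0)\<close>.

  A 2-cocycle with values in \<open>\<int>[G/H]\<close> is over \<open>\<rat>\<close> the coboundary of some \<open>b\<close>; modulo \<open>\<int>\<close>, \<open>b\<close> is a crossed
  homomorphism, whose component at the trivial coset is a character \<open>\<chi>\<close> of \<open>H\<close>.  The classes in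
  \<open>H\<^sup>2(G, J)\<close> that arise in this way are those which vanish in \<open>H\<^sup>2(G, J\<^sub>0)\<close>.  The class of \<open>\<chi>\<close> is trivial on a
  subgroup \<open>S\<close> iff one character of \<open>S\<close> extends all the restrictions of conjugates of \<open>\<chi>\<close> to
  \<open>S \<inter> x H x\<^sup>-\<^sup>1\<close>.  For \<open>S = G\<close> this says that \<open>\<chi>\<close> is trivial on \<open>H \<inter> [G, G]\<close>.  For all cyclic \<open>S\<close> it says that
  \<open>\<chi>\<close> is trivial on the focal subgroup, because compatible characters on subgroups of a cyclic group
  glue.  Hence \<open>C\<close> is the dual of \<open>(H \<inter> [G, G])/\<Phi>\<close>, and biduality of finite abelian groups concludes.
\<close>

section \<open>The group of rationals modulo integers\<close>

text \<open>Why vanishing in J_0 singles out the classes of characters: as H^2(G, Z[G]) = 0, every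
  class that comes from Z[G/H] dies in J_0. Conversely, the obstruction to lifting a class of J to
  Z[G/H] is its image in H^3(G, Z), and this image can be computed in J_0 just as well. Why one
  character of S decides triviality on S: by the formulas of Mackey and Shapiro, H^2(S, Z[G/H]) is
  the sum over the S-orbits of the character groups of the stabilisers, and the kernel of its map to
  H^2(S, J) is the image of H^2(S, Z) = Hom(S, Q/Z). Gluing is special to cyclic S: on the Klein
  four-group the nontrivial characters of the three subgroups of order 2 are compatible, yet no
  character of the whole group restricts to all three. The proof computes none of these groups. It
  carries each class by a rational cochain b with integral coboundary. Biduality is applied to the
  finite group (H \<inter> [G,G])/Phi only; Sha is dualised through the injectivity of Q/Z
  alone.\<close>

definition qz :: "rat \<Rightarrow> rat set" where
  "qz q = \<int> #>\<^bsub>rational_group\<^esub> q"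

lemma qz_iff: "x \<in> qz q \<longleftrightarrow> x - q \<in> \<int>"
  unfolding qz_def r_coset_def rational_group_def
  by (auto intro: bexI[of _ "x - q"])

lemma qz_eq_iff: "qz q = qz r \<longleftrightarrow> q - r \<in> \<int>"
proof
  assume "qz q = qz r"
  moreover have "q \<in> qz q" by (simp add: qz_iff)
  ultimately show "q - r \<in> \<int>" by (simp add: qz_iff)
next
  assume *: "q - r \<in> \<int>"
  have "x - q \<in> \<int> \<longleftrightarrow> x - r \<in> \<int>" for x
    using Ints_add[OF _ *, of "x - q"] Ints_diff[OF _ *, of "x - r"] by auto
  then show "qz q = qz r" by (auto simp: qz_iff)
qed

lemma comm_group_rational: "comm_group rational_group"
proof (rule comm_groupI)
  fix x assume "x \<in> carrier rational_group"
  show "\<exists>y\<in>carrier rational_group. y \<otimes>\<^bsub>rational_group\<^esub> x = \<one>\<^bsub>rational_group\<^esub>"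
    by (rule bexI[of _ "- x"]) (auto simp: rational_group_def)
qed (auto simp: rational_group_def)

lemma subgroup_Ints: "subgroup \<int> rational_group"
proof -
  interpret comm_group rational_group by (rule comm_group_rational)
  have inv: "inv\<^bsub>rational_group\<^esub> x = - x" for x
    by (rule inv_equality) (auto simp: rational_group_def)
  show ?thesis
    by standard (unfold inv, auto simp: rational_group_def)
qed

lemma comm_group_QmodZ: "comm_group QmodZ"
  unfolding QmodZ_def by (rule comm_group.abelian_FactGroup[OF comm_group_rational subgroup_Ints])

interpretation QZ: comm_group QmodZ by (rule comm_group_QmodZ)

lemma carrier_QmodZ: "carrier QmodZ = range qz"
  unfolding QmodZ_def carrier_FactGroup qz_def by (simp add: rational_group_def)

lemma qz_closed [simp]: "qz q \<in> carrier QmodZ" by (simp add: carrier_QmodZ)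

lemma qz_mult [simp]: "qz q \<otimes>\<^bsub>QmodZ\<^esub> qz r = qz (q + r)"
proof -
  interpret normal \<int> rational_group
    using comm_group.subgroup_imp_normal[OF comm_group_rational subgroup_Ints] .
  show ?thesis
    unfolding QmodZ_def qz_def using rcos_sum[of q r] by (simp add: rational_group_def)
qed

lemma qz_one: "\<one>\<^bsub>QmodZ\<^esub> = qz 0"
  by (metis QZ.l_cancel_one add.right_neutral qz_closed qz_mult)

lemma qz_eq_one_iff: "qz q = \<one>\<^bsub>QmodZ\<^esub> \<longleftrightarrow> q \<in> \<int>"
  by (simp add: qz_one qz_eq_iff)

lemma qz_inv [simp]: "inv\<^bsub>QmodZ\<^esub> qz q = qz (- q)"
  by (rule QZ.inv_equality) (simp_all add: qz_one)

lemma qz_nat_pow: "qz q [^]\<^bsub>QmodZ\<^esub> (n::nat) = qz (of_nat n * q)"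
  by (induction n) (simp_all add: qz_one algebra_simps)

lemma qz_int_pow: "qz q [^]\<^bsub>QmodZ\<^esub> (n::int) = qz (of_int n * q)"
  by (simp add: int_pow_def2 qz_nat_pow)

text \<open>Divisibility is what lets a character be extended by one more element: in
  \<open>svs_extend\<close> the value at the new element has to be a root of a prescribed
  value.\<close>

lemma QmodZ_divisible:
  assumes "y \<in> carrier QmodZ" "(d::int) \<noteq> 0"
  obtains t where "t \<in> carrier QmodZ" "t [^]\<^bsub>QmodZ\<^esub> d = y"
proof -
  obtain q where q: "y = qz q" using assms by (auto simp: carrier_QmodZ)
  show thesis
    by (rule that[of "qz (q / of_int d)"]) (use assms q in \<open>auto simp: qz_int_pow\<close>)
qed

text \<open>An arbitrary lift to the rationals. It is additive only up to integers, which is why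
  characters later appear as rational functions whose defect lies in \<open>\<int>\<close>.\<close>

definition qz_rep :: "rat set \<Rightarrow> rat" where
  "qz_rep c = (SOME q. c = qz q)"

lemma qz_rep [simp]: "c \<in> carrier QmodZ \<Longrightarrow> qz (qz_rep c) = c"
  unfolding qz_rep_def carrier_QmodZ by (metis (mono_tags) imageE someI_ex)

section \<open>Injectivity\<close>

text \<open>
  Graphs of homomorphisms from a subgroup to \<open>\<rat>/\<int>\<close>, ordered by inclusion for the use of Zorn's lemma.
\<close>

definition single_valued_subgroup :: "('b, 'x) monoid_scheme \<Rightarrow> ('b \<times> rat set) set \<Rightarrow> bool" where
  "single_valued_subgroup B \<Gamma> \<longleftrightarrow> subgroup \<Gamma> (B \<times>\<times> QmodZ) \<and> (\<forall>y. (\<one>\<^bsub>B\<^esub>, y) \<in> \<Gamma> \<longrightarrow> y = \<one>\<^bsub>QmodZ\<^esub>)"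

context comm_group begin

lemma svs_memD:
  assumes "single_valued_subgroup G \<Gamma>" "(a, y) \<in> \<Gamma>"
  shows "a \<in> carrier G" "y \<in> carrier QmodZ"
  using assms subgroup.subset[of \<Gamma> "G \<times>\<times> QmodZ"] by (auto simp: single_valued_subgroup_def)

lemma svs_mult:
  assumes "single_valued_subgroup G \<Gamma>" "(a, y) \<in> \<Gamma>" "(b, z) \<in> \<Gamma>"
  shows "(a \<otimes> b, y \<otimes>\<^bsub>QmodZ\<^esub> z) \<in> \<Gamma>"
  using assms subgroup.m_closed[of \<Gamma> "G \<times>\<times> QmodZ" "(a,y)" "(b,z)"] by (auto simp: single_valued_subgroup_def)

lemma svs_inv:
  assumes "single_valued_subgroup G \<Gamma>" "(a, y) \<in> \<Gamma>"
  shows "(inv a, inv\<^bsub>QmodZ\<^esub> y) \<in> \<Gamma>"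
  using assms subgroup.m_inv_closed[of \<Gamma> "G \<times>\<times> QmodZ" "(a,y)"] svs_memD[OF assms]
  by (auto simp: single_valued_subgroup_def inv_DirProd is_group QZ.is_group)

lemma svs_one:
  assumes "single_valued_subgroup G \<Gamma>"
  shows "(\<one>, \<one>\<^bsub>QmodZ\<^esub>) \<in> \<Gamma>"
proof -
  have "\<one>\<^bsub>G \<times>\<times> QmodZ\<^esub> \<in> \<Gamma>"
    using assms subgroup.one_closed unfolding single_valued_subgroup_def by blast
  then show ?thesis by (simp only: one_DirProd)
qed

lemma svs_int_pow:
  assumes "single_valued_subgroup G \<Gamma>" "(a, y) \<in> \<Gamma>"
  shows "(a [^] (n::int), y [^]\<^bsub>QmodZ\<^esub> n) \<in> \<Gamma>"
proof -
  have nat: "(a [^] (m::nat), y [^]\<^bsub>QmodZ\<^esub> m) \<in> \<Gamma>" for m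
  proof (induction m)
    case 0 show ?case using svs_one[OF assms(1)] by simp
  next
    case (Suc m) show ?case using svs_mult[OF assms(1) Suc assms(2)] by simp
  qed
  show ?thesis
  proof (cases n)
    case (nonneg m)
    then show ?thesis using nat[of m] by (simp add: int_pow_int)
  next
    case (neg m)
    note mem = svs_memD[OF assms]
    show ?thesis using svs_inv[OF assms(1) nat[of "Suc m"]] mem
      unfolding neg by (metis int_pow_int int_pow_neg QZ.int_pow_neg)
  qed
qed

lemma svs_unique:
  assumes "single_valued_subgroup G \<Gamma>" "(a, y) \<in> \<Gamma>" "(a, z) \<in> \<Gamma>"
  shows "y = z"
proof -
  have "(a \<otimes> inv a, y \<otimes>\<^bsub>QmodZ\<^esub> inv\<^bsub>QmodZ\<^esub> z) \<in> \<Gamma>"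
    using assms svs_mult svs_inv by blast
  then have "y \<otimes>\<^bsub>QmodZ\<^esub> inv\<^bsub>QmodZ\<^esub> z = \<one>\<^bsub>QmodZ\<^esub>"
    using assms svs_memD[OF assms(1)] by (auto simp: single_valued_subgroup_def)
  then show ?thesis
    using assms svs_memD[OF assms(1)] QZ.inv_solve_right' by (metis QZ.l_one QZ.one_closed)
qed

text \<open>One step of Baer's argument. The exponents n for which x^n lies in the domain of
  \<open>\<Gamma>\<close> form an ideal of the integers; if d generates it, a value t at x is
  admissible as soon as t^d is the value at x^d.\<close>

lemma svs_extend:
  assumes \<Gamma>: "single_valued_subgroup G \<Gamma>" and x: "x \<in> carrier G"
  obtains \<Gamma>' t where "single_valued_subgroup G \<Gamma>'" "\<Gamma> \<subseteq> \<Gamma>'" "(x, t) \<in> \<Gamma>'"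
proof -
  define D where "D = {n::int. \<exists>y. (x [^] n, y) \<in> \<Gamma>}"
  have D_diff: "m - n * k \<in> D" if "m \<in> D" "n \<in> D" for m n k
  proof -
    from that obtain y z where *: "(x [^] m, y) \<in> \<Gamma>" "(x [^] n, z) \<in> \<Gamma>" by (auto simp: D_def)
    have "(x [^] m \<otimes> inv ((x [^] n) [^] k), y \<otimes>\<^bsub>QmodZ\<^esub> inv\<^bsub>QmodZ\<^esub> (z [^]\<^bsub>QmodZ\<^esub> k)) \<in> \<Gamma>"
      using * svs_mult svs_inv svs_int_pow \<Gamma> by blast
    then show ?thesis
      using x by (auto simp: D_def int_pow_pow int_pow_diff)
  qed
  have "\<exists>t\<in>carrier QmodZ. \<forall>n y. (x [^] n, y) \<in> \<Gamma> \<longrightarrow> y = t [^]\<^bsub>QmodZ\<^esub> (n::int)"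
  proof (cases "\<exists>n\<in>D. n > 0")
    \<comment> \<open>Here D is {0}, so the only constraint on t comes from x^0, and the trivial t
      meets it.\<close>
    case False
    have "n = 0" if "n \<in> D" for n
    proof (rule ccontr)
      assume "n \<noteq> 0"
      have "0 - n * 1 \<in> D" using D_diff[OF D_diff[OF that that, of 1] that, of 1] by simp
      with False that \<open>n \<noteq> 0\<close> show False
        by (metis diff_0 linorder_neqE_linordered_idom mult.right_neutral neg_0_less_iff_less)
    qed
    then show ?thesis
      using \<Gamma> by (intro bexI[of _ "\<one>\<^bsub>QmodZ\<^esub>"]) (force simp: D_def single_valued_subgroup_def)+
  next
    case True
    define d where "d = (LEAST n. n > 0 \<and> int n \<in> D)"
    have "\<exists>n. n > 0 \<and> int n \<in> D" using True by (metis zero_less_imp_eq_int)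
    then have d: "d > 0" "int d \<in> D" unfolding d_def by (smt (verit, ccfv_SIG) LeastI)+
    have dvd: "int d dvd n" if "n \<in> D" for n
    proof (rule ccontr)
      assume "\<not> int d dvd n"
      then have "n mod int d \<noteq> 0" by (metis dvd_eq_mod_eq_0)
      then have pos: "n mod int d > 0" "n mod int d < int d"
        using d(1) pos_mod_sign[of "int d" n] pos_mod_bound[of "int d" n] by linarith+
      have "n - int d * (n div int d) \<in> D" using D_diff that d by blast
      then have "int (nat (n mod int d)) \<in> D" using pos by (simp add: minus_mult_div_eq_mod)
      then have "(LEAST m. m > 0 \<and> int m \<in> D) \<le> nat (n mod int d)" using pos by (intro Least_le conjI) auto
      then have "d \<le> nat (n mod int d)" by (simp only: d_def)
      with pos show False by linarith
    qed
    obtain y where y: "(x [^] int d, y) \<in> \<Gamma>" using d by (auto simp: D_def)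
    obtain t where t: "t \<in> carrier QmodZ" "t [^]\<^bsub>QmodZ\<^esub> int d = y"
      using QmodZ_divisible[of y "int d"] svs_memD[OF \<Gamma> y] d by auto
    have "z = t [^]\<^bsub>QmodZ\<^esub> n" if n: "(x [^] n, z) \<in> \<Gamma>" for n :: int and z
    proof -
      obtain k where k: "n = int d * k" using dvd n by (auto simp: D_def)
      have "(x [^] n, t [^]\<^bsub>QmodZ\<^esub> n) \<in> \<Gamma>"
        using svs_int_pow[OF \<Gamma> y, of k] t(1) x
        by (simp add: k int_pow_pow QZ.int_pow_pow flip: t(2))
      then show ?thesis using svs_unique \<Gamma> n by blast
    qed
    then show ?thesis using t by blast
  qed
  then obtain t where t: "t \<in> carrier QmodZ" 
    and tn: "\<And>n y. (x [^] n, y) \<in> \<Gamma> \<Longrightarrow> y = t [^]\<^bsub>QmodZ\<^esub> (n::int)" by blast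
  \<comment> \<open>The subgroup generated by \<open>\<Gamma>\<close> and (x, t). It stays
    single-valued because a x^n = 1 puts x^n = a^-1 into the domain of \<open>\<Gamma>\<close>,
    where its value is t^n.\<close>
  define \<Gamma>' where "\<Gamma>' = {(a \<otimes> x [^] n, y \<otimes>\<^bsub>QmodZ\<^esub> t [^]\<^bsub>QmodZ\<^esub> n) | a y n. (a, y) \<in> \<Gamma> \<and> (n::int) \<in> UNIV}"
  have I: "(a \<otimes> x [^] n, y \<otimes>\<^bsub>QmodZ\<^esub> t [^]\<^bsub>QmodZ\<^esub> n) \<in> \<Gamma>'" if "(a, y) \<in> \<Gamma>" for a y and n :: int
    using that unfolding \<Gamma>'_def by blast
  note mem = svs_memD[OF \<Gamma>]
  have sub: "subgroup \<Gamma>' (G \<times>\<times> QmodZ)"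
  proof (rule group.subgroupI[OF DirProd_group[OF is_group QZ.is_group]])
    show "\<Gamma>' \<subseteq> carrier (G \<times>\<times> QmodZ)" using mem x t by (auto simp: \<Gamma>'_def)
    show "\<Gamma>' \<noteq> {}" using svs_one[OF \<Gamma>] I by blast
  next
    fix p assume "p \<in> \<Gamma>'"
    then obtain a y n where p: "p = (a \<otimes> x [^] n, y \<otimes>\<^bsub>QmodZ\<^esub> t [^]\<^bsub>QmodZ\<^esub> n)" "(a, y) \<in> \<Gamma>" "(n::int) \<in> UNIV"
      unfolding \<Gamma>'_def by blast
    have "inv\<^bsub>G \<times>\<times> QmodZ\<^esub> p = (inv a \<otimes> x [^] (-n), inv\<^bsub>QmodZ\<^esub> y \<otimes>\<^bsub>QmodZ\<^esub> t [^]\<^bsub>QmodZ\<^esub> (-n))"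
      using mem[OF p(2)] x t
      by (simp add: p(1) inv_DirProd is_group QZ.is_group inv_mult QZ.inv_mult int_pow_neg QZ.int_pow_neg)
    then show "inv\<^bsub>G \<times>\<times> QmodZ\<^esub> p \<in> \<Gamma>'" using I svs_inv[OF \<Gamma> p(2)] by simp
  next
    fix p r assume "p \<in> \<Gamma>'" "r \<in> \<Gamma>'"
    then obtain a y n b z m where p: "p = (a \<otimes> x [^] n, y \<otimes>\<^bsub>QmodZ\<^esub> t [^]\<^bsub>QmodZ\<^esub> n)" "(a, y) \<in> \<Gamma>" 
      and r: "r = (b \<otimes> x [^] m, z \<otimes>\<^bsub>QmodZ\<^esub> t [^]\<^bsub>QmodZ\<^esub> m)" "(b, z) \<in> \<Gamma>" 
      and nm: "(n::int) \<in> UNIV" "(m::int) \<in> UNIV"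
      unfolding \<Gamma>'_def by blast
    have "p \<otimes>\<^bsub>G \<times>\<times> QmodZ\<^esub> r = ((a \<otimes> b) \<otimes> x [^] (n+m), (y \<otimes>\<^bsub>QmodZ\<^esub> z) \<otimes>\<^bsub>QmodZ\<^esub> t [^]\<^bsub>QmodZ\<^esub> (n+m))"
      using mem[OF p(2)] mem[OF r(2)] x t
      by (simp add: p(1) r(1) int_pow_mult QZ.int_pow_mult m_ac QZ.m_ac)
    then show "p \<otimes>\<^bsub>G \<times>\<times> QmodZ\<^esub> r \<in> \<Gamma>'" using I svs_mult[OF \<Gamma> p(2) r(2)] by simp
  qed
  have one: "y \<otimes>\<^bsub>QmodZ\<^esub> t [^]\<^bsub>QmodZ\<^esub> n = \<one>\<^bsub>QmodZ\<^esub>" if "(a, y) \<in> \<Gamma>" "a \<otimes> x [^] n = \<one>" for a y and n::int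
  proof -
    have "inv a = x [^] n" 
      using that mem[OF that(1)] x by (metis inv_equality int_pow_closed m_comm)
    then have "inv\<^bsub>QmodZ\<^esub> y = t [^]\<^bsub>QmodZ\<^esub> n"
      using tn svs_inv[OF \<Gamma> that(1)] by simp
    then show ?thesis using mem[OF that(1)] by (metis QZ.r_inv)
  qed
  have "single_valued_subgroup G \<Gamma>'"
    unfolding single_valued_subgroup_def
  proof (intro conjI allI impI sub)
    fix y assume "(\<one>, y) \<in> \<Gamma>'"
    then obtain a z n where "(a, z) \<in> \<Gamma>" "\<one> = a \<otimes> x [^] (n::int)" "y = z \<otimes>\<^bsub>QmodZ\<^esub> t [^]\<^bsub>QmodZ\<^esub> n"
      unfolding \<Gamma>'_def by blast
    then show "y = \<one>\<^bsub>QmodZ\<^esub>" using one by metis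
  qed
  moreover have "\<Gamma> \<subseteq> \<Gamma>'"
  proof
    fix p assume "p \<in> \<Gamma>"
    then show "p \<in> \<Gamma>'" using I[of "fst p" "snd p" 0] mem[of "fst p" "snd p"] by simp
  qed
  moreover have "(x, t) \<in> \<Gamma>'" using I[OF svs_one[OF \<Gamma>], of 1] x t by (simp add: int_pow_1)
  ultimately show thesis using that by blast
qed

text \<open>A maximal graph has full domain by \<open>svs_extend\<close>. The union of a chain is
  again a subgroup since any two of its elements lie in a common member.\<close>

lemma svs_total:
  assumes \<Gamma>: "single_valued_subgroup G \<Gamma>"
  obtains l where "l \<in> hom G QmodZ" "\<And>a y. (a, y) \<in> \<Gamma> \<Longrightarrow> l a = y"
proof -
  define A where "A = {\<Delta>. \<Gamma> \<subseteq> \<Delta> \<and> single_valued_subgroup G \<Delta>}"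
  have "\<exists>M\<in>A. \<forall>Y\<in>A. M \<subseteq> Y \<longrightarrow> Y = M"
  proof (rule subset_Zorn_nonempty)
    show "A \<noteq> {}" using \<Gamma> by (auto simp: A_def)
    fix C assume ne: "C \<noteq> {}" and ch: "subset.chain A C"
    have CC: "single_valued_subgroup G Y" "\<Gamma> \<subseteq> Y" if "Y \<in> C" for Y
      using that ch by (auto simp: A_def subset_chain_def)
    have "subgroup (\<Union>C) (G \<times>\<times> QmodZ)"
    proof (rule group.subgroupI[OF DirProd_group[OF is_group QZ.is_group]])
      show "\<Union>C \<subseteq> carrier (G \<times>\<times> QmodZ)" using CC svs_memD by fastforce
      show "\<Union>C \<noteq> {}" using ne CC svs_one by fastforce
    next
      fix p assume "p \<in> \<Union>C"
      then obtain Y where Y: "Y \<in> C" "p \<in> Y" by blast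
      then have "inv\<^bsub>G \<times>\<times> QmodZ\<^esub> p \<in> Y"
        using CC[of Y] subgroup.m_inv_closed[of Y "G \<times>\<times> QmodZ" p] by (auto simp: single_valued_subgroup_def)
      then show "inv\<^bsub>G \<times>\<times> QmodZ\<^esub> p \<in> \<Union>C" using Y by blast
    next
      fix p r assume "p \<in> \<Union>C" "r \<in> \<Union>C"
      then obtain Y Z' where Y: "Y \<in> C" "p \<in> Y" "Z' \<in> C" "r \<in> Z'" by blast
      have "Y \<subseteq> Z' \<or> Z' \<subseteq> Y" using ch Y by (auto simp: subset_chain_def)
      then obtain Z where Z: "Z \<in> C" "p \<in> Z" "r \<in> Z" using Y by blast
      then have "p \<otimes>\<^bsub>G \<times>\<times> QmodZ\<^esub> r \<in> Z"
        using CC[of Z] subgroup.m_closed[of Z "G \<times>\<times> QmodZ" p r] by (auto simp: single_valued_subgroup_def)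
      then show "p \<otimes>\<^bsub>G \<times>\<times> QmodZ\<^esub> r \<in> \<Union>C" using Z by blast
    qed
    moreover have "y = \<one>\<^bsub>QmodZ\<^esub>" if "(\<one>, y) \<in> \<Union>C" for y
      using that CC unfolding single_valued_subgroup_def by blast
    ultimately have "single_valued_subgroup G (\<Union>C)" by (simp add: single_valued_subgroup_def)
    moreover have "\<Gamma> \<subseteq> \<Union>C" using ne CC by blast
    ultimately show "\<Union>C \<in> A" by (simp add: A_def)
  qed
  then obtain M where M: "single_valued_subgroup G M" "\<Gamma> \<subseteq> M"
    and max: "\<And>Y. single_valued_subgroup G Y \<Longrightarrow> M \<subseteq> Y \<Longrightarrow> Y = M"
    unfolding A_def by (smt (verit) mem_Collect_eq subset_trans)
  have tot: "\<exists>t. (x, t) \<in> M" if "x \<in> carrier G" for x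
    using svs_extend[OF M(1) that] max by metis
  define l where "l x = (THE t. (x, t) \<in> M)" for x
  have l: "l x = t" if "(x, t) \<in> M" for x t
    unfolding l_def using svs_unique[OF M(1) _ that] by (rule the_equality[where P = "\<lambda>t. (x, t) \<in> M", OF that])
  have "l \<in> hom G QmodZ"
  proof (rule homI)
    fix x assume x: "x \<in> carrier G"
    show "l x \<in> carrier QmodZ" using tot[OF x] l svs_memD[OF M(1)] by metis
    fix y assume y: "y \<in> carrier G"
    show "l (x \<otimes> y) = l x \<otimes>\<^bsub>QmodZ\<^esub> l y" using tot[OF x] tot[OF y] l svs_mult[OF M(1)] by metis
  qed
  moreover have "l a = y" if "(a, y) \<in> \<Gamma>" for a y
    using that l M(2) by auto
  ultimately show thesis by (rule that)
qed

end

text \<open>That l is trivial on the kernel of f makes the pairs (f a, l a) a single-valued graph in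
  B times Q/Z. The same statement thus serves to extend a character from a subgroup and to let it
  descend to a quotient, also from a nonabelian A.\<close>

lemma QmodZ_injective:
  assumes A: "group A" and B: "comm_group B" and f: "f \<in> hom A B" and l: "l \<in> hom A QmodZ"
    and ker: "\<And>a. a \<in> carrier A \<Longrightarrow> f a = \<one>\<^bsub>B\<^esub> \<Longrightarrow> l a = \<one>\<^bsub>QmodZ\<^esub>"
  obtains l' where "l' \<in> hom B QmodZ" "\<And>a. a \<in> carrier A \<Longrightarrow> l' (f a) = l a"
proof -
  interpret A: group A by fact
  interpret B: comm_group B by fact
  define \<Gamma> where "\<Gamma> = (\<lambda>a. (f a, l a)) ` carrier A"
  have "(\<lambda>a. (f a, l a)) \<in> hom A (B \<times>\<times> QmodZ)"
    using f l by (auto simp: hom_def)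
  then have "subgroup \<Gamma> (B \<times>\<times> QmodZ)"
    unfolding \<Gamma>_def
    by (intro group_hom.img_is_subgroup group_hom.intro group_hom_axioms.intro A
        DirProd_group B.is_group QZ.is_group)
  then have "single_valued_subgroup B \<Gamma>"
    using ker by (auto simp: single_valued_subgroup_def \<Gamma>_def)
  from B.svs_total[OF this] show thesis
    using that unfolding \<Gamma>_def by (metis (mono_tags, lifting) imageI)
qed

section \<open>Finite duality\<close>

lemma carrier_QZ_dual: "carrier (QZ_dual M) = hom M QmodZ \<inter> extensional (carrier M)"
  by (simp add: QZ_dual_def)

lemma mult_QZ_dual: "\<chi> \<otimes>\<^bsub>QZ_dual M\<^esub> \<psi> = (\<lambda>x\<in>carrier M. \<chi> x \<otimes>\<^bsub>QmodZ\<^esub> \<psi> x)"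
  by (simp add: QZ_dual_def product_group_def)

lemma one_QZ_dual: "\<one>\<^bsub>QZ_dual M\<^esub> = (\<lambda>x\<in>carrier M. \<one>\<^bsub>QmodZ\<^esub>)"
  by (simp add: QZ_dual_def product_group_def)

lemma restrict_in_QZ_dual:
  assumes "group M" "l \<in> hom M QmodZ" shows "restrict l (carrier M) \<in> carrier (QZ_dual M)"
proof -
  interpret group M by fact
  show ?thesis using assms(2) by (auto simp: carrier_QZ_dual hom_def)
qed

lemma comm_group_QZ_dual:
  assumes "group M" shows "comm_group (QZ_dual M)"
proof (rule comm_groupI)
  interpret M: group M by fact
  have mem: "\<chi> x \<in> carrier QmodZ" if "\<chi> \<in> carrier (QZ_dual M)" "x \<in> carrier M" for \<chi> x
    using that by (auto simp: carrier_QZ_dual hom_def)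
  have mul: "\<chi> (x \<otimes>\<^bsub>M\<^esub> y) = \<chi> x \<otimes>\<^bsub>QmodZ\<^esub> \<chi> y" 
    if "\<chi> \<in> carrier (QZ_dual M)" "x \<in> carrier M" "y \<in> carrier M" for \<chi> x y
    using that by (auto simp: carrier_QZ_dual hom_def)
  have ext: "\<chi> = \<psi>" if "\<chi> \<in> carrier (QZ_dual M)" "\<psi> \<in> carrier (QZ_dual M)" "\<And>x. x \<in> carrier M \<Longrightarrow> \<chi> x = \<psi> x" for \<chi> \<psi>
    using that by (auto simp: carrier_QZ_dual intro: extensionalityI)
  note closed = restrict_in_QZ_dual[OF M.is_group]
  {
    fix \<chi> \<psi> assume *: "\<chi> \<in> carrier (QZ_dual M)" "\<psi> \<in> carrier (QZ_dual M)"
    show "\<chi> \<otimes>\<^bsub>QZ_dual M\<^esub> \<psi> \<in> carrier (QZ_dual M)"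
      unfolding mult_QZ_dual
      by (rule closed, rule homI) (use * in \<open>simp_all add: mem mul QZ.m_ac\<close>)
    show "\<chi> \<otimes>\<^bsub>QZ_dual M\<^esub> \<psi> = \<psi> \<otimes>\<^bsub>QZ_dual M\<^esub> \<chi>"
      using * by (auto simp: mult_QZ_dual mem QZ.m_comm intro!: restrict_ext)
  }
  show "\<one>\<^bsub>QZ_dual M\<^esub> \<in> carrier (QZ_dual M)"
    unfolding one_QZ_dual by (rule closed, rule homI) auto
  show "\<chi> \<otimes>\<^bsub>QZ_dual M\<^esub> \<psi> \<otimes>\<^bsub>QZ_dual M\<^esub> \<phi> = \<chi> \<otimes>\<^bsub>QZ_dual M\<^esub> (\<psi> \<otimes>\<^bsub>QZ_dual M\<^esub> \<phi>)"
    if "\<chi> \<in> carrier (QZ_dual M)" "\<psi> \<in> carrier (QZ_dual M)" "\<phi> \<in> carrier (QZ_dual M)" for \<chi> \<psi> \<phi>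
    using that by (auto simp: mult_QZ_dual mem QZ.m_assoc intro!: restrict_ext)
  fix \<chi> assume *: "\<chi> \<in> carrier (QZ_dual M)"
  show "\<one>\<^bsub>QZ_dual M\<^esub> \<otimes>\<^bsub>QZ_dual M\<^esub> \<chi> = \<chi>"
  proof -
    have "\<one>\<^bsub>QZ_dual M\<^esub> \<otimes>\<^bsub>QZ_dual M\<^esub> \<chi> = restrict \<chi> (carrier M)"
      using * by (auto simp: mult_QZ_dual one_QZ_dual mem intro!: restrict_ext)
    then show ?thesis using * by (simp add: carrier_QZ_dual extensional_restrict)
  qed
  show "\<exists>y\<in>carrier (QZ_dual M). y \<otimes>\<^bsub>QZ_dual M\<^esub> \<chi> = \<one>\<^bsub>QZ_dual M\<^esub>"
  proof (rule bexI)
    show "(\<lambda>x\<in>carrier M. inv\<^bsub>QmodZ\<^esub> \<chi> x) \<in> carrier (QZ_dual M)"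
      by (rule closed, rule homI) (use * in \<open>simp_all add: mem mul QZ.inv_mult\<close>)
    show "(\<lambda>x\<in>carrier M. inv\<^bsub>QmodZ\<^esub> \<chi> x) \<otimes>\<^bsub>QZ_dual M\<^esub> \<chi> = \<one>\<^bsub>QZ_dual M\<^esub>"
      using * by (auto simp: mult_QZ_dual one_QZ_dual mem intro!: restrict_ext)
  qed
qed

text \<open>The embedding of Q/Z in the unit circle by exp(2 pi i q), so that values of characters
  can be added up; \<open>qz_exp_qz\<close> removes the dependence on the representative.\<close>

definition qz_exp :: "rat set \<Rightarrow> complex" where
  "qz_exp c = cis (2 * pi * of_rat (qz_rep c))"

lemma qz_exp_qz: "qz_exp (qz q) = cis (2 * pi * of_rat q)"
proof -
  have "qz (qz_rep (qz q)) = qz q" by simp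
  then have "qz_rep (qz q) - q \<in> \<int>" by (simp only: qz_eq_iff)
  then obtain n where "qz_rep (qz q) - q = of_int n" by (auto elim: Ints_cases)
  then have "qz_rep (qz q) = q + of_int n" by simp
  then have "2 * pi * of_rat (qz_rep (qz q)) = 2 * pi * of_rat q + 2 * pi * of_int n"
    by (simp add: of_rat_add algebra_simps)
  then show ?thesis by (simp add: qz_exp_def flip: cis_mult)
qed

lemma qz_exp_mult:
  assumes "x \<in> carrier QmodZ" "y \<in> carrier QmodZ"
  shows "qz_exp (x \<otimes>\<^bsub>QmodZ\<^esub> y) = qz_exp x * qz_exp y"
  using assms by (auto simp: carrier_QmodZ qz_exp_qz cis_mult of_rat_add algebra_simps)

lemma qz_exp_eq_1:
  assumes "x \<in> carrier QmodZ" "qz_exp x = 1"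
  shows "x = \<one>\<^bsub>QmodZ\<^esub>"
proof -
  obtain q where q: "x = qz q" using assms by (auto simp: carrier_QmodZ)
  then have "cos (2 * pi * of_rat q) = 1"
    using assms by (simp add: qz_exp_qz complex_eq_iff)
  then obtain n :: int where "2 * pi * real_of_rat q = of_int n * 2 * pi"
    using cos_one_2pi_int by blast
  then have "real_of_rat q = real_of_rat (of_int n)" by simp
  then have "q = of_int n" by (simp only: of_rat_eq_iff)
  then show ?thesis by (simp add: q qz_eq_one_iff)
qed

lemma qz_exp_one [simp]: "qz_exp \<one>\<^bsub>QmodZ\<^esub> = 1"
  by (simp add: qz_one qz_exp_qz)

text \<open>Replacing x by a x permutes the summands and multiplies the sum by
  \<open>qz_exp (\<chi> a)\<close>, which is not 1.\<close>

lemma sum_qz_exp_eq_0: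
  assumes A: "group A" and \<chi>: "\<chi> \<in> hom A QmodZ"
    and a: "a \<in> carrier A" "\<chi> a \<noteq> \<one>\<^bsub>QmodZ\<^esub>"
  shows "(\<Sum>x\<in>carrier A. qz_exp (\<chi> x)) = 0"
proof -
  interpret A: group A by fact
  have mem: "\<chi> x \<in> carrier QmodZ" if "x \<in> carrier A" for x using \<chi> that by (auto simp: hom_def)
  have "(\<Sum>x\<in>carrier A. qz_exp (\<chi> x)) = (\<Sum>x\<in>carrier A. qz_exp (\<chi> (a \<otimes>\<^bsub>A\<^esub> x)))"
    by (rule sum.reindex_bij_witness[of _ "\<lambda>x. a \<otimes>\<^bsub>A\<^esub> x" "\<lambda>x. inv\<^bsub>A\<^esub> a \<otimes>\<^bsub>A\<^esub> x"])
       (use a in \<open>auto simp flip: A.m_assoc\<close>)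
  also have "\<dots> = qz_exp (\<chi> a) * (\<Sum>x\<in>carrier A. qz_exp (\<chi> x))"
    using a \<chi> by (simp add: sum_distrib_left hom_mult[OF \<chi>] qz_exp_mult mem)
  finally have "(1 - qz_exp (\<chi> a)) * (\<Sum>x\<in>carrier A. qz_exp (\<chi> x)) = 0"
    by (simp add: algebra_simps)
  then show ?thesis using qz_exp_eq_1[OF mem[OF a(1)]] a(2) by auto
qed

text \<open>If a has order m, sending a^n to n/m is a faithful character of the cyclic group
  generated by a; injectivity of Q/Z extends it to all of A.\<close>

lemma QZ_dual_separates:
  assumes A: "comm_group A" "finite (carrier A)" and a: "a \<in> carrier A" "a \<noteq> \<one>\<^bsub>A\<^esub>"
  obtains \<chi> where "\<chi> \<in> carrier (QZ_dual A)" "\<chi> a \<noteq> \<one>\<^bsub>QmodZ\<^esub>"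
proof -
  interpret A: comm_group A by fact
  define m where "m = A.ord a"
  have m: "m > 1" using A.ord_ge_1[OF A(2) a(1)] A.ord_eq_1[OF a(1)] a(2) by (simp add: m_def)
  have f: "(\<lambda>n::int. a [^]\<^bsub>A\<^esub> n) \<in> hom integer_group A"
    using a by (intro homI) (auto simp: A.int_pow_mult)
  have l: "(\<lambda>n::int. qz (of_int n / of_nat m)) \<in> hom integer_group QmodZ"
    by (intro homI) (auto simp: add_divide_distrib)
  obtain l' where l': "l' \<in> hom A QmodZ" 
    "\<And>n. n \<in> carrier integer_group \<Longrightarrow> l' (a [^]\<^bsub>A\<^esub> n) = qz (of_int n / of_nat m)"
  proof (rule QmodZ_injective[OF group_integer_group A(1) f l])
    fix n :: int assume "a [^]\<^bsub>A\<^esub> n = \<one>\<^bsub>A\<^esub>"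
    then have "int m dvd n" using a by (simp add: m_def A.int_pow_eq_id)
    then show "qz (of_int n / of_nat m) = \<one>\<^bsub>QmodZ\<^esub>"
      using m by (auto simp: qz_eq_one_iff)
  qed auto
  have "l' a = qz (1 / of_nat m)" using l'(2)[of 1] a by (simp add: A.int_pow_1)
  moreover have "(1 / of_nat m :: rat) \<notin> \<int>"
  proof
    assume "(1 / of_nat m :: rat) \<in> \<int>"
    then obtain k where "1 / of_nat m = (of_int k :: rat)" by (auto elim: Ints_cases)
    then have "(1::rat) = of_int (k * int m)" using m by (simp add: field_simps)
    then have "1 = k * int m" by (metis of_int_1 of_int_eq_iff)
    then show False using m by (metis dvd_triv_right int_dvd_int_iff nat_dvd_1_iff_1 of_nat_1 less_irrefl)
  qed
  ultimately have "l' a \<noteq> \<one>\<^bsub>QmodZ\<^esub>" by (simp add: qz_eq_one_iff)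
  then show thesis
    using that[OF restrict_in_QZ_dual[OF A.is_group l'(1)]] a by simp
qed

text \<open>Every value is killed by the order n of A, hence is the class of some i/n with i < n, so
  a character is one of finitely many functions into these classes.\<close>

lemma finite_QZ_dual:
  assumes A: "group A" "finite (carrier A)"
  shows "finite (carrier (QZ_dual A))"
proof -
  interpret A: group A by fact
  define n where "n = Coset.order A"
  have n: "n > 0" unfolding n_def using A.order_gt_0_iff_finite A(2) by blast
  define V where "V = (\<lambda>i. qz (of_nat i / of_nat n)) ` {..<n}"
  have "\<chi> a \<in> V" if \<chi>: "\<chi> \<in> carrier (QZ_dual A)" and a: "a \<in> carrier A" for \<chi> a
  proof -
    have hom: "\<chi> \<in> hom A QmodZ" using \<chi> by (simp add: carrier_QZ_dual)
    interpret h: group_hom A QmodZ \<chi>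
      using hom A.is_group QZ.is_group by (intro group_hom.intro group_hom_axioms.intro)
    obtain q where q: "\<chi> a = qz q" using h.hom_closed[OF a] by (auto simp: carrier_QmodZ)
    have "qz (of_nat n * q) = \<one>\<^bsub>QmodZ\<^esub>"
      using h.hom_nat_pow[OF a, of n] A.pow_order_eq_1[OF a] by (simp add: q qz_nat_pow n_def)
    then obtain k where "of_nat n * q = of_int k" by (auto simp: qz_eq_one_iff elim: Ints_cases)
    then have qk: "q = of_int k / of_nat n" using n by (simp add: field_simps)
    have kk: "k = k mod int n + int n * (k div int n)" by simp
    have "q = of_int (k mod int n) / of_nat n + of_int (k div int n)"
    proof -
      have "(of_int k :: rat) = of_int (k mod int n) + of_nat n * of_int (k div int n)"
        by (metis kk of_int_add of_int_mult of_int_of_nat_eq)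
      then show ?thesis unfolding qk using n by (simp add: add_divide_distrib)
    qed
    then have "\<chi> a = qz (of_nat (nat (k mod int n)) / of_nat n)"
      using n by (simp add: q qz_eq_iff)
    moreover have "nat (k mod int n) < n" using n by (simp add: nat_less_iff)
    ultimately show ?thesis unfolding V_def by blast
  qed
  then have "carrier (QZ_dual A) \<subseteq> carrier A \<rightarrow>\<^sub>E V"
    by (auto simp: carrier_QZ_dual PiE_def)
  moreover have "finite (carrier A \<rightarrow>\<^sub>E V)" using A(2) by (auto intro!: finite_PiE simp: V_def)
  ultimately show ?thesis by (rule finite_subset)
qed

lemma QZ_dual_eval_hom:
  assumes "a \<in> carrier A" shows "(\<lambda>\<chi>. \<chi> a) \<in> hom (QZ_dual A) QmodZ"
  using assms by (intro homI) (auto simp: mult_QZ_dual carrier_QZ_dual hom_def)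

text \<open>
  By orthogonality, summing \<open>qz_exp (\<chi> a)\<close> over all pairs gives the order of the dual when summed over
  \<open>\<chi>\<close> first and the order of the group when summed over \<open>a\<close> first.
\<close>

lemma card_QZ_dual:
  assumes A: "comm_group A" "finite (carrier A)"
  shows "card (carrier (QZ_dual A)) = card (carrier A)"
proof -
  interpret A: comm_group A by fact
  interpret D: comm_group "QZ_dual A" by (rule comm_group_QZ_dual[OF A.is_group])
  note fin = finite_QZ_dual[OF A.is_group A(2)]
  have one: "\<chi> \<one>\<^bsub>A\<^esub> = \<one>\<^bsub>QmodZ\<^esub>" if "\<chi> \<in> carrier (QZ_dual A)" for \<chi>
    using that hom_one[of \<chi> A QmodZ] A.is_group QZ.is_group by (auto simp: carrier_QZ_dual)
  have "(\<Sum>a\<in>carrier A. \<Sum>\<chi>\<in>carrier (QZ_dual A). qz_exp (\<chi> a)) 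
      = (\<Sum>a\<in>carrier A. if a = \<one>\<^bsub>A\<^esub> then of_nat (card (carrier (QZ_dual A))) else 0)"
  proof (rule sum.cong[OF refl])
    fix a assume a: "a \<in> carrier A"
    show "(\<Sum>\<chi>\<in>carrier (QZ_dual A). qz_exp (\<chi> a)) =
      (if a = \<one>\<^bsub>A\<^esub> then of_nat (card (carrier (QZ_dual A))) else 0)"
    proof (cases "a = \<one>\<^bsub>A\<^esub>")
      case True then show ?thesis by (simp add: one)
    next
      case False
      then obtain \<chi> where "\<chi> \<in> carrier (QZ_dual A)" "\<chi> a \<noteq> \<one>\<^bsub>QmodZ\<^esub>"
        using QZ_dual_separates[OF A a] by blast
      then show ?thesis
        using sum_qz_exp_eq_0[OF D.is_group QZ_dual_eval_hom[OF a], of \<chi>] False by simp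
    qed
  qed
  then have 1: "(\<Sum>a\<in>carrier A. \<Sum>\<chi>\<in>carrier (QZ_dual A). qz_exp (\<chi> a)) = of_nat (card (carrier (QZ_dual A)))"
    using A(2) by simp
  have "(\<Sum>\<chi>\<in>carrier (QZ_dual A). \<Sum>a\<in>carrier A. qz_exp (\<chi> a)) 
      = (\<Sum>\<chi>\<in>carrier (QZ_dual A). if \<chi> = \<one>\<^bsub>QZ_dual A\<^esub> then of_nat (card (carrier A)) else 0)"
  proof (rule sum.cong[OF refl])
    fix \<chi> assume \<chi>: "\<chi> \<in> carrier (QZ_dual A)"
    show "(\<Sum>a\<in>carrier A. qz_exp (\<chi> a)) = (if \<chi> = \<one>\<^bsub>QZ_dual A\<^esub> then of_nat (card (carrier A)) else 0)"
    proof (cases "\<forall>a\<in>carrier A. \<chi> a = \<one>\<^bsub>QmodZ\<^esub>")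
      case True
      then have "\<chi> = \<one>\<^bsub>QZ_dual A\<^esub>"
        using \<chi> by (auto simp: one_QZ_dual carrier_QZ_dual intro: extensionalityI[of _ "carrier A"])
      then show ?thesis using True by simp
    next
      case False
      then obtain a where a: "a \<in> carrier A" "\<chi> a \<noteq> \<one>\<^bsub>QmodZ\<^esub>" by blast
      then have "\<chi> \<noteq> \<one>\<^bsub>QZ_dual A\<^esub>" by (auto simp: one_QZ_dual)
      moreover have "\<chi> \<in> hom A QmodZ" using \<chi> by (simp add: carrier_QZ_dual)
      ultimately show ?thesis using sum_qz_exp_eq_0[of A \<chi> a] A.is_group a by simp
    qed
  qed
  then have 2: "(\<Sum>\<chi>\<in>carrier (QZ_dual A). \<Sum>a\<in>carrier A. qz_exp (\<chi> a)) = of_nat (card (carrier A))"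
    using fin by simp
  have "(of_nat (card (carrier (QZ_dual A))) :: complex) = of_nat (card (carrier A))"
    unfolding 1[symmetric] 2[symmetric] by (rule sum.swap)
  then show ?thesis by simp
qed

text \<open>Evaluation at points is injective because characters separate points. By
  \<open>card_QZ_dual\<close>, used for A and for its dual, source and target have the same finite
  size, so it is onto.\<close>

lemma QZ_bidual:
  assumes A: "comm_group A" "finite (carrier A)" and \<Lambda>: "\<Lambda> \<in> hom (QZ_dual A) QmodZ"
  obtains a where "a \<in> carrier A" "\<And>\<chi>. \<chi> \<in> carrier (QZ_dual A) \<Longrightarrow> \<Lambda> \<chi> = \<chi> a"
proof -
  interpret A: comm_group A by fact
  interpret D: comm_group "QZ_dual A" by (rule comm_group_QZ_dual[OF A.is_group])
  note fin = finite_QZ_dual[OF A.is_group A(2)]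
  define ev where "ev a = (\<lambda>\<chi>\<in>carrier (QZ_dual A). \<chi> a)" for a :: 'a
  have sub: "ev ` carrier A \<subseteq> carrier (QZ_dual (QZ_dual A))"
    unfolding ev_def using restrict_in_QZ_dual[OF D.is_group QZ_dual_eval_hom] by blast
  have inj: "inj_on ev (carrier A)"
  proof (rule inj_onI, rule ccontr)
    fix a b assume a: "a \<in> carrier A" and b: "b \<in> carrier A" and eq: "ev a = ev b" and "a \<noteq> b"
    then have "a \<otimes>\<^bsub>A\<^esub> inv\<^bsub>A\<^esub> b \<noteq> \<one>\<^bsub>A\<^esub>" by (metis A.inv_equality A.inv_inv A.inv_closed)
    then obtain \<chi> where \<chi>: "\<chi> \<in> carrier (QZ_dual A)" "\<chi> (a \<otimes>\<^bsub>A\<^esub> inv\<^bsub>A\<^esub> b) \<noteq> \<one>\<^bsub>QmodZ\<^esub>"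
      using QZ_dual_separates[OF A, of "a \<otimes>\<^bsub>A\<^esub> inv\<^bsub>A\<^esub> b"] a b by auto
    interpret h: group_hom A QmodZ \<chi>
      using \<chi> A.is_group QZ.is_group by (intro group_hom.intro group_hom_axioms.intro) (auto simp: carrier_QZ_dual)
    have "\<chi> a = \<chi> b" using eq \<chi>(1) unfolding ev_def by (metis restrict_apply')
    then show False using \<chi>(2) a b by simp
  qed
  have "ev ` carrier A = carrier (QZ_dual (QZ_dual A))"
  proof (rule card_subset_eq[OF _ sub])
    show "finite (carrier (QZ_dual (QZ_dual A)))" by (rule finite_QZ_dual[OF D.is_group fin])
    show "card (ev ` carrier A) = card (carrier (QZ_dual (QZ_dual A)))"
      by (simp add: card_image[OF inj] card_QZ_dual[OF comm_group_QZ_dual[OF A.is_group] fin] card_QZ_dual[OF A])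
  qed
  then obtain a where "a \<in> carrier A" "restrict \<Lambda> (carrier (QZ_dual A)) = ev a"
    using restrict_in_QZ_dual[OF D.is_group \<Lambda>] by blast
  then show thesis using that unfolding ev_def by (metis restrict_apply')
qed

section \<open>Second cohomology\<close>

lemma comm_group_product_group:
  assumes "\<And>i. i \<in> I \<Longrightarrow> comm_group (F i)"
  shows "comm_group (product_group I F)"
proof -
  have "group (product_group I F)" using assms by (intro product_group) (rule comm_group.axioms(2))
  then show ?thesis
    by (rule group.group_comm_groupI)
       (auto intro!: restrict_ext comm_monoid.m_comm comm_group.axioms(1) assms)
qed

lemma comm_group_subgroup:
  assumes "comm_group C" "subgroup S C" shows "comm_group (C\<lparr>carrier := S\<rparr>)"
proof -
  interpret comm_group C by fact
  have "group (C\<lparr>carrier := S\<rparr>)" using assms(2) by (rule subgroup_imp_group)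
  then show ?thesis
    by (rule group.group_comm_groupI) (use subgroup.subset[OF assms(2)] in \<open>auto intro: m_comm\<close>)
qed

locale group_module = group G + M: comm_group M
  for G :: "('g, 'x) monoid_scheme" (structure) and M :: "('m, 'y) monoid_scheme" +
  fixes act :: "'g \<Rightarrow> 'm \<Rightarrow> 'm"
  assumes act_hom: "g \<in> carrier G \<Longrightarrow> act g \<in> hom M M"
    and act_mult: "\<lbrakk>g \<in> carrier G; h \<in> carrier G; m \<in> carrier M\<rbrakk> \<Longrightarrow> act (g \<otimes> h) m = act g (act h m)"
begin

lemma act_closed [simp]: "\<lbrakk>g \<in> carrier G; m \<in> carrier M\<rbrakk> \<Longrightarrow> act g m \<in> carrier M"
  using act_hom by (auto simp: hom_def)

lemma act_distrib: 
  "\<lbrakk>g \<in> carrier G; m \<in> carrier M; n \<in> carrier M\<rbrakk> \<Longrightarrow> act g (m \<otimes>\<^bsub>M\<^esub> n) = act g m \<otimes>\<^bsub>M\<^esub> act g n"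
  using act_hom by (auto simp: hom_def)

lemma act_group_hom: "g \<in> carrier G \<Longrightarrow> group_hom M M (act g)"
  using act_hom by (simp add: group_hom_def group_hom_axioms_def M.is_group)

lemma act_one: "g \<in> carrier G \<Longrightarrow> act g \<one>\<^bsub>M\<^esub> = \<one>\<^bsub>M\<^esub>"
  using group_hom.hom_one[OF act_group_hom] .

lemma act_inv: "\<lbrakk>g \<in> carrier G; m \<in> carrier M\<rbrakk> \<Longrightarrow> act g (inv\<^bsub>M\<^esub> m) = inv\<^bsub>M\<^esub> (act g m)"
  using group_hom.hom_inv[OF act_group_hom] by blast

lemma subgroup_module:
  assumes "subgroup S G" shows "group_module (G\<lparr>carrier := S\<rparr>) M act"
proof -
  interpret S: group "G\<lparr>carrier := S\<rparr>" using assms by (rule subgroup_imp_group)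
  show ?thesis
    by standard (use subgroup.mem_carrier[OF assms] act_hom act_mult in auto)
qed

abbreviation "Z2 \<equiv> cocycles2 G M act"
abbreviation "B2 \<equiv> coboundaries2 G M act"
abbreviation "Z2_group \<equiv> (cochains2 G M)\<lparr>carrier := Z2\<rparr>"
abbreviation "H2 \<equiv> cohom2 G M act"
abbreviation "cls \<equiv> cohom2_class G M act"

lemma comm_group_cochains2: "comm_group (cochains2 G M)"
  unfolding cochains2_def by (rule comm_group_product_group) (rule M.comm_group_axioms)

lemma cochains2_mult: 
  "c \<otimes>\<^bsub>cochains2 G M\<^esub> d = (\<lambda>p\<in>carrier G \<times> carrier G. c p \<otimes>\<^bsub>M\<^esub> d p)"
  by (simp add: cochains2_def)

lemma cochains2_inv: 
  "c \<in> carrier (cochains2 G M) \<Longrightarrow> inv\<^bsub>cochains2 G M\<^esub> c = (\<lambda>p\<in>carrier G \<times> carrier G. inv\<^bsub>M\<^esub> c p)"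
  by (simp add: cochains2_def)

lemma cocycles2_closed: "\<lbrakk>c \<in> Z2; g1 \<in> carrier G; g2 \<in> carrier G\<rbrakk> \<Longrightarrow> c (g1, g2) \<in> carrier M"
  by (auto simp: cocycles2_def cochains2_def)

lemma cocycles2I:
  assumes "\<And>g1 g2. \<lbrakk>g1 \<in> carrier G; g2 \<in> carrier G\<rbrakk> \<Longrightarrow> c (g1, g2) \<in> carrier M"
    and "c \<in> extensional (carrier G \<times> carrier G)"
    and "\<And>g1 g2 g3. \<lbrakk>g1 \<in> carrier G; g2 \<in> carrier G; g3 \<in> carrier G\<rbrakk> \<Longrightarrow>
        act g1 (c (g2, g3)) \<otimes>\<^bsub>M\<^esub> c (g1, g2 \<otimes> g3) = c (g1 \<otimes> g2, g3) \<otimes>\<^bsub>M\<^esub> c (g1, g2)"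
  shows "c \<in> Z2"
  using assms by (auto simp: cocycles2_def cochains2_def PiE_def)

lemma cocycles2D:
  assumes "c \<in> Z2" "g1 \<in> carrier G" "g2 \<in> carrier G" "g3 \<in> carrier G"
  shows "act g1 (c (g2, g3)) \<otimes>\<^bsub>M\<^esub> c (g1, g2 \<otimes> g3) = c (g1 \<otimes> g2, g3) \<otimes>\<^bsub>M\<^esub> c (g1, g2)"
  using assms by (auto simp: cocycles2_def)

lemma subgroup_cocycles2: "subgroup Z2 (cochains2 G M)"
proof (rule group.subgroupI)
  show "group (cochains2 G M)" using comm_group_cochains2 by (rule comm_group.axioms)
  show "Z2 \<subseteq> carrier (cochains2 G M)" by (auto simp: cocycles2_def)
  have "(\<lambda>p\<in>carrier G \<times> carrier G. \<one>\<^bsub>M\<^esub>) \<in> Z2" by (rule cocycles2I) (auto simp: act_one)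
  then show "Z2 \<noteq> {}" by blast
next
  fix c assume c: "c \<in> Z2"
  note cc = cocycles2_closed[OF c]
  have "inv\<^bsub>cochains2 G M\<^esub> c = (\<lambda>p\<in>carrier G \<times> carrier G. inv\<^bsub>M\<^esub> c p)"
    using c by (intro cochains2_inv) (auto simp: cocycles2_def)
  also have "\<dots> \<in> Z2"
    by (rule cocycles2I)
       (use cocycles2D[OF c] in \<open>auto simp: cc act_inv simp flip: M.inv_mult\<close>)
  finally show "inv\<^bsub>cochains2 G M\<^esub> c \<in> Z2" .
next
  fix c d assume c: "c \<in> Z2" and d: "d \<in> Z2"
  note cc = cocycles2_closed[OF c] cocycles2_closed[OF d]
  show "c \<otimes>\<^bsub>cochains2 G M\<^esub> d \<in> Z2"
    unfolding cochains2_mult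
  proof (rule cocycles2I)
    fix g1 g2 g3 assume g: "g1 \<in> carrier G" "g2 \<in> carrier G" "g3 \<in> carrier G"
    have "act g1 (c (g2, g3) \<otimes>\<^bsub>M\<^esub> d (g2, g3)) \<otimes>\<^bsub>M\<^esub> (c (g1, g2 \<otimes> g3) \<otimes>\<^bsub>M\<^esub> d (g1, g2 \<otimes> g3))
       = (act g1 (c (g2, g3)) \<otimes>\<^bsub>M\<^esub> c (g1, g2 \<otimes> g3)) \<otimes>\<^bsub>M\<^esub> (act g1 (d (g2, g3)) \<otimes>\<^bsub>M\<^esub> d (g1, g2 \<otimes> g3))"
      using g by (simp add: act_distrib cc M.m_ac)
    also have "\<dots> = (c (g1 \<otimes> g2, g3) \<otimes>\<^bsub>M\<^esub> c (g1, g2)) \<otimes>\<^bsub>M\<^esub> (d (g1 \<otimes> g2, g3) \<otimes>\<^bsub>M\<^esub> d (g1, g2))"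
      using g by (simp add: cocycles2D[OF c] cocycles2D[OF d])
    also have "\<dots> = (c (g1 \<otimes> g2, g3) \<otimes>\<^bsub>M\<^esub> d (g1 \<otimes> g2, g3)) \<otimes>\<^bsub>M\<^esub> (c (g1, g2) \<otimes>\<^bsub>M\<^esub> d (g1, g2))"
      using g by (simp add: cc M.m_ac)
    finally show "act g1 ((\<lambda>p\<in>carrier G \<times> carrier G. c p \<otimes>\<^bsub>M\<^esub> d p) (g2, g3)) \<otimes>\<^bsub>M\<^esub>
        (\<lambda>p\<in>carrier G \<times> carrier G. c p \<otimes>\<^bsub>M\<^esub> d p) (g1, g2 \<otimes> g3) =
      (\<lambda>p\<in>carrier G \<times> carrier G. c p \<otimes>\<^bsub>M\<^esub> d p) (g1 \<otimes> g2, g3) \<otimes>\<^bsub>M\<^esub>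
        (\<lambda>p\<in>carrier G \<times> carrier G. c p \<otimes>\<^bsub>M\<^esub> d p) (g1, g2)"
      using g by simp
  qed (auto simp: cc)
qed

lemma comm_group_Z2: "comm_group Z2_group"
  by (rule comm_group_subgroup[OF comm_group_cochains2 subgroup_cocycles2])

definition cobd :: "('g \<Rightarrow> 'm) \<Rightarrow> 'g \<times> 'g \<Rightarrow> 'm" where
  "cobd b = (\<lambda>(g1, g2) \<in> carrier G \<times> carrier G.
        act g1 (b g2) \<otimes>\<^bsub>M\<^esub> inv\<^bsub>M\<^esub> (b (g1 \<otimes> g2)) \<otimes>\<^bsub>M\<^esub> b g1)"

lemma coboundaries2_eq: "B2 = cobd ` (carrier G \<rightarrow>\<^sub>E carrier M)"
  by (simp add: coboundaries2_def cobd_def)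

lemma cobd_apply [simp]:
  "\<lbrakk>g1 \<in> carrier G; g2 \<in> carrier G\<rbrakk> \<Longrightarrow> 
     cobd b (g1, g2) = act g1 (b g2) \<otimes>\<^bsub>M\<^esub> inv\<^bsub>M\<^esub> (b (g1 \<otimes> g2)) \<otimes>\<^bsub>M\<^esub> b g1"
  by (simp add: cobd_def)

lemma cobd_cocycle:
  assumes b: "b \<in> carrier G \<rightarrow> carrier M"
  shows "cobd b \<in> Z2"
proof (rule cocycles2I)
  have bc: "g \<in> carrier G \<Longrightarrow> b g \<in> carrier M" for g using b by auto
  \<comment> \<open>The identity behind the vanishing of a double coboundary, in six independent
    letters: q, which stands for g1 b(g2 g3), cancels on the left, and u, which stands for b(g1 g2),
    on the right.\<close>
  have aux: "(p \<otimes>\<^bsub>M\<^esub> inv\<^bsub>M\<^esub> q \<otimes>\<^bsub>M\<^esub> r) \<otimes>\<^bsub>M\<^esub> (q \<otimes>\<^bsub>M\<^esub> inv\<^bsub>M\<^esub> s \<otimes>\<^bsub>M\<^esub> t) =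
     (p \<otimes>\<^bsub>M\<^esub> inv\<^bsub>M\<^esub> s \<otimes>\<^bsub>M\<^esub> u) \<otimes>\<^bsub>M\<^esub> (r \<otimes>\<^bsub>M\<^esub> inv\<^bsub>M\<^esub> u \<otimes>\<^bsub>M\<^esub> t)"
    if "p \<in> carrier M" "q \<in> carrier M" "r \<in> carrier M" "s \<in> carrier M" "t \<in> carrier M" "u \<in> carrier M"
    for p q r s t u
  proof -
    have "(p \<otimes>\<^bsub>M\<^esub> inv\<^bsub>M\<^esub> q \<otimes>\<^bsub>M\<^esub> r) \<otimes>\<^bsub>M\<^esub> (q \<otimes>\<^bsub>M\<^esub> inv\<^bsub>M\<^esub> s \<otimes>\<^bsub>M\<^esub> t) 
        = (inv\<^bsub>M\<^esub> q \<otimes>\<^bsub>M\<^esub> q) \<otimes>\<^bsub>M\<^esub> (p \<otimes>\<^bsub>M\<^esub> r \<otimes>\<^bsub>M\<^esub> inv\<^bsub>M\<^esub> s \<otimes>\<^bsub>M\<^esub> t)"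
      using that by (simp only: M.m_ac M.m_closed M.inv_closed)
    also have "\<dots> = (inv\<^bsub>M\<^esub> u \<otimes>\<^bsub>M\<^esub> u) \<otimes>\<^bsub>M\<^esub> (p \<otimes>\<^bsub>M\<^esub> r \<otimes>\<^bsub>M\<^esub> inv\<^bsub>M\<^esub> s \<otimes>\<^bsub>M\<^esub> t)"
      using that by simp
    also have "\<dots> = (p \<otimes>\<^bsub>M\<^esub> inv\<^bsub>M\<^esub> s \<otimes>\<^bsub>M\<^esub> u) \<otimes>\<^bsub>M\<^esub> (r \<otimes>\<^bsub>M\<^esub> inv\<^bsub>M\<^esub> u \<otimes>\<^bsub>M\<^esub> t)"
      using that by (simp only: M.m_ac M.m_closed M.inv_closed)
    finally show ?thesis .
  qed
  show "cobd b \<in> extensional (carrier G \<times> carrier G)" by (auto simp: cobd_def extensional_def)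
  fix g1 g2 assume g12: "g1 \<in> carrier G" "g2 \<in> carrier G"
  then show "cobd b (g1, g2) \<in> carrier M" by (simp add: bc)
  fix g3 assume g3: "g3 \<in> carrier G"
  show "act g1 (cobd b (g2, g3)) \<otimes>\<^bsub>M\<^esub> cobd b (g1, g2 \<otimes> g3) = cobd b (g1 \<otimes> g2, g3) \<otimes>\<^bsub>M\<^esub> cobd b (g1, g2)"
    using g12 g3 aux[of "act g1 (act g2 (b g3))" "act g1 (b (g2 \<otimes> g3))" "act g1 (b g2)" "b (g1 \<otimes> (g2 \<otimes> g3))" "b g1" "b (g1 \<otimes> g2)"]
    by (simp add: bc act_distrib act_inv act_mult m_assoc)
qed

lemma cobd_mult:
  assumes b: "b \<in> carrier G \<rightarrow> carrier M" and c: "c \<in> carrier G \<rightarrow> carrier M"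
  shows "cobd (\<lambda>g\<in>carrier G. b g \<otimes>\<^bsub>M\<^esub> c g) = cobd b \<otimes>\<^bsub>cochains2 G M\<^esub> cobd c"
proof -
  have bc: "g \<in> carrier G \<Longrightarrow> b g \<in> carrier M" "g \<in> carrier G \<Longrightarrow> c g \<in> carrier M" for g using b c by auto
  show ?thesis
    by (auto simp: cochains2_mult cobd_def bc act_distrib M.inv_mult M.m_ac intro!: restrict_ext)
qed

lemma subgroup_coboundaries2: "subgroup B2 Z2_group"
proof -
  have "cobd \<in> hom (product_group (carrier G) (\<lambda>_. M)) Z2_group"
    by (rule homI) (auto simp: cobd_mult cobd_cocycle PiE_def)
  then have "group_hom (product_group (carrier G) (\<lambda>_. M)) Z2_group cobd"
    using comm_group.axioms(2)[OF comm_group_Z2] M.is_group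
    by (intro group_hom.intro group_hom_axioms.intro) auto
  from group_hom.img_is_subgroup[OF this] show ?thesis
    by (simp add: coboundaries2_eq)
qed

lemma coboundaries2_subset: "B2 \<subseteq> Z2"
  using subgroup.subset[OF subgroup_coboundaries2] by simp

lemma comm_group_H2: "comm_group H2"
  unfolding cohom2_def by (rule comm_group.abelian_FactGroup[OF comm_group_Z2 subgroup_coboundaries2])

lemma normal_coboundaries2: "B2 \<lhd> Z2_group"
  using comm_group.subgroup_imp_normal[OF comm_group_Z2 subgroup_coboundaries2] .

lemma cls_eq: "cls c = B2 #>\<^bsub>Z2_group\<^esub> c"
  by (simp add: cohom2_class_def)

lemma carrier_H2: "carrier H2 = cls ` Z2"
  by (auto simp: cohom2_def carrier_FactGroup cls_eq)

lemma one_H2: "\<one>\<^bsub>H2\<^esub> = B2"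
  by (simp add: cohom2_def)

lemma cls_hom: "cls \<in> hom Z2_group H2"
proof -
  have "cls = (\<lambda>c. B2 #>\<^bsub>Z2_group\<^esub> c)" by (rule ext) (rule cls_eq)
  then show ?thesis
    using normal.r_coset_hom_Mod[OF normal_coboundaries2] by (simp only: cohom2_def)
qed

lemma cls_mult: "\<lbrakk>c \<in> Z2; d \<in> Z2\<rbrakk> \<Longrightarrow> cls (c \<otimes>\<^bsub>cochains2 G M\<^esub> d) = cls c \<otimes>\<^bsub>H2\<^esub> cls d"
  using cls_hom by (auto simp: hom_def)

lemma cls_closed: "c \<in> Z2 \<Longrightarrow> cls c \<in> carrier H2"
  by (auto simp: carrier_H2)

lemma cls_eq_one_iff: "c \<in> Z2 \<Longrightarrow> cls c = \<one>\<^bsub>H2\<^esub> \<longleftrightarrow> c \<in> B2"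
proof -
  assume c: "c \<in> Z2"
  interpret Z: comm_group Z2_group by (rule comm_group_Z2)
  interpret B: subgroup B2 Z2_group by (rule subgroup_coboundaries2)
  show "cls c = \<one>\<^bsub>H2\<^esub> \<longleftrightarrow> c \<in> B2"
    unfolding cls_eq one_H2 using Z.coset_join1[of B2 c] Z.coset_join2[of c B2] c coboundaries2_subset
      subgroup_coboundaries2 by auto
qed

lemma cls_mem: "\<lbrakk>c \<in> Z2; x \<in> cls c\<rbrakk> \<Longrightarrow> \<exists>b\<in>B2. x = b \<otimes>\<^bsub>cochains2 G M\<^esub> c"
  by (auto simp: cohom2_class_def r_coset_def)

lemma cls_self: "c \<in> Z2 \<Longrightarrow> c \<in> cls c"
  unfolding cls_eq using subgroup.rcos_module_rev comm_group_Z2 subgroup_coboundaries2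
  by (metis (no_types, lifting) comm_group.axioms(2) group.rcos_self partial_object.select_convs(1) partial_object.surjective partial_object.update_convs(1))

text \<open>\<open>cohom2_res\<close> and \<open>cohom2_map\<close> are unions over all
  representatives of a class. For a homomorphism F of cocycles that preserves coboundaries all
  members of the union coincide, and both maps can be computed on one representative.\<close>

lemma UN_cls:
  assumes "group_module G' M' act'"
    and F: "F \<in> hom Z2_group ((cochains2 G' M')\<lparr>carrier := cocycles2 G' M' act'\<rparr>)"
    and FB: "\<And>b. b \<in> B2 \<Longrightarrow> F b \<in> coboundaries2 G' M' act'" and c: "c \<in> Z2"
  shows "(\<Union>x\<in>cls c. cohom2_class G' M' act' (F x)) = cohom2_class G' M' act' (F c)"
proof -
  interpret N: group_module G' M' act' by fact
  interpret NH: comm_group "cohom2 G' M' act'" by (rule N.comm_group_H2)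
  have Fc: "F x \<in> cocycles2 G' M' act'" if "x \<in> Z2" for x using F that by (auto simp: hom_def)
  have "cohom2_class G' M' act' (F x) = cohom2_class G' M' act' (F c)" if xc: "x \<in> cls c" for x
  proof -
    obtain b where b: "b \<in> B2" "x = b \<otimes>\<^bsub>cochains2 G M\<^esub> c" using cls_mem[OF c xc] by blast
    have bZ: "b \<in> Z2" using b coboundaries2_subset by blast
    have "F x = F b \<otimes>\<^bsub>cochains2 G' M'\<^esub> F c" using F b c bZ by (auto simp: hom_def)
    then have "N.cls (F x) = N.cls (F b) \<otimes>\<^bsub>N.H2\<^esub> N.cls (F c)"
      using N.cls_mult[OF Fc[OF bZ] Fc[OF c]] by simp
    also have "N.cls (F b) = \<one>\<^bsub>N.H2\<^esub>"
      using N.cls_eq_one_iff[OF Fc[OF bZ]] FB[OF b(1)] by blast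
    finally show ?thesis using N.cls_closed[OF Fc[OF c]] by simp
  qed
  then show ?thesis using cls_self[OF c] by blast
qed

section \<open>Restriction to a subgroup\<close>

abbreviation res :: "'g set \<Rightarrow> ('g \<times> 'g \<Rightarrow> 'm) \<Rightarrow> ('g \<times> 'g \<Rightarrow> 'm)" where
  "res S c \<equiv> (\<lambda>p\<in>S \<times> S. c p)"

context
  fixes S assumes S: "subgroup S G"
begin

interpretation S: group_module "G\<lparr>carrier := S\<rparr>" M act by (rule subgroup_module[OF S])

lemma res_hom: "res S \<in> hom Z2_group S.Z2_group"
proof (rule homI)
  have SG: "x \<in> carrier G" if "x \<in> S" for x using that subgroup.subset[OF S] by blast
  have Sm: "x \<otimes> y \<in> S" if "x \<in> S" "y \<in> S" for x y using that S by (simp add: subgroup.m_closed)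
  fix c assume "c \<in> carrier Z2_group"
  then have c: "c \<in> Z2" by simp
  have "res S c \<in> S.Z2"
    by (rule S.cocycles2I) (use cocycles2_closed[OF c] cocycles2D[OF c] SG Sm in auto)
  then show "res S c \<in> carrier S.Z2_group" by simp
  fix d
  show "res S (c \<otimes>\<^bsub>Z2_group\<^esub> d) = res S c \<otimes>\<^bsub>S.Z2_group\<^esub> res S d"
    using SG by (auto simp: cochains2_mult S.cochains2_mult intro!: restrict_ext)
qed

lemma res_coboundary:
  assumes "b \<in> B2" shows "res S b \<in> S.B2"
proof -
  have SG: "x \<in> carrier G" if "x \<in> S" for x using that subgroup.subset[OF S] by blast
  have Sm: "x \<otimes> y \<in> S" if "x \<in> S" "y \<in> S" for x y using that S by (simp add: subgroup.m_closed)
  obtain u where u: "u \<in> carrier G \<rightarrow>\<^sub>E carrier M" "b = cobd u" using assms by (auto simp: coboundaries2_eq)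
  have "res S b = S.cobd (restrict u S)"
    using SG Sm by (auto simp: u(2) S.cobd_def cobd_def intro!: restrict_ext)
  moreover have "restrict u S \<in> carrier (G\<lparr>carrier := S\<rparr>) \<rightarrow>\<^sub>E carrier M" using u SG by auto
  ultimately show ?thesis unfolding S.coboundaries2_eq by blast
qed

lemma cohom2_res_cls: "c \<in> Z2 \<Longrightarrow> cohom2_res G M act S (cls c) = S.cls (res S c)"
  unfolding cohom2_res_def by (rule UN_cls[OF S.group_module_axioms res_hom res_coboundary])

lemma cohom2_res_one_iff:
  assumes "c \<in> Z2"
  shows "cohom2_res G M act S (cls c) = \<one>\<^bsub>S.H2\<^esub> \<longleftrightarrow> res S c \<in> S.B2"
proof -
  have "res S c \<in> S.Z2" using res_hom assms by (auto simp: hom_def)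
  then show ?thesis by (simp add: cohom2_res_cls[OF assms] S.cls_eq_one_iff)
qed

end

section \<open>Classes that are trivial on all cyclic subgroups\<close>

abbreviation "Sha \<equiv> Sha2_omega G M act"

lemma cls_in_Sha_iff:
  assumes "c \<in> Z2"
  shows "cls c \<in> carrier Sha \<longleftrightarrow> 
    (\<forall>g\<in>carrier G. res (generate G {g}) c \<in> coboundaries2 (G\<lparr>carrier := generate G {g}\<rparr>) M act)"
  using cohom2_res_one_iff[OF generate_is_subgroup assms] cls_closed[OF assms]
  by (auto simp: Sha2_omega_def)

lemma Sha_cases:
  assumes "\<xi> \<in> carrier Sha"
  obtains c where "c \<in> Z2" "\<xi> = cls c"
  using assms by (auto simp: Sha2_omega_def carrier_H2)

lemma subgroup_Sha: "subgroup (carrier Sha) H2"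
proof -
  interpret H: comm_group H2 by (rule comm_group_H2)
  interpret Z: comm_group Z2_group by (rule comm_group_Z2)
  interpret cl: group_hom Z2_group H2 cls 
    using cls_hom Z.is_group H.is_group by (intro group_hom.intro group_hom_axioms.intro)
  have gen: "subgroup (generate G {g}) G" if "g \<in> carrier G" for g
    using that by (intro generate_is_subgroup) auto
  have SB: "subgroup (coboundaries2 (G\<lparr>carrier := generate G {g}\<rparr>) M act) 
    ((cochains2 (G\<lparr>carrier := generate G {g}\<rparr>) M)\<lparr>carrier := cocycles2 (G\<lparr>carrier := generate G {g}\<rparr>) M act\<rparr>)"
    and rh: "group_hom Z2_group ((cochains2 (G\<lparr>carrier := generate G {g}\<rparr>) M)\<lparr>carrier := cocycles2 (G\<lparr>carrier := generate G {g}\<rparr>) M act\<rparr>) (res (generate G {g}))"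
    if g: "g \<in> carrier G" for g
  proof -
    interpret S: group_module "G\<lparr>carrier := generate G {g}\<rparr>" M act using subgroup_module[OF gen[OF g]] .
    show "subgroup S.B2 S.Z2_group" by (rule S.subgroup_coboundaries2)
    show "group_hom Z2_group S.Z2_group (res (generate G {g}))"
      using res_hom[OF gen[OF g]] Z.is_group comm_group.axioms(2)[OF S.comm_group_Z2]
      by (intro group_hom.intro group_hom_axioms.intro)
  qed
  show ?thesis
  proof (rule H.subgroupI)
    show "carrier Sha \<subseteq> carrier H2" by (auto simp: Sha2_omega_def)
    have "cls \<one>\<^bsub>Z2_group\<^esub> \<in> carrier Sha"
      using group_hom.hom_one[OF rh] subgroup.one_closed[OF SB]
      by (subst cls_in_Sha_iff) (use Z.one_closed in auto)
    then show "carrier Sha \<noteq> {}" by blast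
  next
    fix \<xi> assume xi: "\<xi> \<in> carrier Sha"
    then obtain c where c: "c \<in> Z2" "\<xi> = cls c" by (rule Sha_cases)
    have "inv\<^bsub>H2\<^esub> \<xi> = cls (inv\<^bsub>Z2_group\<^esub> c)" using c cl.hom_inv[of c] by simp
    moreover have "cls (inv\<^bsub>Z2_group\<^esub> c) \<in> carrier Sha"
      using group_hom.hom_inv[OF rh, of _ c] subgroup.m_inv_closed[OF SB] xi c
      by (subst cls_in_Sha_iff) (use Z.inv_closed[of c] in \<open>auto simp: cls_in_Sha_iff\<close>)
    ultimately show "inv\<^bsub>H2\<^esub> \<xi> \<in> carrier Sha" by simp
  next
    fix \<xi> \<eta> assume xi: "\<xi> \<in> carrier Sha" "\<eta> \<in> carrier Sha"
    then obtain c d where c: "c \<in> Z2" "\<xi> = cls c" and d: "d \<in> Z2" "\<eta> = cls d" by (metis Sha_cases)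
    have "\<xi> \<otimes>\<^bsub>H2\<^esub> \<eta> = cls (c \<otimes>\<^bsub>Z2_group\<^esub> d)" using c d cls_mult by simp
    moreover have "cls (c \<otimes>\<^bsub>Z2_group\<^esub> d) \<in> carrier Sha"
      using group_hom.hom_mult[OF rh, of _ c d] subgroup.m_closed[OF SB] xi c d
      by (subst cls_in_Sha_iff) (use Z.m_closed[of c d] in \<open>auto simp: cls_in_Sha_iff\<close>)
    ultimately show "\<xi> \<otimes>\<^bsub>H2\<^esub> \<eta> \<in> carrier Sha" by simp
  qed
qed

lemma Sha_eq: "Sha = H2\<lparr>carrier := carrier Sha\<rparr>"
  by (simp add: Sha2_omega_def)

lemma comm_group_Sha: "comm_group Sha"
  by (subst Sha_eq) (rule comm_group_subgroup[OF comm_group_H2 subgroup_Sha])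

lemma mult_Sha: "(\<otimes>\<^bsub>Sha\<^esub>) = (\<otimes>\<^bsub>H2\<^esub>)" and one_Sha: "\<one>\<^bsub>Sha\<^esub> = \<one>\<^bsub>H2\<^esub>"
  by (simp_all add: Sha2_omega_def)

end

section \<open>Change of coefficients\<close>

locale module_hom = group_module G M act + N: group_module G N actN
  for G :: "('g, 'x) monoid_scheme" (structure) and M :: "('m, 'y) monoid_scheme" and act
    and N :: "('n, 'z) monoid_scheme" and actN +
  fixes \<phi> :: "'m \<Rightarrow> 'n"
  assumes phi_hom: "\<phi> \<in> hom M N"
    and phi_act: "\<lbrakk>g \<in> carrier G; m \<in> carrier M\<rbrakk> \<Longrightarrow> \<phi> (act g m) = actN g (\<phi> m)"
begin

abbreviation push :: "('g \<times> 'g \<Rightarrow> 'm) \<Rightarrow> 'g \<times> 'g \<Rightarrow> 'n" where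
  "push c \<equiv> (\<lambda>p \<in> carrier G \<times> carrier G. \<phi> (c p))"

lemma phi_closed [simp]: "m \<in> carrier M \<Longrightarrow> \<phi> m \<in> carrier N"
  using phi_hom by (auto simp: hom_def)

lemma phi_mult: "\<lbrakk>m \<in> carrier M; n \<in> carrier M\<rbrakk> \<Longrightarrow> \<phi> (m \<otimes>\<^bsub>M\<^esub> n) = \<phi> m \<otimes>\<^bsub>N\<^esub> \<phi> n"
  using phi_hom by (auto simp: hom_def)

lemma phi_inv: "m \<in> carrier M \<Longrightarrow> \<phi> (inv\<^bsub>M\<^esub> m) = inv\<^bsub>N\<^esub> (\<phi> m)"
  using phi_hom M.is_group N.M.is_group
  by (intro group_hom.hom_inv group_hom.intro group_hom_axioms.intro)

lemma push_hom: "push \<in> hom Z2_group N.Z2_group"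
proof (rule homI)
  fix c assume "c \<in> carrier Z2_group"
  then have c: "c \<in> Z2" by simp
  note cc = cocycles2_closed[OF c]
  have "push c \<in> N.Z2"
  proof (rule N.cocycles2I)
    fix g1 g2 g3 assume g: "g1 \<in> carrier G" "g2 \<in> carrier G" "g3 \<in> carrier G"
    then show "actN g1 (push c (g2, g3)) \<otimes>\<^bsub>N\<^esub> push c (g1, g2 \<otimes> g3) =
       push c (g1 \<otimes> g2, g3) \<otimes>\<^bsub>N\<^esub> push c (g1, g2)"
      using arg_cong[OF cocycles2D[OF c g], of \<phi>] by (simp add: phi_mult phi_act cc)
  qed (auto simp: cc)
  then show "push c \<in> carrier N.Z2_group" by simp
  fix d assume "d \<in> carrier Z2_group"
  then have d: "d \<in> Z2" by simp
  show "push (c \<otimes>\<^bsub>Z2_group\<^esub> d) = push c \<otimes>\<^bsub>N.Z2_group\<^esub> push d"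
    by (auto simp: cochains2_mult N.cochains2_mult phi_mult cc cocycles2_closed[OF d] intro!: restrict_ext)
qed

lemma push_coboundary:
  assumes "b \<in> B2" shows "push b \<in> N.B2"
proof -
  obtain u where u: "u \<in> carrier G \<rightarrow>\<^sub>E carrier M" "b = cobd u" using assms by (auto simp: coboundaries2_eq)
  have uc: "u g \<in> carrier M" if "g \<in> carrier G" for g using u(1) that by auto
  have "push b = N.cobd (\<lambda>g\<in>carrier G. \<phi> (u g))"
    by (auto simp: u(2) N.cobd_def cobd_def phi_mult phi_act phi_inv uc intro!: restrict_ext)
  moreover have "(\<lambda>g\<in>carrier G. \<phi> (u g)) \<in> carrier G \<rightarrow>\<^sub>E carrier N" by (auto simp: uc)
  ultimately show ?thesis unfolding N.coboundaries2_eq by blast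
qed

lemma cohom2_map_cls: "c \<in> Z2 \<Longrightarrow> cohom2_map G N actN \<phi> (cls c) = N.cls (push c)"
  unfolding cohom2_map_def by (rule UN_cls[OF N.group_module_axioms push_hom push_coboundary])

lemma push_cocycle: "c \<in> Z2 \<Longrightarrow> push c \<in> N.Z2"
  using push_hom by (auto simp: hom_def)

lemma subgroup_module_hom:
  assumes "subgroup S G" shows "module_hom (G\<lparr>carrier := S\<rparr>) M act N actN \<phi>"
proof -
  interpret S: group_module "G\<lparr>carrier := S\<rparr>" M act using subgroup_module[OF assms] .
  interpret SN: group_module "G\<lparr>carrier := S\<rparr>" N actN using N.subgroup_module[OF assms] .
  show ?thesis by standard (use phi_hom phi_act subgroup.subset[OF assms] in auto)
qed

text \<open>Restriction and change of coefficients commute on cochains, so a class that is trivial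
  on a cyclic subgroup has an image that is trivial there.\<close>

lemma Sha_map_hom: "cohom2_map G N actN \<phi> \<in> hom Sha N.Sha"
proof (rule homI)
  fix \<xi> assume xi: "\<xi> \<in> carrier Sha"
  then obtain c where c: "c \<in> Z2" "\<xi> = cls c" by (rule Sha_cases)
  have "N.cls (push c) \<in> carrier N.Sha"
  proof (subst N.cls_in_Sha_iff[OF push_cocycle[OF c(1)]], rule ballI)
    fix g assume g: "g \<in> carrier G"
    have gen: "subgroup (generate G {g}) G" using g by (intro generate_is_subgroup) auto
    interpret S: module_hom "G\<lparr>carrier := generate G {g}\<rparr>" M act N actN \<phi> by (rule subgroup_module_hom[OF gen])
    have "res (generate G {g}) c \<in> S.B2" using xi g c by (simp add: cls_in_Sha_iff)
    then have "S.push (res (generate G {g}) c) \<in> S.N.B2" by (rule S.push_coboundary)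
    moreover have "S.push (res (generate G {g}) c) = N.res (generate G {g}) (push c)"
      using subgroup.subset[OF gen] by (auto intro!: restrict_ext)
    ultimately show "N.res (generate G {g}) (push c) \<in> S.N.B2" by simp
  qed
  then show "cohom2_map G N actN \<phi> \<xi> \<in> carrier N.Sha" by (simp add: c cohom2_map_cls)
  fix \<eta> assume et: "\<eta> \<in> carrier Sha"
  then obtain d where d: "d \<in> Z2" "\<eta> = cls d" by (rule Sha_cases)
  have cd: "c \<otimes>\<^bsub>cochains2 G M\<^esub> d \<in> Z2"
    using c d subgroup.m_closed[OF subgroup_cocycles2] by blast
  have "cohom2_map G N actN \<phi> (\<xi> \<otimes>\<^bsub>Sha\<^esub> \<eta>) = N.cls (push (c \<otimes>\<^bsub>cochains2 G M\<^esub> d))"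
    using c d cd by (simp add: mult_Sha cohom2_map_cls flip: cls_mult)
  also have "push (c \<otimes>\<^bsub>cochains2 G M\<^esub> d) = push c \<otimes>\<^bsub>cochains2 G N\<^esub> push d"
    using hom_mult[OF push_hom, of c d] c d by simp
  also have "N.cls \<dots> = N.cls (push c) \<otimes>\<^bsub>N.H2\<^esub> N.cls (push d)"
    using c d by (intro N.cls_mult push_cocycle)
  finally show "cohom2_map G N actN \<phi> (\<xi> \<otimes>\<^bsub>Sha\<^esub> \<eta>) 
      = cohom2_map G N actN \<phi> \<xi> \<otimes>\<^bsub>N.Sha\<^esub> cohom2_map G N actN \<phi> \<eta>"
    using c d by (simp add: N.mult_Sha cohom2_map_cls)
qed

end

section \<open>Gluing homomorphisms on a cyclic group\<close>

text \<open>
  In the induction step the solution for \<open>I\<close> is corrected by an element killed by \<open>Gcd (d ` I)\<close>.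
  It exists because the order \<open>q\<close> of the error satisfies \<open>q * gcd (d x) (Gcd (d ` I)) dvd d i\<close> for all \<open>i\<close>.
\<close>

lemma QmodZ_crt:
  fixes d :: "'i \<Rightarrow> nat" and c :: "'i \<Rightarrow> rat set"
  assumes "finite I" and "\<And>i. i \<in> I \<Longrightarrow> d i > 0" and "\<And>i. i \<in> I \<Longrightarrow> c i \<in> carrier QmodZ"
    and "\<And>i j. \<lbrakk>i \<in> I; j \<in> I\<rbrakk> \<Longrightarrow> 
       c i [^]\<^bsub>QmodZ\<^esub> (d j div gcd (d i) (d j)) = c j [^]\<^bsub>QmodZ\<^esub> (d i div gcd (d i) (d j))"
  shows "\<exists>t\<in>carrier QmodZ. \<forall>i\<in>I. t [^]\<^bsub>QmodZ\<^esub> d i = c i"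
  using assms
proof (induction I)
  case empty then show ?case using QZ.one_closed by blast
next
  case (insert x I)
  have "\<exists>t\<in>carrier QmodZ. \<forall>i\<in>I. t [^]\<^bsub>QmodZ\<^esub> d i = c i"
    using insert.prems by (intro insert.IH) blast+
  then obtain t where t: "t \<in> carrier QmodZ" "\<And>i. i \<in> I \<Longrightarrow> t [^]\<^bsub>QmodZ\<^esub> d i = c i" by blast
  have dx: "d x > 0" and cx: "c x \<in> carrier QmodZ" using insert.prems by auto
  \<comment> \<open>The factor by which t misses the condition at x. The new solution is t z, where
    z^(d x) = y and z^(d i) = 1 for all i in I.\<close>
  define y where "y = c x \<otimes>\<^bsub>QmodZ\<^esub> inv\<^bsub>QmodZ\<^esub> (t [^]\<^bsub>QmodZ\<^esub> d x)"
  have y: "y \<in> carrier QmodZ" using t cx by (simp add: y_def)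
  define q where "q = QZ.ord y"
  define k where "k = Gcd (d ` I)"
  define r where "r = gcd (d x) k"
  have "q * r dvd d i" if i: "i \<in> I" for i
  proof -
    define l where "l = gcd (d x) (d i)"
    have di: "d i > 0" using insert.prems i by auto
    have e: "d x * (d i div l) = d i * (d x div l)"
      by (metis l_def div_mult_swap gcd_dvd1 gcd_dvd2 mult.commute)
    \<comment> \<open>The compatibility of c x with c i turns the first factor into the same power
      of t as the one inverted in the second.\<close>
    have "y [^]\<^bsub>QmodZ\<^esub> (d i div l) = c x [^]\<^bsub>QmodZ\<^esub> (d i div l) \<otimes>\<^bsub>QmodZ\<^esub> inv\<^bsub>QmodZ\<^esub> (t [^]\<^bsub>QmodZ\<^esub> (d x * (d i div l)))"
      using t cx by (simp add: y_def QZ.nat_pow_distrib QZ.nat_pow_pow flip: QZ.nat_pow_inv)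
    also have "c x [^]\<^bsub>QmodZ\<^esub> (d i div l) = c i [^]\<^bsub>QmodZ\<^esub> (d x div l)"
      using insert.prems(3)[of x i] i by (simp add: l_def)
    also have "\<dots> = t [^]\<^bsub>QmodZ\<^esub> (d i * (d x div l))"
      using t(1) by (simp add: QZ.nat_pow_pow flip: t(2)[OF i])
    finally have "y [^]\<^bsub>QmodZ\<^esub> (d i div l) = \<one>\<^bsub>QmodZ\<^esub>"
      using t(1) by (simp add: e)
    then have "q dvd d i div l" using y by (simp add: q_def QZ.pow_eq_id)
    then have "q * l dvd d i" using di by (simp add: l_def dvd_div_iff_mult)
    moreover have "r dvd l" unfolding r_def k_def l_def using i by (meson Gcd_dvd dvd_trans gcd_dvd1 gcd_dvd2 gcd_greatest imageI)
    ultimately show ?thesis by (meson dvd_trans dvd_refl mult_dvd_mono)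
  qed
  then have qr: "q * r dvd k" unfolding k_def by (auto intro: Gcd_greatest)
  have r: "r > 0" using dx by (simp add: r_def)
  obtain e where e: "d x = r * e" unfolding r_def by (meson dvdE gcd_dvd1)
  obtain h where h: "k = r * h" unfolding r_def by (meson dvdE gcd_dvd2)
  have "gcd (r * e) (r * h) = r" by (metis e h r_def)
  then have "coprime e h" using r by (simp add: gcd_mult_distrib_nat[symmetric] coprime_iff_gcd_eq_1)
  have "q dvd h" using qr r by (simp add: h mult.commute)
  then have "coprime e q" using \<open>coprime e h\<close> by (meson coprime_divisors dvd_refl)
  moreover have "e \<noteq> 0" using dx e by (cases "e = 0") auto
  \<comment> \<open>e' inverts e modulo the order q of y, so an r-th root z of y^e' satisfies z^(r
    e) = y^(e e') = y. As q divides h, also z^(r h) = 1, and r h = k divides every d i.\<close>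
  ultimately obtain e' m where ek: "e * e' = q * m + 1"
    using bezout_nat[of e q] by (auto simp: coprime_iff_gcd_eq_1)
  obtain z where z: "z \<in> carrier QmodZ" "z [^]\<^bsub>QmodZ\<^esub> int r = y [^]\<^bsub>QmodZ\<^esub> e'"
    using QmodZ_divisible[of "y [^]\<^bsub>QmodZ\<^esub> e'" "int r"] y r by auto
  then have zr: "z [^]\<^bsub>QmodZ\<^esub> r = y [^]\<^bsub>QmodZ\<^esub> e'" by (simp add: int_pow_int)
  have zx: "z [^]\<^bsub>QmodZ\<^esub> d x = y"
  proof -
    have "z [^]\<^bsub>QmodZ\<^esub> d x = (z [^]\<^bsub>QmodZ\<^esub> r) [^]\<^bsub>QmodZ\<^esub> e" using z by (simp add: e QZ.nat_pow_pow)
    also have "\<dots> = y [^]\<^bsub>QmodZ\<^esub> (e * e')" using y by (simp add: zr QZ.nat_pow_pow mult.commute)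
    also have "\<dots> = y [^]\<^bsub>QmodZ\<^esub> (1::nat)"
    proof -
      have "y [^]\<^bsub>QmodZ\<^esub> (q * m) = \<one>\<^bsub>QmodZ\<^esub>"
        using y by (simp add: QZ.pow_eq_id q_def)
      then show ?thesis using y by (simp add: ek)
    qed
    finally show ?thesis using y by simp
  qed
  have zi: "z [^]\<^bsub>QmodZ\<^esub> d i = \<one>\<^bsub>QmodZ\<^esub>" if i: "i \<in> I" for i
  proof -
    have "k dvd d i" unfolding k_def using i by (intro Gcd_dvd) simp
    then obtain f where "d i = k * f" by blast
    then have f: "d i = r * (h * f)" by (simp add: h mult.assoc)
    have "z [^]\<^bsub>QmodZ\<^esub> d i = y [^]\<^bsub>QmodZ\<^esub> (e' * (h * f))"
      using z y by (simp add: f zr flip: QZ.nat_pow_pow)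
    also have "\<dots> = \<one>\<^bsub>QmodZ\<^esub>"
      using \<open>q dvd h\<close> y by (simp add: QZ.pow_eq_id q_def)
    finally show ?thesis .
  qed
  show ?case
  proof (intro bexI[of _ "t \<otimes>\<^bsub>QmodZ\<^esub> z"] ballI)
    fix i assume "i \<in> insert x I"
    then show "(t \<otimes>\<^bsub>QmodZ\<^esub> z) [^]\<^bsub>QmodZ\<^esub> d i = c i"
    proof
      assume i: "i = x"
      show ?thesis using t(1) z(1) cx unfolding i
        by (simp add: QZ.nat_pow_distrib zx y_def QZ.m_ac)
    next
      assume i: "i \<in> I"
      then show ?thesis using t z(1) insert.prems(2) by (simp add: QZ.nat_pow_distrib zi)
    qed
  qed (use t z in auto)
qed

text \<open>The characters of the members of \<open>\<S>\<close> are given as restrictions of one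
  function F, so that their compatibility on intersections is built in. As A is generated by g^(d
  A), the value t of the character sought at g is subject to t^(d A) = F(g^(d A)) for all A, a
  system of the kind solved by \<open>QmodZ_crt\<close>.\<close>

lemma (in group) cyclic_glue:
  assumes fin: "finite (carrier G)" and g: "g \<in> carrier G" and gen: "carrier G = generate G {g}"
    and \<S>: "finite \<S>" "\<S> \<noteq> {}" "\<And>A. A \<in> \<S> \<Longrightarrow> subgroup A G"
    and F: "\<And>A. A \<in> \<S> \<Longrightarrow> F \<in> hom (G\<lparr>carrier := A\<rparr>) QmodZ"
  obtains \<psi> where "\<psi> \<in> hom G QmodZ" "\<And>A s. \<lbrakk>A \<in> \<S>; s \<in> A\<rbrakk> \<Longrightarrow> \<psi> s = F s"
proof -
  have pow: "\<exists>k::nat. s = g [^] k" if "s \<in> carrier G" for s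
    using that generate_pow_on_finite_carrier[OF fin g] gen by auto
  have cg: "comm_group G"
  proof (rule group_comm_groupI)
    fix x y assume "x \<in> carrier G" "y \<in> carrier G"
    then obtain i j :: nat where "x = g [^] i" "y = g [^] j" using pow by metis
    then show "x \<otimes> y = y \<otimes> x" using g by (simp add: nat_pow_mult add.commute)
  qed
  define d where "d A = (LEAST n::nat. n > 0 \<and> g [^] n \<in> A)" for A
  have n: "ord g > 0" using ord_ge_1[OF fin g] by simp
  have d: "d A > 0" "g [^] d A \<in> A" if A: "A \<in> \<S>" for A
  proof -
    have "g [^] ord g \<in> A" using pow_ord_eq_1[OF g] subgroup.one_closed[OF \<S>(3)[OF A]] by simp
    then have "d A > 0 \<and> g [^] d A \<in> A" unfolding d_def
      by (intro LeastI[of "\<lambda>n. n > 0 \<and> g [^] n \<in> A" "ord g"]) (use n in auto)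
    then show "d A > 0" "g [^] d A \<in> A" by auto
  qed
  have hom: "group_hom (G\<lparr>carrier := A\<rparr>) QmodZ F" if A: "A \<in> \<S>" for A
    using F[OF A] subgroup_imp_group[OF \<S>(3)[OF A]] QZ.is_group
    by (intro group_hom.intro group_hom_axioms.intro)
  have dvd: "d A dvd m" if A: "A \<in> \<S>" and m: "g [^] m \<in> A" for A m
  proof (rule ccontr)
    assume "\<not> d A dvd m"
    then have pos: "m mod d A > 0" by (metis dvd_eq_mod_eq_0 gr0I)
    have "g [^] m = g [^] (d A * (m div d A)) \<otimes> g [^] (m mod d A)"
      using g by (simp add: nat_pow_mult)
    then have "g [^] (m mod d A) = inv ((g [^] d A) [^] (m div d A)) \<otimes> g [^] m"
      using g by (simp add: nat_pow_pow inv_solve_left)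
    also have "\<dots> \<in> A"
    proof -
      interpret A: subgroup A G using \<S>(3)[OF A] .
      interpret AG: group "G\<lparr>carrier := A\<rparr>" using subgroup_imp_group[OF \<S>(3)[OF A]] .
      have "(g [^] d A) [^] (m div d A) \<in> A"
        using AG.nat_pow_closed[of "g [^] d A"] d[OF A] by (simp add: nat_pow_def)
      then show ?thesis using m by simp
    qed
    finally have "d A \<le> m mod d A" unfolding d_def using pos
      by (intro Least_le) (auto simp: d_def)
    moreover have "m mod d A < d A" using d[OF A] by simp
    ultimately show False by simp
  qed
  have Fpow: "F (g [^] (d A * m)) = F (g [^] d A) [^]\<^bsub>QmodZ\<^esub> m" if A: "A \<in> \<S>" for A and m :: nat
  proof -
    have "F ((g [^] d A) [^] m) = F (g [^] d A) [^]\<^bsub>QmodZ\<^esub> m"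
      using group_hom.hom_nat_pow[OF hom[OF A], of "g [^] d A" m] d[OF A] by (simp add: nat_pow_def)
    then show ?thesis using g by (simp add: nat_pow_pow)
  qed
  have "\<exists>t\<in>carrier QmodZ. \<forall>A\<in>\<S>. t [^]\<^bsub>QmodZ\<^esub> d A = F (g [^] d A)"
  proof (rule QmodZ_crt[OF \<S>(1)])
    fix A assume A: "A \<in> \<S>"
    then show "d A > 0" using d by blast
    show "F (g [^] d A) \<in> carrier QmodZ" using group_hom.hom_closed[OF hom[OF A]] d[OF A] by simp
    fix B assume B: "B \<in> \<S>"
    \<comment> \<open>Both sides are the least common multiple of d A and d B, so the two powers to
      be compared are the value of F at one element of \<open>A \<inter> B\<close>.\<close>
    have "d A * (d B div gcd (d A) (d B)) = d B * (d A div gcd (d A) (d B))"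
      by (metis div_mult_swap gcd_dvd1 gcd_dvd2 mult.commute)
    then show "F (g [^] d A) [^]\<^bsub>QmodZ\<^esub> (d B div gcd (d A) (d B)) = F (g [^] d B) [^]\<^bsub>QmodZ\<^esub> (d A div gcd (d A) (d B))"
      by (simp flip: Fpow[OF A] Fpow[OF B])
  qed
  then obtain t where t: "t \<in> carrier QmodZ" and tA: "\<And>A. A \<in> \<S> \<Longrightarrow> t [^]\<^bsub>QmodZ\<^esub> d A = F (g [^] d A)" by blast
  have tpow: "t [^]\<^bsub>QmodZ\<^esub> m = F (g [^] m)" if A: "A \<in> \<S>" and m: "g [^] m \<in> A" for A and m :: nat
  proof -
    obtain k where k: "m = d A * k" using dvd[OF A m] by blast
    show ?thesis using t by (simp add: k Fpow[OF A] flip: tA[OF A] QZ.nat_pow_pow)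
  qed
  \<comment> \<open>Any member of \<open>\<S>\<close> contains g^(ord g) = 1, which forces t^(ord g)
    = F 1 = 1; hence sending g^n to t^n is well defined.\<close>
  obtain A0 where A0: "A0 \<in> \<S>" using \<S>(2) by blast
  have t1: "t [^]\<^bsub>QmodZ\<^esub> ord g = \<one>\<^bsub>QmodZ\<^esub>"
  proof -
    have "\<one> \<in> A0" using subgroup.one_closed[OF \<S>(3)[OF A0]] .
    then show ?thesis
      using tpow[OF A0, of "ord g"] group_hom.hom_one[OF hom[OF A0]] by (simp add: pow_ord_eq_1[OF g])
  qed
  have f: "(\<lambda>n::int. g [^] n) \<in> hom integer_group G"
    using g by (intro homI) (auto simp: int_pow_mult)
  have l: "(\<lambda>n::int. t [^]\<^bsub>QmodZ\<^esub> n) \<in> hom integer_group QmodZ"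
    using t by (intro homI) (auto simp: QZ.int_pow_mult)
  have ker: "t [^]\<^bsub>QmodZ\<^esub> n = \<one>\<^bsub>QmodZ\<^esub>" if "n \<in> carrier integer_group" "g [^] n = \<one>" for n :: int
  proof -
    from that(2) have "int (ord g) dvd n" using g by (simp add: int_pow_eq_id)
    then obtain k where "n = int (ord g) * k" by blast
    then show ?thesis
      using t t1 by (simp add: int_pow_int flip: QZ.int_pow_pow)
  qed
  obtain \<psi> where \<psi>: "\<psi> \<in> hom G QmodZ" "\<And>n::int. \<psi> (g [^] n) = t [^]\<^bsub>QmodZ\<^esub> n"
  proof (rule QmodZ_injective[OF group_integer_group cg f l ker])
    fix l' assume "l' \<in> hom G QmodZ" "\<And>n::int. n \<in> carrier integer_group \<Longrightarrow> l' (g [^] n) = t [^]\<^bsub>QmodZ\<^esub> n"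
    then show thesis by (intro that[of l']) simp_all
  qed
  show thesis
  proof (rule that[OF \<psi>(1)])
    fix A s assume A: "A \<in> \<S>" and s: "s \<in> A"
    obtain k :: nat where k: "s = g [^] k" using pow subgroup.mem_carrier[OF \<S>(3)[OF A] s] by blast
    then show "\<psi> s = F s" using \<psi>(2)[of "int k"] tpow[OF A] s by (simp add: int_pow_int)
  qed
qed

section \<open>Permutation modules modulo constants\<close>

text \<open>M is an abstract copy of Z[E] modulo constants, presented by the map \<open>mono\<close>
  from integer functions; only their values on E count. Both character modules will be instances,
  with E the embeddings of K and with E = G. The action on E may have several orbits, so that the
  locale passes to the cyclic subgroups of G.\<close>

locale permutation_quotient = group_module G M act
  for G :: "('g, 'x) monoid_scheme" (structure) and M :: "('m, 'y) monoid_scheme" and act +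
  fixes E :: "'e set" and ac :: "'g \<Rightarrow> 'e \<Rightarrow> 'e" and mono :: "('e \<Rightarrow> int) \<Rightarrow> 'm"
  assumes fin: "finite (carrier G)"
    and E_nonempty: "E \<noteq> {}"
    and ac_closed [simp]: "\<lbrakk>g \<in> carrier G; \<sigma> \<in> E\<rbrakk> \<Longrightarrow> ac g \<sigma> \<in> E"
    and ac_mult: "\<lbrakk>g \<in> carrier G; h \<in> carrier G; \<sigma> \<in> E\<rbrakk> \<Longrightarrow> ac (g \<otimes> h) \<sigma> = ac g (ac h \<sigma>)"
    and ac_one [simp]: "\<sigma> \<in> E \<Longrightarrow> ac \<one> \<sigma> = \<sigma>"
    and mono_closed [simp]: "mono m \<in> carrier M"
    and mono_add: "mono (\<lambda>\<sigma>. m \<sigma> + m' \<sigma>) = mono m \<otimes>\<^bsub>M\<^esub> mono m'"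
    and mono_surj: "x \<in> carrier M \<Longrightarrow> \<exists>m. x = mono m"
    and mono_one_iff: "mono m = \<one>\<^bsub>M\<^esub> \<longleftrightarrow> (\<exists>z. \<forall>\<sigma>\<in>E. m \<sigma> = z)"
    and mono_act: "g \<in> carrier G \<Longrightarrow> act g (mono m) = mono (\<lambda>\<sigma>. m (ac (inv g) \<sigma>))"
begin

lemma ac_inv_cancel [simp]: 
  "\<lbrakk>g \<in> carrier G; \<sigma> \<in> E\<rbrakk> \<Longrightarrow> ac (inv g) (ac g \<sigma>) = \<sigma>"
  "\<lbrakk>g \<in> carrier G; \<sigma> \<in> E\<rbrakk> \<Longrightarrow> ac g (ac (inv g) \<sigma>) = \<sigma>"
  by (simp_all flip: ac_mult)

lemma ac_inv_mult:
  "\<lbrakk>g \<in> carrier G; h \<in> carrier G; \<sigma> \<in> E\<rbrakk> \<Longrightarrow> ac (inv (g \<otimes> h)) \<sigma> = ac (inv h) (ac (inv g) \<sigma>)"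
  by (simp add: inv_mult_group ac_mult)

lemma ac_inv_fixed: "\<lbrakk>g \<in> carrier G; \<sigma> \<in> E; ac g \<sigma> = \<sigma>\<rbrakk> \<Longrightarrow> ac (inv g) \<sigma> = \<sigma>"
  using ac_inv_cancel(1)[of g \<sigma>] by simp

lemma subgroup_quotient:
  assumes "subgroup S G" shows "permutation_quotient (G\<lparr>carrier := S\<rparr>) M act E ac mono"
proof -
  interpret S: group_module "G\<lparr>carrier := S\<rparr>" M act using subgroup_module[OF assms] .
  note mem = subgroup.mem_carrier[OF assms]
  show ?thesis
    by standard (use fin finite_subset[OF subgroup.subset[OF assms]] E_nonempty ac_mult mono_add mono_surj mono_one_iff mono_act mem
      in \<open>auto simp: m_inv_consistent[OF assms]\<close>)
qed

lemma mono_inv: "inv\<^bsub>M\<^esub> (mono m) = mono (\<lambda>\<sigma>. - m \<sigma>)"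
proof (rule M.inv_equality)
  show "mono (\<lambda>\<sigma>. - m \<sigma>) \<otimes>\<^bsub>M\<^esub> mono m = \<one>\<^bsub>M\<^esub>"
    by (simp flip: mono_add add: mono_one_iff)
qed auto

lemma mono_eq_iff: "mono m = mono m' \<longleftrightarrow> (\<exists>z. \<forall>\<sigma>\<in>E. m \<sigma> = m' \<sigma> + z)"
proof -
  have "mono m = mono m' \<longleftrightarrow> mono m \<otimes>\<^bsub>M\<^esub> inv\<^bsub>M\<^esub> mono m' = \<one>\<^bsub>M\<^esub>"
    by (metis M.inv_closed M.inv_equality M.inv_inv M.r_inv mono_closed)
  also have "\<dots> \<longleftrightarrow> mono (\<lambda>\<sigma>. m \<sigma> + - m' \<sigma>) = \<one>\<^bsub>M\<^esub>"
    by (simp only: mono_inv mono_add)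
  also have "\<dots> \<longleftrightarrow> (\<exists>z. \<forall>\<sigma>\<in>E. m \<sigma> = m' \<sigma> + z)"
    unfolding mono_one_iff by (intro ex_cong1 ball_cong) auto
  finally show ?thesis .
qed

section \<open>Integral cochains on E and their rational primitives\<close>

definition mono2 :: "('g \<times> 'g \<Rightarrow> 'e \<Rightarrow> int) \<Rightarrow> 'g \<times> 'g \<Rightarrow> 'm" where
  "mono2 a = (\<lambda>p \<in> carrier G \<times> carrier G. mono (a p))"

definition perm_cocycle :: "('g \<times> 'g \<Rightarrow> 'e \<Rightarrow> int) \<Rightarrow> bool" where
  "perm_cocycle a \<longleftrightarrow> (\<forall>g1\<in>carrier G. \<forall>g2\<in>carrier G. \<forall>g3\<in>carrier G. \<forall>\<sigma>\<in>E.
     a (g2, g3) (ac (inv g1) \<sigma>) + a (g1, g2 \<otimes> g3) \<sigma> = a (g1 \<otimes> g2, g3) \<sigma> + a (g1, g2) \<sigma>)"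

text \<open>The form in which classes are handled from here on: a is integral and is the coboundary
  of the rational cochain b. Modulo integers b is then a crossed homomorphism into the functions
  from E to Q/Z.\<close>

definition rat_cobd :: "('g \<Rightarrow> 'e \<Rightarrow> rat) \<Rightarrow> ('g \<times> 'g \<Rightarrow> 'e \<Rightarrow> int) \<Rightarrow> bool" where
  "rat_cobd b a \<longleftrightarrow> (\<forall>g1\<in>carrier G. \<forall>g2\<in>carrier G. \<forall>\<sigma>\<in>E.
     of_int (a (g1, g2) \<sigma>) = b g2 (ac (inv g1) \<sigma>) - b (g1 \<otimes> g2) \<sigma> + b g1 \<sigma>)"

lemma mono2_apply [simp]: "\<lbrakk>g1 \<in> carrier G; g2 \<in> carrier G\<rbrakk> \<Longrightarrow> mono2 a (g1, g2) = mono (a (g1, g2))"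
  by (simp add: mono2_def)

lemma perm_cocycleD: 
  "\<lbrakk>perm_cocycle a; g1 \<in> carrier G; g2 \<in> carrier G; g3 \<in> carrier G; \<sigma> \<in> E\<rbrakk> \<Longrightarrow>
     a (g2, g3) (ac (inv g1) \<sigma>) + a (g1, g2 \<otimes> g3) \<sigma> = a (g1 \<otimes> g2, g3) \<sigma> + a (g1, g2) \<sigma>"
  by (simp add: perm_cocycle_def)

lemma rat_cobdD:
  "\<lbrakk>rat_cobd b a; g1 \<in> carrier G; g2 \<in> carrier G; \<sigma> \<in> E\<rbrakk> \<Longrightarrow>
     of_int (a (g1, g2) \<sigma>) = b g2 (ac (inv g1) \<sigma>) - b (g1 \<otimes> g2) \<sigma> + b g1 \<sigma>"
  by (simp add: rat_cobd_def)

lemma mono2_cocycle: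
  assumes "perm_cocycle a" shows "mono2 a \<in> Z2"
proof (rule cocycles2I)
  show "mono2 a \<in> extensional (carrier G \<times> carrier G)" by (simp add: mono2_def)
  fix g1 g2 g3 assume g: "g1 \<in> carrier G" "g2 \<in> carrier G" "g3 \<in> carrier G"
  then show "act g1 (mono2 a (g2, g3)) \<otimes>\<^bsub>M\<^esub> mono2 a (g1, g2 \<otimes> g3) = mono2 a (g1 \<otimes> g2, g3) \<otimes>\<^bsub>M\<^esub> mono2 a (g1, g2)"
    using perm_cocycleD[OF assms g]
    by (simp add: mono_act mono_eq_iff flip: mono_add)
qed auto

text \<open>The lift a is only a cochain with values in Z[E]; the cocycle identity holds for it up
  to functions constant on E.\<close>

lemma Z2_mono2:
  assumes "c \<in> Z2" obtains a where "c = mono2 a"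
proof -
  have "\<forall>p\<in>carrier G \<times> carrier G. \<exists>m. c p = mono m"
    using cocycles2_closed[OF assms] mono_surj by auto
  then obtain a where "\<forall>p\<in>carrier G \<times> carrier G. c p = mono (a p)" by metis
  moreover have "c \<in> extensional (carrier G \<times> carrier G)"
    using assms by (auto simp: cocycles2_def cochains2_def PiE_def)
  ultimately have "c = mono2 a"
    unfolding mono2_def by (intro extensionalityI[of c "carrier G \<times> carrier G"]) auto
  then show thesis by (rule that)
qed

text \<open>Functions on E have the same image in M iff they differ by a constant. Here w records
  that constant for each pair of group elements, and u is an integral lift of the cochain whose
  coboundary is taken.\<close>

lemma mono2_in_B2_iff:
  "mono2 a \<in> B2 \<longleftrightarrow> (\<exists>u w. \<forall>g1\<in>carrier G. \<forall>g2\<in>carrier G. \<forall>\<sigma>\<in>E.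
     a (g1, g2) \<sigma> = u g2 (ac (inv g1) \<sigma>) - u (g1 \<otimes> g2) \<sigma> + u g1 \<sigma> + w g1 g2)"
proof -
  have *: "act g1 (mono (u g2)) \<otimes>\<^bsub>M\<^esub> inv\<^bsub>M\<^esub> (mono (u (g1 \<otimes> g2))) \<otimes>\<^bsub>M\<^esub> mono (u g1)
      = mono (\<lambda>\<sigma>. u g2 (ac (inv g1) \<sigma>) - u (g1 \<otimes> g2) \<sigma> + u g1 \<sigma>)" 
    if "g1 \<in> carrier G" for u g1 g2
    using that by (simp add: mono_act mono_inv flip: mono_add)
  show ?thesis
  proof
    assume "mono2 a \<in> B2"
    then obtain b where b: "b \<in> carrier G \<rightarrow>\<^sub>E carrier M" "mono2 a = cobd b" by (auto simp: coboundaries2_eq)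
    have "\<forall>g\<in>carrier G. \<exists>m. b g = mono m" using b(1) mono_surj by auto
    then obtain u where u: "\<And>g. g \<in> carrier G \<Longrightarrow> b g = mono (u g)" by metis
    have "\<exists>z. \<forall>\<sigma>\<in>E. a (g1, g2) \<sigma> = u g2 (ac (inv g1) \<sigma>) - u (g1 \<otimes> g2) \<sigma> + u g1 \<sigma> + z"
      if "g1 \<in> carrier G" "g2 \<in> carrier G" for g1 g2
    proof -
      have "mono (a (g1, g2)) = cobd b (g1, g2)" using that b(2) by (metis mono2_apply)
      then show ?thesis using that by (simp add: u * mono_eq_iff)
    qed
    then have "\<forall>g1 g2. \<exists>z. g1 \<in> carrier G \<longrightarrow> g2 \<in> carrier G \<longrightarrow> (\<forall>\<sigma>\<in>E. a (g1, g2) \<sigma> = u g2 (ac (inv g1) \<sigma>) - u (g1 \<otimes> g2) \<sigma> + u g1 \<sigma> + z)"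
      by blast
    then obtain w where "\<forall>g1 g2. g1 \<in> carrier G \<longrightarrow> g2 \<in> carrier G \<longrightarrow> (\<forall>\<sigma>\<in>E. a (g1, g2) \<sigma> = u g2 (ac (inv g1) \<sigma>) - u (g1 \<otimes> g2) \<sigma> + u g1 \<sigma> + w g1 g2)"
      by metis
    then show "\<exists>u w. \<forall>g1\<in>carrier G. \<forall>g2\<in>carrier G. \<forall>\<sigma>\<in>E.
     a (g1, g2) \<sigma> = u g2 (ac (inv g1) \<sigma>) - u (g1 \<otimes> g2) \<sigma> + u g1 \<sigma> + w g1 g2" by blast
  next
    assume "\<exists>u w. \<forall>g1\<in>carrier G. \<forall>g2\<in>carrier G. \<forall>\<sigma>\<in>E.
     a (g1, g2) \<sigma> = u g2 (ac (inv g1) \<sigma>) - u (g1 \<otimes> g2) \<sigma> + u g1 \<sigma> + w g1 g2"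
    then obtain u w where uw: "\<And>g1 g2 \<sigma>. g1 \<in> carrier G \<Longrightarrow> g2 \<in> carrier G \<Longrightarrow> \<sigma> \<in> E \<Longrightarrow>
       a (g1, g2) \<sigma> = u g2 (ac (inv g1) \<sigma>) - u (g1 \<otimes> g2) \<sigma> + u g1 \<sigma> + w g1 g2" by blast
    have "mono (a (g1, g2)) = mono (\<lambda>\<sigma>. u g2 (ac (inv g1) \<sigma>) - u (g1 \<otimes> g2) \<sigma> + u g1 \<sigma>)"
      if "g1 \<in> carrier G" "g2 \<in> carrier G" for g1 g2
      unfolding mono_eq_iff using uw[OF that] by blast
    then have "mono2 a = cobd (\<lambda>g\<in>carrier G. mono (u g))"
      by (auto simp: mono2_def cobd_def * intro!: restrict_ext)
    moreover have "(\<lambda>g\<in>carrier G. mono (u g)) \<in> carrier G \<rightarrow>\<^sub>E carrier M" by auto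
    ultimately show "mono2 a \<in> B2" unfolding coboundaries2_eq by blast
  qed
qed

text \<open>The common core of two averaging arguments, one for cocycles with values in Z[E] and one
  for the constants w. Translation by h permutes the group, so C may be summed without it.\<close>

lemma sum_average:
  fixes A B C :: "'g \<Rightarrow> rat"
  assumes h: "h \<in> carrier G" and eq: "\<And>x. x \<in> carrier G \<Longrightarrow> A x + C (h \<otimes> x) = B x + c"
  shows "sum A (carrier G) / of_nat (card (carrier G)) - sum B (carrier G) / of_nat (card (carrier G)) 
    + sum C (carrier G) / of_nat (card (carrier G)) = c"
proof -
  have "sum C (carrier G) = (\<Sum>x\<in>carrier G. C (h \<otimes> x))"
    by (rule sum.reindex_bij_witness[of _ "\<lambda>x. h \<otimes> x" "\<lambda>x. inv h \<otimes> x"])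
       (use h in \<open>auto simp flip: m_assoc\<close>)
  then have "sum A (carrier G) + sum C (carrier G) = sum B (carrier G) + of_nat (card (carrier G)) * c"
    by (simp add: eq flip: sum.distrib) (simp add: sum.distrib)
  moreover have "card (carrier G) > 0" using fin one_closed card_gt_0_iff by blast
  ultimately show ?thesis by (simp add: field_simps)
qed

text \<open>
  Higher cohomology of a finite group vanishes over \<open>\<rat>\<close>; explicitly, a cocycle is the coboundary of its
  average over the second argument.
\<close>

lemma perm_cocycle_average:
  assumes a: "perm_cocycle a" obtains b where "rat_cobd b a"
proof -
  define b where "b g \<sigma> = (\<Sum>x\<in>carrier G. of_int (a (g, x) \<sigma>)) / (of_nat (card (carrier G)) :: rat)" for g \<sigma>
  have "of_int (a (g1, g2) \<sigma>) = b g2 (ac (inv g1) \<sigma>) - b (g1 \<otimes> g2) \<sigma> + b g1 \<sigma>"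
    if g: "g1 \<in> carrier G" "g2 \<in> carrier G" "\<sigma> \<in> E" for g1 g2 \<sigma>
    unfolding b_def
    by (rule sum_average[symmetric, OF g(2)])
       (use perm_cocycleD[OF a g(1,2) _ g(3)] in \<open>simp flip: of_int_add\<close>)
  then show thesis using that by (auto simp: rat_cobd_def)
qed

lemma rat_cobd_cocycle:
  assumes b: "rat_cobd b a" shows "perm_cocycle a"
  unfolding perm_cocycle_def
proof (intro ballI)
  fix g1 g2 g3 \<sigma> assume g: "g1 \<in> carrier G" "g2 \<in> carrier G" "g3 \<in> carrier G" "\<sigma> \<in> E"
  have "of_int (a (g2, g3) (ac (inv g1) \<sigma>) + a (g1, g2 \<otimes> g3) \<sigma>) = (of_int (a (g1 \<otimes> g2, g3) \<sigma> + a (g1, g2) \<sigma>) :: rat)"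
    using g by (simp add: rat_cobdD[OF b] ac_inv_mult m_assoc)
  then show "a (g2, g3) (ac (inv g1) \<sigma>) + a (g1, g2 \<otimes> g3) \<sigma> = a (g1 \<otimes> g2, g3) \<sigma> + a (g1, g2) \<sigma>"
    by (simp only: of_int_eq_iff)
qed

text \<open>On the stabiliser of a point a crossed homomorphism is a homomorphism to the rationals
  at that point, and elements of finite order have image 0 there.\<close>

lemma crossed_fixed_zero:
  fixes D :: "'g \<Rightarrow> 'e \<Rightarrow> rat"
  assumes D: "\<And>g h \<sigma>. \<lbrakk>g \<in> carrier G; h \<in> carrier G; \<sigma> \<in> E\<rbrakk> \<Longrightarrow> D (g \<otimes> h) \<sigma> = D g \<sigma> + D h (ac (inv g) \<sigma>)"
    and g: "g \<in> carrier G" "\<sigma> \<in> E" "ac g \<sigma> = \<sigma>"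
  shows "D g \<sigma> = 0"
proof -
  have one: "D \<one> \<sigma> = 0" using D[of \<one> \<one> \<sigma>] g(2) by simp
  have pow: "D (g [^] (k::nat)) \<sigma> = of_nat k * D g \<sigma> \<and> ac (inv (g [^] k)) \<sigma> = \<sigma>" for k
  proof (induction k)
    case 0 show ?case using one g by simp
  next
    case (Suc k)
    then show ?case using g D[of "g [^] k" g \<sigma>] ac_inv_fixed[OF g] by (simp add: algebra_simps ac_inv_mult)
  qed
  have "of_nat (ord g) * D g \<sigma> = 0" using pow[of "ord g"] pow_ord_eq_1[OF g(1)] one by simp
  then show ?thesis using ord_ge_1[OF fin g(1)] by simp
qed

lemma rat_cobd_add:
  assumes "rat_cobd b a" "g \<in> carrier G" "h \<in> carrier G" "\<sigma> \<in> E"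
  shows "b g \<sigma> + b h (ac (inv g) \<sigma>) - b (g \<otimes> h) \<sigma> \<in> \<int>"
proof -
  have "b g \<sigma> + b h (ac (inv g) \<sigma>) - b (g \<otimes> h) \<sigma> = of_int (a (g, h) \<sigma>)"
    using rat_cobdD[OF assms] by simp
  then show ?thesis by simp
qed

text \<open>Expand b at g x = x (x^-1 g x) in two ways at the point x \<open>\<tau>\<close>. So the
  values of b on the stabiliser of one point determine, modulo integers, those on the stabilisers
  along its orbit.\<close>

lemma rat_cobd_conj:
  assumes b: "rat_cobd b a" and g: "g \<in> carrier G" "x \<in> carrier G" "\<tau> \<in> E" and fx: "ac g (ac x \<tau>) = ac x \<tau>"
  shows "b g (ac x \<tau>) - b (inv x \<otimes> g \<otimes> x) \<tau> \<in> \<int>"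
proof -
  have "b g (ac x \<tau>) + b x (ac x \<tau>) - b (g \<otimes> x) (ac x \<tau>) \<in> \<int>"
    using rat_cobd_add[OF b g(1,2), of "ac x \<tau>"] g ac_inv_fixed[OF g(1) _ fx] by simp
  moreover have "b x (ac x \<tau>) + b (inv x \<otimes> g \<otimes> x) \<tau> - b (g \<otimes> x) (ac x \<tau>) \<in> \<int>"
    using rat_cobd_add[OF b g(2), of "inv x \<otimes> g \<otimes> x" "ac x \<tau>"] g by (simp flip: m_assoc)
  ultimately have "(b g (ac x \<tau>) + b x (ac x \<tau>) - b (g \<otimes> x) (ac x \<tau>)) -
     (b x (ac x \<tau>) + b (inv x \<otimes> g \<otimes> x) \<tau> - b (g \<otimes> x) (ac x \<tau>)) \<in> \<int>" by (rule Ints_diff)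
  then show ?thesis by (simp add: algebra_simps)
qed

text \<open>
  The next two lemmas together: modulo constants, the coboundary of \<open>b\<close> is a coboundary iff a single
  character \<open>\<omega>\<close> of \<open>G\<close> (modulo \<open>\<int>\<close>) agrees with \<open>\<lambda>g. b g \<sigma>\<close> on the stabiliser of every \<open>\<sigma>\<close>.
\<close>

lemma mono2_trivial_imp:
  assumes b: "rat_cobd b a" and triv: "mono2 a \<in> B2"
  obtains \<omega> :: "'g \<Rightarrow> rat" where "\<And>g h. \<lbrakk>g \<in> carrier G; h \<in> carrier G\<rbrakk> \<Longrightarrow> \<omega> g + \<omega> h - \<omega> (g \<otimes> h) \<in> \<int>"
    "\<And>g \<sigma>. \<lbrakk>g \<in> carrier G; \<sigma> \<in> E; ac g \<sigma> = \<sigma>\<rbrakk> \<Longrightarrow> b g \<sigma> - \<omega> g \<in> \<int>"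
proof -
  obtain u w where uw: "\<And>g1 g2 \<sigma>. g1 \<in> carrier G \<Longrightarrow> g2 \<in> carrier G \<Longrightarrow> \<sigma> \<in> E \<Longrightarrow>
       a (g1, g2) \<sigma> = u g2 (ac (inv g1) \<sigma>) - u (g1 \<otimes> g2) \<sigma> + u g1 \<sigma> + w g1 g2" 
    using triv unfolding mono2_in_B2_iff by blast
  \<comment> \<open>Since a and the coboundary of u are cocycles, so is their difference w, for the
    trivial action on the integers.\<close>
  have wc: "w g2 g3 + w g1 (g2 \<otimes> g3) = w (g1 \<otimes> g2) g3 + w g1 g2"
    if g: "g1 \<in> carrier G" "g2 \<in> carrier G" "g3 \<in> carrier G" for g1 g2 g3
  proof -
    obtain \<sigma> where \<sigma>: "\<sigma> \<in> E" using E_nonempty by blast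
    show ?thesis using perm_cocycleD[OF rat_cobd_cocycle[OF b] g \<sigma>] g \<sigma>
      by (simp add: uw ac_inv_mult m_assoc)
  qed
  \<comment> \<open>The average of w, hence a rational primitive of it; as w is integral, it is a
    character modulo integers.\<close>
  define \<omega> where "\<omega> g = (\<Sum>x\<in>carrier G. of_int (w g x)) / (of_nat (card (carrier G)) :: rat)" for g
  have \<omega>: "\<omega> h - \<omega> (g \<otimes> h) + \<omega> g = of_int (w g h)" if g: "g \<in> carrier G" "h \<in> carrier G" for g h
    unfolding \<omega>_def
    by (rule sum_average[OF g(2)]) (use wc[OF g] in \<open>simp flip: of_int_add\<close>)
  \<comment> \<open>Its coboundary is a - (a - w) - w = 0, so D is a crossed homomorphism over the
    rationals, not only modulo integers, and vanishes on stabilisers.\<close>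
  define D where "D g \<sigma> = b g \<sigma> - of_int (u g \<sigma>) - \<omega> g" for g \<sigma>
  have D: "D (g \<otimes> h) \<sigma> = D g \<sigma> + D h (ac (inv g) \<sigma>)" if g: "g \<in> carrier G" "h \<in> carrier G" "\<sigma> \<in> E" for g h \<sigma>
    using rat_cobdD[OF b g] \<omega>[OF g(1,2)] by (simp add: D_def uw[OF g] algebra_simps)
  show thesis
  proof (rule that)
    fix g h assume g: "g \<in> carrier G" "h \<in> carrier G"
    have "\<omega> g + \<omega> h - \<omega> (g \<otimes> h) = of_int (w g h)" using \<omega>[OF g] by simp
    then show "\<omega> g + \<omega> h - \<omega> (g \<otimes> h) \<in> \<int>" by simp
  next
    fix g \<sigma> assume "g \<in> carrier G" "\<sigma> \<in> E" "ac g \<sigma> = \<sigma>"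
    from crossed_fixed_zero[OF D this] have "b g \<sigma> - \<omega> g = of_int (u g \<sigma>)" by (simp add: D_def)
    then show "b g \<sigma> - \<omega> g \<in> \<int>" by simp
  qed
qed

lemma mono2_trivialI:
  fixes \<omega> :: "'g \<Rightarrow> rat"
  assumes b: "rat_cobd b a" 
    and \<omega>: "\<And>g h. \<lbrakk>g \<in> carrier G; h \<in> carrier G\<rbrakk> \<Longrightarrow> \<omega> g + \<omega> h - \<omega> (g \<otimes> h) \<in> \<int>"
    and b\<omega>: "\<And>g \<sigma>. \<lbrakk>g \<in> carrier G; \<sigma> \<in> E; ac g \<sigma> = \<sigma>\<rbrakk> \<Longrightarrow> b g \<sigma> - \<omega> g \<in> \<int>"
  shows "mono2 a \<in> B2"
proof -
  \<comment> \<open>Modulo integers D is a crossed homomorphism that is trivial on all stabilisers.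
    The aim is a function R on E with D g \<open>\<sigma>\<close> congruent to R
    \<open>\<sigma>\<close> - R(g^-1 \<open>\<sigma>\<close>); subtracting its coboundary leaves an
    integral cochain.\<close>
  define D where "D g \<sigma> = b g \<sigma> - \<omega> g" for g \<sigma>
  have D: "D g \<sigma> + D h (ac (inv g) \<sigma>) - D (g \<otimes> h) \<sigma> \<in> \<int>" if g: "g \<in> carrier G" "h \<in> carrier G" "\<sigma> \<in> E" for g h \<sigma>
    using Ints_diff[OF rat_cobd_add[OF b g] \<omega>[OF g(1,2)]] by (simp add: D_def algebra_simps)
  define orb where "orb \<sigma> = {ac g \<sigma> | g. g \<in> carrier G}" for \<sigma>
  have orb_ac: "orb (ac g \<sigma>) = orb \<sigma>" if g: "g \<in> carrier G" "\<sigma> \<in> E" for g \<sigma>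
  proof
    show "orb (ac g \<sigma>) \<subseteq> orb \<sigma>" unfolding orb_def using g ac_mult by (auto simp flip: ac_mult)
    show "orb \<sigma> \<subseteq> orb (ac g \<sigma>)"
    proof
      fix \<tau> assume "\<tau> \<in> orb \<sigma>"
      then obtain h where h: "h \<in> carrier G" "\<tau> = ac h \<sigma>" by (auto simp: orb_def)
      then have "\<tau> = ac (h \<otimes> inv g) (ac g \<sigma>)" using g by (simp add: ac_mult)
      then show "\<tau> \<in> orb (ac g \<sigma>)" unfolding orb_def using h g by blast
    qed
  qed
  \<comment> \<open>A base point in each orbit. The choice depends on the orbit as a set, hence is
    the same for all points of it.\<close>
  define \<rho> where "\<rho> \<sigma> = (SOME \<tau>. \<tau> \<in> orb \<sigma>)" for \<sigma>
  have "\<exists>t\<in>carrier G. ac t (\<rho> \<sigma>) = \<sigma>" if s: "\<sigma> \<in> E" for \<sigma>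
  proof -
    have "orb \<sigma> \<noteq> {}" by (auto simp: orb_def)
    then have "\<rho> \<sigma> \<in> orb \<sigma>" unfolding \<rho>_def by (simp add: some_in_eq)
    then obtain h where "h \<in> carrier G" "\<rho> \<sigma> = ac h \<sigma>" by (auto simp: orb_def)
    then show ?thesis using s by (intro bexI[of _ "inv h"]) auto
  qed
  then obtain t where t: "\<And>\<sigma>. \<sigma> \<in> E \<Longrightarrow> t \<sigma> \<in> carrier G" "\<And>\<sigma>. \<sigma> \<in> E \<Longrightarrow> ac (t \<sigma>) (\<rho> \<sigma>) = \<sigma>" by metis
  have \<rho>: "\<rho> \<sigma> \<in> E" if "\<sigma> \<in> E" for \<sigma>
  proof -
    have "orb \<sigma> \<noteq> {}" by (auto simp: orb_def)
    then have "\<rho> \<sigma> \<in> orb \<sigma>" unfolding \<rho>_def by (simp add: some_in_eq)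
    then show ?thesis using that by (auto simp: orb_def)
  qed
  \<comment> \<open>The value forced by taking R to vanish at the base point and g to be the element
    t \<open>\<sigma>\<close> that moves the base point to \<open>\<sigma>\<close>.\<close>
  define R where "R \<sigma> = D (t \<sigma>) \<sigma>" for \<sigma>
  have R: "D g \<sigma> - R \<sigma> + R (ac (inv g) \<sigma>) \<in> \<int>" if g: "g \<in> carrier G" "\<sigma> \<in> E" for g \<sigma>
  proof -
    define \<sigma>' where "\<sigma>' = ac (inv g) \<sigma>"
    have s': "\<sigma>' \<in> E" using g by (simp add: \<sigma>'_def)
    have rr: "\<rho> \<sigma>' = \<rho> \<sigma>" unfolding \<rho>_def \<sigma>'_def using orb_ac[of "inv g" \<sigma>] g by simp
    \<comment> \<open>h and t \<open>\<sigma>\<close> both carry the base point to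
      \<open>\<sigma>\<close>, so they differ by an element k of the stabiliser of
      \<open>\<sigma>\<close>, on which D is integral.\<close>
    define h where "h = g \<otimes> t \<sigma>'"
    have h: "h \<in> carrier G" "ac h (\<rho> \<sigma>) = \<sigma>"
      unfolding h_def using g t[OF s'] \<rho>[OF s'] by (auto simp: ac_mult rr \<sigma>'_def simp flip: rr)
    define k where "k = h \<otimes> inv (t \<sigma>)"
    have tinv: "ac (inv (t \<sigma>)) \<sigma> = \<rho> \<sigma>" using ac_inv_cancel(1)[OF t(1)[OF g(2)] \<rho>[OF g(2)]] t(2)[OF g(2)] by simp
    have k: "k \<in> carrier G" "ac k \<sigma> = \<sigma>" "k \<otimes> t \<sigma> = h"
      unfolding k_def using h t(1)[OF g(2)] g tinv by (auto simp: ac_mult m_assoc)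
    have i1: "D g \<sigma> + D (t \<sigma>') \<sigma>' - D h \<sigma> \<in> \<int>" using D[OF g(1) t(1)[OF s'] g(2)] by (simp add: h_def \<sigma>'_def)
    have i2: "D k \<sigma> + D (t \<sigma>) \<sigma> - D h \<sigma> \<in> \<int>"
      using D[OF k(1) t(1)[OF g(2)] g(2)] k ac_inv_fixed[OF k(1) g(2) k(2)] by simp
    have i3: "D k \<sigma> \<in> \<int>" unfolding D_def by (rule b\<omega>[OF k(1) g(2) k(2)])
    have "(D g \<sigma> + D (t \<sigma>') \<sigma>' - D h \<sigma>) - (D k \<sigma> + D (t \<sigma>) \<sigma> - D h \<sigma>) + D k \<sigma> \<in> \<int>"
      by (rule Ints_add[OF Ints_diff[OF i1 i2] i3])
    then show ?thesis by (simp add: R_def \<sigma>'_def algebra_simps)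
  qed
  \<comment> \<open>The floors are exact, because R and \<open>\<omega>\<close> make their arguments
    integers. The R terms drop out of the coboundary of u, and w is the coboundary of
    \<open>\<omega>\<close>, so together they give back a.\<close>
  define u where "u g \<sigma> = \<lfloor>D g \<sigma> - R \<sigma> + R (ac (inv g) \<sigma>)\<rfloor>" for g \<sigma>
  define w where "w g h = \<lfloor>\<omega> g + \<omega> h - \<omega> (g \<otimes> h)\<rfloor>" for g h
  have ui: "of_int (u g \<sigma>) = D g \<sigma> - R \<sigma> + R (ac (inv g) \<sigma>)" if "g \<in> carrier G" "\<sigma> \<in> E" for g \<sigma>
    using R[OF that] unfolding u_def by (metis Ints_cases floor_of_int)
  have wi: "of_int (w g h) = \<omega> g + \<omega> h - \<omega> (g \<otimes> h)" if "g \<in> carrier G" "h \<in> carrier G" for g h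
    using \<omega>[OF that] unfolding w_def by (metis Ints_cases floor_of_int)
  have "a (g1, g2) \<sigma> = u g2 (ac (inv g1) \<sigma>) - u (g1 \<otimes> g2) \<sigma> + u g1 \<sigma> + w g1 g2"
    if g: "g1 \<in> carrier G" "g2 \<in> carrier G" "\<sigma> \<in> E" for g1 g2 \<sigma>
  proof -
    have "of_int (a (g1, g2) \<sigma>) = (of_int (u g2 (ac (inv g1) \<sigma>) - u (g1 \<otimes> g2) \<sigma> + u g1 \<sigma> + w g1 g2) :: rat)"
      using g by (simp add: rat_cobdD[OF b] ui wi ac_inv_mult D_def)
    then show ?thesis by (simp only: of_int_eq_iff)
  qed
  then show ?thesis unfolding mono2_in_B2_iff by blast
qed

end

section \<open>Focal subgroups\<close>

text \<open>The rationals are torsion-free. This makes a rational cochain on a finite group, for the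
  trivial action, determined by its coboundary.\<close>

lemma (in group) additive_rat_zero:
  fixes D :: "'a \<Rightarrow> rat"
  assumes fin: "finite (carrier G)" and D: "\<And>g h. \<lbrakk>g \<in> carrier G; h \<in> carrier G\<rbrakk> \<Longrightarrow> D (g \<otimes> h) = D g + D h"
    and g: "g \<in> carrier G"
  shows "D g = 0"
proof -
  have one: "D \<one> = 0" using D[of \<one> \<one>] by simp
  have "D (g [^] (k::nat)) = of_nat k * D g" for k
    by (induction k) (use one g D in \<open>auto simp: algebra_simps\<close>)
  from this[of "ord g"] have "of_nat (ord g) * D g = 0" using pow_ord_eq_1[OF g] one by simp
  then show ?thesis using ord_ge_1[OF fin g] by simp
qed

context group begin

lemma hom_kills_derived:
  assumes "comm_group A" "\<psi> \<in> hom G A" "x \<in> derived G (carrier G)"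
  shows "\<psi> x = \<one>\<^bsub>A\<^esub>"
proof -
  interpret A: comm_group A by fact
  interpret h: group_hom G A \<psi> using assms by unfold_locales auto
  have "derived G (carrier G) \<subseteq> kernel G A \<psi>"
    unfolding derived_def
  proof (rule generate_subgroup_incl[OF _ h.subgroup_kernel])
    show "derived_set G (carrier G) \<subseteq> kernel G A \<psi>"
    proof
      fix y assume "y \<in> derived_set G (carrier G)"
      then obtain g k where gk: "g \<in> carrier G" "k \<in> carrier G" "y = g \<otimes> k \<otimes> inv g \<otimes> inv k" by blast
      have "\<psi> y = (\<psi> g \<otimes>\<^bsub>A\<^esub> \<psi> k) \<otimes>\<^bsub>A\<^esub> inv\<^bsub>A\<^esub> \<psi> g \<otimes>\<^bsub>A\<^esub> inv\<^bsub>A\<^esub> \<psi> k" using gk by simp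
      also have "\<psi> g \<otimes>\<^bsub>A\<^esub> \<psi> k = \<psi> k \<otimes>\<^bsub>A\<^esub> \<psi> g" using gk by (simp add: A.m_comm)
      also have "\<dots> \<otimes>\<^bsub>A\<^esub> inv\<^bsub>A\<^esub> \<psi> g \<otimes>\<^bsub>A\<^esub> inv\<^bsub>A\<^esub> \<psi> k = \<one>\<^bsub>A\<^esub>" using gk by (simp add: A.m_assoc)
      finally show "y \<in> kernel G A \<psi>" using gk by (simp add: kernel_def)
    qed
  qed
  then show ?thesis using assms(3) by (auto simp: kernel_def)
qed

context
  fixes H assumes H: "subgroup H G"
begin

lemma focal_gen:
  assumes "h1 \<in> H" "inv x \<otimes> h1 \<otimes> x \<in> H" "x \<in> carrier G"
  shows "inv h1 \<otimes> (inv x \<otimes> h1 \<otimes> x) \<in> focal_subgroup G H"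
  unfolding focal_subgroup_def by (rule generate.incl) (use assms in blast)

lemma focal_gens_in: "{inv h1 \<otimes> h2 | h1 h2. h1 \<in> H \<and> h2 \<in> H \<and> (\<exists>x \<in> carrier G. h2 = inv x \<otimes> h1 \<otimes> x)} 
    \<subseteq> H \<inter> derived G (carrier G)"
proof
  fix y assume "y \<in> {inv h1 \<otimes> h2 | h1 h2. h1 \<in> H \<and> h2 \<in> H \<and> (\<exists>x \<in> carrier G. h2 = inv x \<otimes> h1 \<otimes> x)}"
  then obtain h1 x where h: "h1 \<in> H" "inv x \<otimes> h1 \<otimes> x \<in> H" "x \<in> carrier G" "y = inv h1 \<otimes> (inv x \<otimes> h1 \<otimes> x)" by blast
  note mem = subgroup.mem_carrier[OF H h(1)]
  \<comment> \<open>The generator is the commutator of h1^-1 and x^-1, in the convention of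
    \<open>derived_set\<close>.\<close>
  have "y = inv h1 \<otimes> inv x \<otimes> inv (inv h1) \<otimes> inv (inv x)" using h mem by (simp add: m_assoc)
  then have "y \<in> derived_set G (carrier G)" using h mem by blast
  then have "y \<in> derived G (carrier G)" unfolding derived_def by (rule generate.incl)
  moreover have "y \<in> H" using h subgroup.m_closed[OF H] subgroup.m_inv_closed[OF H] by blast
  ultimately show "y \<in> H \<inter> derived G (carrier G)" by simp
qed

lemma subgroup_derived_carrier: "subgroup (derived G (carrier G)) G"
  by (rule derived_is_subgroup) simp

lemma subgroup_H_derived: "subgroup (H \<inter> derived G (carrier G)) G"
  by (rule subgroups_Inter_pair[OF H subgroup_derived_carrier])

lemma focal_subset: "focal_subgroup G H \<subseteq> H \<inter> derived G (carrier G)"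
  unfolding focal_subgroup_def by (rule generate_subgroup_incl[OF focal_gens_in subgroup_H_derived])

lemma subgroup_focal: "subgroup (focal_subgroup G H) G"
  unfolding focal_subgroup_def
  by (rule generate_is_subgroup) (use focal_gens_in subgroup.subset[OF H] in blast)

text \<open>Conjugation inside H already puts [H, H] into the focal subgroup. This yields both its
  normality and the commutativity of the quotients by it.\<close>

lemma focal_commutator:
  assumes "x \<in> H" "y \<in> H" shows "x \<otimes> y \<otimes> inv x \<otimes> inv y \<in> focal_subgroup G H"
proof -
  note mem = subgroup.mem_carrier[OF H]
  have "inv (inv x) \<otimes> (inv (inv y) \<otimes> inv x \<otimes> inv y) \<in> focal_subgroup G H"
    by (rule focal_gen) (use assms mem subgroup.m_closed[OF H] subgroup.m_inv_closed[OF H] in auto)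
  then show ?thesis using assms mem by (simp add: m_assoc)
qed

context
  fixes K assumes K: "subgroup K G" "focal_subgroup G H \<subseteq> K" "K \<subseteq> H"
begin

text \<open>Commutators of K with the focal subgroup lie in [H, H]. Two choices of K occur:
  \<open>H \<inter> derived G (carrier G)\<close>, whose quotient is the group of the theorem, and
  H, to whose quotient characters are extended.\<close>

lemma focal_normal: "focal_subgroup G H \<lhd> G\<lparr>carrier := K\<rparr>"
proof -
  interpret K: group "G\<lparr>carrier := K\<rparr>" by (rule subgroup_imp_group[OF K(1)])
  note mem = subgroup.mem_carrier[OF K(1)]
  have sub: "subgroup (focal_subgroup G H) (G\<lparr>carrier := K\<rparr>)"
    using subgroup_incl[OF subgroup_focal K(1,2)] .
  show ?thesis
    unfolding K.normal_inv_iff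
  proof (intro conjI ballI sub)
    fix x f assume x: "x \<in> carrier (G\<lparr>carrier := K\<rparr>)" and f: "f \<in> focal_subgroup G H"
    have xf: "x \<in> K" "f \<in> K" "x \<in> H" "f \<in> H" using x f K by auto
    have "x \<otimes> f \<otimes> inv x \<otimes> inv f \<in> focal_subgroup G H" using focal_commutator xf by blast
    then have "x \<otimes> f \<otimes> inv x \<otimes> inv f \<otimes> f \<in> focal_subgroup G H"
      using f subgroup.m_closed[OF subgroup_focal] by blast
    then have "x \<otimes> f \<otimes> inv x \<in> focal_subgroup G H" using xf mem by (simp add: m_assoc)
    then show "x \<otimes>\<^bsub>G\<lparr>carrier := K\<rparr>\<^esub> f \<otimes>\<^bsub>G\<lparr>carrier := K\<rparr>\<^esub> inv\<^bsub>G\<lparr>carrier := K\<rparr>\<^esub> x \<in> focal_subgroup G H"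
      using xf by (simp add: m_inv_consistent[OF K(1)])
  qed
qed

lemma comm_group_mod_focal: "comm_group (G\<lparr>carrier := K\<rparr> Mod focal_subgroup G H)"
proof -
  interpret K: group "G\<lparr>carrier := K\<rparr>" by (rule subgroup_imp_group[OF K(1)])
  interpret N: normal "focal_subgroup G H" "G\<lparr>carrier := K\<rparr>" by (rule focal_normal)
  note mem = subgroup.mem_carrier[OF K(1)]
  show ?thesis
  proof (rule group.group_comm_groupI[OF N.factorgroup_is_group])
    fix X' Y' assume "X' \<in> carrier (G\<lparr>carrier := K\<rparr> Mod focal_subgroup G H)" "Y' \<in> carrier (G\<lparr>carrier := K\<rparr> Mod focal_subgroup G H)"
    then obtain x y where xy: "x \<in> K" "y \<in> K" and X: "X' = focal_subgroup G H #>\<^bsub>G\<lparr>carrier := K\<rparr>\<^esub> x" "Y' = focal_subgroup G H #>\<^bsub>G\<lparr>carrier := K\<rparr>\<^esub> y"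
      by (auto simp: carrier_FactGroup)
    have c: "x \<otimes> y \<otimes> inv x \<otimes> inv y \<in> focal_subgroup G H" using focal_commutator xy K by blast
    have "x \<otimes> y = (x \<otimes> y \<otimes> inv x \<otimes> inv y) \<otimes> (y \<otimes> x)" using xy mem by (simp add: m_assoc inv_solve_left')
    then have "x \<otimes> y \<in> focal_subgroup G H #>\<^bsub>G\<lparr>carrier := K\<rparr>\<^esub> (y \<otimes> x)"
      using c by (auto simp: r_coset_def)
    then have "focal_subgroup G H #>\<^bsub>G\<lparr>carrier := K\<rparr>\<^esub> (x \<otimes> y) = focal_subgroup G H #>\<^bsub>G\<lparr>carrier := K\<rparr>\<^esub> (y \<otimes> x)"
      using K.repr_independence[of "x \<otimes> y" "focal_subgroup G H" "y \<otimes> x"] N.subgroup_axioms xy subgroup.m_closed[OF K(1)] by auto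
    then show "X' \<otimes>\<^bsub>G\<lparr>carrier := K\<rparr> Mod focal_subgroup G H\<^esub> Y' = Y' \<otimes>\<^bsub>G\<lparr>carrier := K\<rparr> Mod focal_subgroup G H\<^esub> X'"
      unfolding X using N.rcos_sum[of x y] N.rcos_sum[of y x] xy by simp
  qed
qed

lemma coset_hom: "(\<lambda>x. focal_subgroup G H #> x) \<in> hom (G\<lparr>carrier := K\<rparr>) (G\<lparr>carrier := K\<rparr> Mod focal_subgroup G H)"
  using normal.r_coset_hom_Mod[OF focal_normal] by simp

lemma coset_one_iff:
  assumes "x \<in> K" shows "focal_subgroup G H #> x = focal_subgroup G H \<longleftrightarrow> x \<in> focal_subgroup G H"
  using assms coset_join1[of "focal_subgroup G H" x] coset_join2[of x "focal_subgroup G H"] subgroup_focal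
    subgroup.mem_carrier[OF K(1)] subgroup.subset[OF subgroup_focal] by auto

end

end

end

section \<open>Classes transferred from characters\<close>

text \<open>P is the module J: by transitivity E is G/H with e0 as the trivial coset. Q is the
  module J_0, where G acts on itself by left multiplication. The map \<open>\<phi>\<close> is the
  pullback of functions along the projection from G to G/H, which is what the norm does to
  characters.\<close>

locale norm_tower = P: permutation_quotient G M act E ac mono
    + Q: permutation_quotient G N actN "carrier G" "\<lambda>g h. g \<otimes>\<^bsub>G\<^esub> h" monoN
  for G :: "('g, 'x) monoid_scheme" (structure) and M :: "('m, 'y) monoid_scheme" and act
    and E :: "'e set" and ac and mono and N :: "('n, 'z) monoid_scheme" and actN and monoN +
  fixes \<phi> :: "'m \<Rightarrow> 'n" and e0 :: 'e
  assumes e0 [simp]: "e0 \<in> E"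
    and trans: "\<sigma> \<in> E \<Longrightarrow> \<exists>g\<in>carrier G. \<sigma> = ac g e0"
    and phi_mono: "\<phi> (mono m) = monoN (\<lambda>\<tau>. m (ac \<tau> e0))"
begin

sublocale module_hom G M act N actN \<phi>
proof
  show "\<phi> \<in> hom M N"
  proof (rule homI)
    fix x y assume "x \<in> carrier M" "y \<in> carrier M"
    then obtain m m' where m: "x = mono m" "y = mono m'" using P.mono_surj by metis
    show "\<phi> x \<in> carrier N" by (simp add: m phi_mono)
    show "\<phi> (x \<otimes>\<^bsub>M\<^esub> y) = \<phi> x \<otimes>\<^bsub>N\<^esub> \<phi> y"
      by (simp add: m phi_mono flip: P.mono_add Q.mono_add)
  qed
  fix g m assume g: "g \<in> carrier G" and "m \<in> carrier M"
  then obtain x where m: "m = mono x" using P.mono_surj by metis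
  show "\<phi> (act g m) = actN g (\<phi> m)"
    unfolding m P.mono_act[OF g] phi_mono Q.mono_act[OF g] Q.mono_eq_iff
    using g by (intro exI[of _ 0]) (simp add: P.ac_mult)
qed

definition stab :: "'g set" where "stab = {h \<in> carrier G. ac h e0 = e0}"

lemma stab_subgroup: "subgroup stab G"
  by (rule P.subgroupI) (use P.ac_one e0 in \<open>auto simp: stab_def P.ac_mult P.ac_inv_fixed intro!: exI[of _ "\<one>"]\<close>)

lemma stab_inv_fixed: "h \<in> stab \<Longrightarrow> ac (inv h) e0 = e0"
  by (simp add: stab_def P.ac_inv_fixed)

lemma stabD: "h \<in> stab \<Longrightarrow> h \<in> carrier G"
  by (simp add: stab_def)

abbreviation "GH \<equiv> G\<lparr>carrier := stab\<rparr>"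

definition transferred :: "('g \<Rightarrow> rat set) \<Rightarrow> ('g \<times> 'g \<Rightarrow> 'm) set \<Rightarrow> bool" where
  "transferred \<chi> \<xi> \<longleftrightarrow> (\<exists>q a. P.perm_cocycle a \<and> (\<forall>h\<in>stab. \<chi> h = qz (q h)) \<and>
     (\<forall>h1\<in>stab. \<forall>h2\<in>stab. of_int (a (h1, h2) e0) = q h1 + q h2 - q (h1 \<otimes> h2)) \<and> \<xi> = P.cls (P.mono2 a))"

text \<open>On the stabiliser, q and the component at e0 of a rational primitive b of a have the
  same coboundary. They differ by a homomorphism from a finite group to the rationals, hence agree,
  and b alone carries the information.\<close>

lemma transferred_iff:
  "transferred \<chi> \<xi> \<longleftrightarrow> (\<exists>b a. P.rat_cobd b a \<and> (\<forall>h\<in>stab. \<chi> h = qz (b h e0)) \<and> \<xi> = P.cls (P.mono2 a))"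
proof
  assume "transferred \<chi> \<xi>"
  then obtain q a where a: "P.perm_cocycle a" and q: "\<And>h. h \<in> stab \<Longrightarrow> \<chi> h = qz (q h)"
     "\<And>h1 h2. \<lbrakk>h1 \<in> stab; h2 \<in> stab\<rbrakk> \<Longrightarrow> of_int (a (h1, h2) e0) = q h1 + q h2 - q (h1 \<otimes> h2)" and xi: "\<xi> = P.cls (P.mono2 a)"
    by (auto simp: transferred_def)
  obtain b where b: "P.rat_cobd b a" using P.perm_cocycle_average[OF a] .
  interpret GH: group GH by (rule P.subgroup_imp_group[OF stab_subgroup])
  have "q h = b h e0" if h: "h \<in> stab" for h
  proof -
    have "q h - b h e0 = 0"
    proof (rule GH.additive_rat_zero)
      show "finite (carrier GH)" using P.fin finite_subset[OF subgroup.subset[OF stab_subgroup]] by simp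
      show "h \<in> carrier GH" using h by simp
      fix h1 h2 assume "h1 \<in> carrier GH" "h2 \<in> carrier GH"
      then have h12: "h1 \<in> stab" "h2 \<in> stab" by auto
      show "q (h1 \<otimes>\<^bsub>GH\<^esub> h2) - b (h1 \<otimes>\<^bsub>GH\<^esub> h2) e0 = q h1 - b h1 e0 + (q h2 - b h2 e0)"
        using q(2)[OF h12] P.rat_cobdD[OF b stabD[OF h12(1)] stabD[OF h12(2)] e0] h12
        by (simp add: stab_inv_fixed)
    qed
    then show ?thesis by simp
  qed
  then show "\<exists>b a. P.rat_cobd b a \<and> (\<forall>h\<in>stab. \<chi> h = qz (b h e0)) \<and> \<xi> = P.cls (P.mono2 a)"
    using b q(1) xi by auto
next
  assume "\<exists>b a. P.rat_cobd b a \<and> (\<forall>h\<in>stab. \<chi> h = qz (b h e0)) \<and> \<xi> = P.cls (P.mono2 a)"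
  then obtain b a where b: "P.rat_cobd b a" "\<And>h. h \<in> stab \<Longrightarrow> \<chi> h = qz (b h e0)" "\<xi> = P.cls (P.mono2 a)" by blast
  have "of_int (a (h1, h2) e0) = b h1 e0 + b h2 e0 - b (h1 \<otimes> h2) e0" if "h1 \<in> stab" "h2 \<in> stab" for h1 h2
    using P.rat_cobdD[OF b(1) stabD[OF that(1)] stabD[OF that(2)] e0] that by (simp add: stab_inv_fixed)
  then show "transferred \<chi> \<xi>"
    unfolding transferred_def using b P.rat_cobd_cocycle[OF b(1)]
    by (intro exI[of _ "\<lambda>h. b h e0"] exI[of _ a]) auto
qed

lemma transferred_mult:
  assumes "transferred \<chi> \<xi>" "transferred \<chi>' \<xi>'"
  shows "transferred (\<lambda>h. \<chi> h \<otimes>\<^bsub>QmodZ\<^esub> \<chi>' h) (\<xi> \<otimes>\<^bsub>P.H2\<^esub> \<xi>')"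
proof -
  from assms(1) obtain b a where b: "P.rat_cobd b a" "\<And>h. h \<in> stab \<Longrightarrow> \<chi> h = qz (b h e0)" "\<xi> = P.cls (P.mono2 a)" 
    unfolding transferred_iff by blast
  from assms(2) obtain b' a' where b': "P.rat_cobd b' a'" "\<And>h. h \<in> stab \<Longrightarrow> \<chi>' h = qz (b' h e0)" "\<xi>' = P.cls (P.mono2 a')" 
    unfolding transferred_iff by blast
  define b2 where "b2 g \<sigma> = b g \<sigma> + b' g \<sigma>" for g \<sigma>
  define a2 where "a2 p \<sigma> = a p \<sigma> + a' p \<sigma>" for p \<sigma>
  have 1: "P.rat_cobd b2 a2"
    unfolding P.rat_cobd_def a2_def b2_def by (simp add: P.rat_cobdD[OF b(1)] P.rat_cobdD[OF b'(1)])
  have "P.mono2 a2 = P.mono2 a \<otimes>\<^bsub>cochains2 G M\<^esub> P.mono2 a'"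
    by (auto simp: P.mono2_def P.cochains2_mult a2_def[abs_def] P.mono_add intro!: restrict_ext)
  then have 2: "\<xi> \<otimes>\<^bsub>P.H2\<^esub> \<xi>' = P.cls (P.mono2 a2)"
    using P.cls_mult[OF P.mono2_cocycle P.mono2_cocycle] P.rat_cobd_cocycle[OF b(1)] P.rat_cobd_cocycle[OF b'(1)]
    by (simp add: b(3) b'(3))
  have 3: "\<chi> h \<otimes>\<^bsub>QmodZ\<^esub> \<chi>' h = qz (b2 h e0)" if "h \<in> stab" for h
    using that by (simp add: b b' b2_def)
  show ?thesis unfolding transferred_iff using 1 2 3 by blast
qed

lemma transferred_inv:
  assumes "transferred \<chi> \<xi>"
  shows "transferred (\<lambda>h. inv\<^bsub>QmodZ\<^esub> \<chi> h) (inv\<^bsub>P.H2\<^esub> \<xi>)"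
proof -
  from assms(1) obtain b a where b: "P.rat_cobd b a" "\<And>h. h \<in> stab \<Longrightarrow> \<chi> h = qz (b h e0)" "\<xi> = P.cls (P.mono2 a)" 
    unfolding transferred_iff by blast
  define b2 where "b2 g \<sigma> = - b g \<sigma>" for g \<sigma>
  define a2 where "a2 p \<sigma> = - a p \<sigma>" for p \<sigma>
  have 1: "P.rat_cobd b2 a2"
    unfolding P.rat_cobd_def a2_def b2_def by (simp add: P.rat_cobdD[OF b(1)])
  interpret H2: comm_group P.H2 by (rule P.comm_group_H2)
  note aZ = P.mono2_cocycle[OF P.rat_cobd_cocycle[OF b(1)]] and a2Z = P.mono2_cocycle[OF P.rat_cobd_cocycle[OF 1]]
  have "P.mono2 a2 \<otimes>\<^bsub>cochains2 G M\<^esub> P.mono2 a = P.mono2 (\<lambda>p \<sigma>. 0)"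
    by (auto simp: P.mono2_def P.cochains2_mult a2_def[abs_def] simp flip: P.mono_add intro!: restrict_ext)
  moreover have "P.mono2 (\<lambda>p \<sigma>. 0) \<in> P.B2" unfolding P.mono2_in_B2_iff
    by (intro exI[of _ "\<lambda>g \<sigma>. 0"] exI[of _ "\<lambda>g h. 0"]) simp
  ultimately have "P.cls (P.mono2 a2) \<otimes>\<^bsub>P.H2\<^esub> \<xi> = \<one>\<^bsub>P.H2\<^esub>"
    using P.cls_mult[OF a2Z aZ] P.cls_eq_one_iff[of "P.mono2 (\<lambda>p \<sigma>. 0)"] P.coboundaries2_subset by (auto simp: b(3))
  then have 2: "inv\<^bsub>P.H2\<^esub> \<xi> = P.cls (P.mono2 a2)"
    using P.cls_closed[OF aZ] P.cls_closed[OF a2Z] b(3) by (metis H2.inv_equality)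
  have 3: "inv\<^bsub>QmodZ\<^esub> \<chi> h = qz (b2 h e0)" if "h \<in> stab" for h
    using that by (simp add: b b2_def)
  show ?thesis unfolding transferred_iff using 1 2 3 by blast
qed

text \<open>If the class is trivial, \<open>mono2_trivial_imp\<close> exhibits \<open>\<chi>\<close>
  as the restriction of a character of G, and such a character kills [G, G].\<close>

lemma transferred_one_imp:
  assumes t: "transferred \<chi> \<one>\<^bsub>P.H2\<^esub>" and h: "h \<in> stab" "h \<in> derived G (carrier G)"
  shows "\<chi> h = \<one>\<^bsub>QmodZ\<^esub>"
proof -
  from t obtain b a where b: "P.rat_cobd b a" "\<And>h. h \<in> stab \<Longrightarrow> \<chi> h = qz (b h e0)" "P.cls (P.mono2 a) = \<one>\<^bsub>P.H2\<^esub>" 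
    unfolding transferred_iff by metis
  have "P.mono2 a \<in> P.B2" using b(3) P.cls_eq_one_iff P.mono2_cocycle P.rat_cobd_cocycle[OF b(1)] by blast
  then obtain \<omega> where \<omega>: "\<And>g h. \<lbrakk>g \<in> carrier G; h \<in> carrier G\<rbrakk> \<Longrightarrow> \<omega> g + \<omega> h - \<omega> (g \<otimes> h) \<in> \<int>"
    "\<And>g \<sigma>. \<lbrakk>g \<in> carrier G; \<sigma> \<in> E; ac g \<sigma> = \<sigma>\<rbrakk> \<Longrightarrow> b g \<sigma> - \<omega> g \<in> \<int>"
    using P.mono2_trivial_imp[OF b(1)] by blast
  have "(\<lambda>g. qz (\<omega> g)) \<in> hom G QmodZ"
  proof (rule homI)
    fix g h assume "g \<in> carrier G" "h \<in> carrier G"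
    then show "qz (\<omega> (g \<otimes> h)) = qz (\<omega> g) \<otimes>\<^bsub>QmodZ\<^esub> qz (\<omega> h)"
      using \<omega>(1)[of g h] by (metis qz_mult qz_eq_iff)
  qed auto
  then have "qz (\<omega> h) = \<one>\<^bsub>QmodZ\<^esub>" using P.hom_kills_derived[OF comm_group_QmodZ] h by blast
  moreover have "qz (b h e0) = qz (\<omega> h)" using \<omega>(2)[of h e0] h by (auto simp: qz_eq_iff stab_def)
  ultimately show ?thesis using b(2) h by simp
qed

text \<open>Being trivial on the kernel of the map from H to G/[G, G], \<open>\<chi>\<close> extends
  to a character of G. That character is invariant under conjugation, so it matches b not only on H
  but on the stabilisers of all points, which are the conjugates of H.\<close>

lemma transferred_trivialI:
  assumes t: "transferred \<chi> \<xi>" and \<chi>: "\<chi> \<in> hom GH QmodZ" 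
    and triv: "\<And>h. \<lbrakk>h \<in> stab; h \<in> derived G (carrier G)\<rbrakk> \<Longrightarrow> \<chi> h = \<one>\<^bsub>QmodZ\<^esub>"
  shows "\<xi> = \<one>\<^bsub>P.H2\<^esub>"
proof -
  from t obtain b a where b: "P.rat_cobd b a" "\<And>h. h \<in> stab \<Longrightarrow> \<chi> h = qz (b h e0)" "\<xi> = P.cls (P.mono2 a)" 
    unfolding transferred_iff by metis
  define G' where "G' = derived G (carrier G)"
  interpret N: normal G' G unfolding G'_def by (rule P.derived_is_normal[OF P.normal_self])
  have comm: "comm_group (G Mod G')" unfolding G'_def by (rule P.derived_quot_is_comm_group)
  note subm = subgroup.mem_carrier[OF stab_subgroup]
  have f: "(\<lambda>x. G' #> x) \<in> hom GH (G Mod G')"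
    using N.r_coset_hom_Mod subm by (auto simp: hom_def)
  obtain l where l: "l \<in> hom (G Mod G') QmodZ" "\<And>h. h \<in> carrier GH \<Longrightarrow> l (G' #> h) = \<chi> h"
  proof (rule QmodZ_injective[OF P.subgroup_imp_group[OF stab_subgroup] comm f \<chi>])
    fix h assume "h \<in> carrier GH" "G' #> h = \<one>\<^bsub>G Mod G'\<^esub>"
    then show "\<chi> h = \<one>\<^bsub>QmodZ\<^esub>" using triv P.coset_join1[of G' h] N.subgroup_axioms N.subset subm G'_def by auto
  qed auto
  have \<psi>: "(\<lambda>g. l (G' #> g)) \<in> hom G QmodZ"
    using hom_compose[OF N.r_coset_hom_Mod l(1)] by (simp add: comp_def)
  define \<psi> where "\<psi> = (\<lambda>g. l (G' #> g))"
  have \<psi>c: "\<psi> g \<in> carrier QmodZ" if "g \<in> carrier G" for g using \<psi> that by (auto simp: hom_def \<psi>_def)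
  have \<psi>m: "\<psi> (g \<otimes> h) = \<psi> g \<otimes>\<^bsub>QmodZ\<^esub> \<psi> h" if "g \<in> carrier G" "h \<in> carrier G" for g h 
    using \<psi> that by (auto simp: hom_def \<psi>_def)
  have \<psi>conj: "\<psi> (inv x \<otimes> g \<otimes> x) = \<psi> g" if "g \<in> carrier G" "x \<in> carrier G" for g x
  proof -
    have "x \<otimes> (inv x \<otimes> g \<otimes> x) = g \<otimes> x" using that by (simp flip: P.m_assoc)
    then have "\<psi> x \<otimes>\<^bsub>QmodZ\<^esub> \<psi> (inv x \<otimes> g \<otimes> x) = \<psi> g \<otimes>\<^bsub>QmodZ\<^esub> \<psi> x"
      using that by (metis \<psi>m P.inv_closed P.m_closed)
    then show ?thesis using that \<psi>c by (metis QZ.m_comm QZ.l_cancel P.inv_closed P.m_closed)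
  qed
  have "P.mono2 a \<in> P.B2"
  proof (rule P.mono2_trivialI[OF b(1)])
    fix g h assume g: "g \<in> carrier G" "h \<in> carrier G"
    then have "qz (qz_rep (\<psi> g) + qz_rep (\<psi> h)) = qz (qz_rep (\<psi> (g \<otimes> h)))"
      using \<psi>m[OF g] \<psi>c by (metis P.m_closed qz_mult qz_rep)
    then show "qz_rep (\<psi> g) + qz_rep (\<psi> h) - qz_rep (\<psi> (g \<otimes> h)) \<in> \<int>" by (simp only: qz_eq_iff)
  next
    fix g \<sigma> assume g: "g \<in> carrier G" "\<sigma> \<in> E" "ac g \<sigma> = \<sigma>"
    then obtain x where x: "x \<in> carrier G" "\<sigma> = ac x e0" using trans by blast
    have xg: "inv x \<otimes> g \<otimes> x \<in> stab" using g x by (simp add: stab_def P.ac_mult)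
    have "qz (b g \<sigma>) = qz (b (inv x \<otimes> g \<otimes> x) e0)"
      using P.rat_cobd_conj[OF b(1) g(1) x(1) e0] g x by (simp add: qz_eq_iff)
    also have "\<dots> = \<psi> (inv x \<otimes> g \<otimes> x)" using b(2)[OF xg] l(2) xg by (simp add: \<psi>_def)
    also have "\<dots> = qz (qz_rep (\<psi> g))" using \<psi>conj \<psi>c g x by simp
    finally show "b g \<sigma> - qz_rep (\<psi> g) \<in> \<int>" by (simp only: qz_eq_iff)
  qed
  then show ?thesis using b(3) P.cls_eq_one_iff P.mono2_cocycle P.rat_cobd_cocycle[OF b(1)] by blast
qed

section \<open>The kernel of the map induced by the norm\<close>

abbreviation "norm_map \<equiv> cohom2_map G N actN \<phi>"

lemma push_mono2: "push (P.mono2 a) = Q.mono2 (\<lambda>p \<tau>. a p (ac \<tau> e0))"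
  by (auto simp: P.mono2_def Q.mono2_def phi_mono intro!: restrict_ext)

lemma norm_map_mono2:
  assumes "P.mono2 a \<in> P.Z2"
  shows "norm_map (P.cls (P.mono2 a)) = \<one>\<^bsub>Q.H2\<^esub> \<longleftrightarrow> Q.mono2 (\<lambda>p \<tau>. a p (ac \<tau> e0)) \<in> Q.B2"
  using cohom2_map_cls[OF assms] Q.cls_eq_one_iff[OF push_cocycle[OF assms]] by (simp add: push_mono2)

text \<open>
  A lift of the cocycle to \<open>\<int>[G/H]\<close> becomes, in \<open>\<int>[G]\<close>, a coboundary plus constants \<open>w\<close>.  Since
  pulling back to \<open>G\<close> is injective, subtracting \<open>w\<close> already gives a cocycle in \<open>\<int>[G/H]\<close>.
\<close>

lemma kernel_transferred:
  assumes \<xi>: "\<xi> \<in> carrier P.H2" and ker: "norm_map \<xi> = \<one>\<^bsub>Q.H2\<^esub>"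
  obtains \<chi> where "\<chi> \<in> carrier (QZ_dual GH)" "transferred \<chi> \<xi>"
proof -
  obtain c where c: "c \<in> P.Z2" "\<xi> = P.cls c" using \<xi> by (auto simp: P.carrier_H2)
  obtain a where a: "c = P.mono2 a" using P.Z2_mono2[OF c(1)] .
  have "Q.mono2 (\<lambda>p \<tau>. a p (ac \<tau> e0)) \<in> Q.B2" using norm_map_mono2 c ker a by simp
  then obtain u w where uw: "\<And>g1 g2 \<tau>. \<lbrakk>g1 \<in> carrier G; g2 \<in> carrier G; \<tau> \<in> carrier G\<rbrakk> \<Longrightarrow>
     a (g1, g2) (ac \<tau> e0) = u g2 (inv g1 \<otimes> \<tau>) - u (g1 \<otimes> g2) \<tau> + u g1 \<tau> + (w g1 g2 :: int)"
    unfolding Q.mono2_in_B2_iff by blast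
  define a' where "a' p \<sigma> = a p \<sigma> - w (fst p) (snd p)" for p \<sigma>
  have coc: "P.perm_cocycle a'"
    unfolding P.perm_cocycle_def
  proof (intro ballI)
    fix g1 g2 g3 \<sigma> assume g: "g1 \<in> carrier G" "g2 \<in> carrier G" "g3 \<in> carrier G" and "\<sigma> \<in> E"
    then obtain \<tau> where \<tau>: "\<tau> \<in> carrier G" "\<sigma> = ac \<tau> e0" using trans by blast
    have "ac (inv g1) \<sigma> = ac (inv g1 \<otimes> \<tau>) e0" using g \<tau> by (simp add: P.ac_mult)
    then show "a' (g2, g3) (ac (inv g1) \<sigma>) + a' (g1, g2 \<otimes> g3) \<sigma> = a' (g1 \<otimes> g2, g3) \<sigma> + a' (g1, g2) \<sigma>"
      using g \<tau> by (simp add: a'_def uw P.m_assoc P.inv_mult_group)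
  qed
  have m: "P.mono2 a' = c"
    unfolding a P.mono2_def a'_def[abs_def]
  proof (rule restrict_ext)
    fix p show "mono (\<lambda>\<sigma>. a p \<sigma> - w (fst p) (snd p)) = mono (a p)"
      unfolding P.mono_eq_iff by (intro exI[of _ "- w (fst p) (snd p)"]) simp
  qed
  obtain b where b: "P.rat_cobd b a'" using P.perm_cocycle_average[OF coc] .
  define \<chi> where "\<chi> = (\<lambda>h\<in>carrier GH. qz (b h e0))"
  have "(\<lambda>h. qz (b h e0)) \<in> hom GH QmodZ"
  proof (rule homI)
    fix g h assume gh: "g \<in> carrier GH" "h \<in> carrier GH"
    then have "b g e0 + b h e0 - b (g \<otimes> h) e0 \<in> \<int>"
      using P.rat_cobd_add[OF b, of g h e0] stabD stab_inv_fixed by auto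
    then show "qz (b (g \<otimes>\<^bsub>GH\<^esub> h) e0) = qz (b g e0) \<otimes>\<^bsub>QmodZ\<^esub> qz (b h e0)"
      by (simp flip: qz_eq_iff)
  qed auto
  then have "\<chi> \<in> carrier (QZ_dual GH)" unfolding \<chi>_def
    by (rule restrict_in_QZ_dual[OF P.subgroup_imp_group[OF stab_subgroup]])
  moreover have "transferred \<chi> \<xi>" unfolding transferred_iff
    using b m c by (intro exI[of _ b] exI[of _ a']) (auto simp: \<chi>_def)
  ultimately show thesis by (rule that)
qed

text \<open>A transferred class lifts to a cocycle with values in Z[G/H], and its pullback takes
  values in the induced module Z[G], whose second cohomology vanishes.\<close>

lemma transferred_kernel:
  assumes "transferred \<chi> \<xi>" shows "norm_map \<xi> = \<one>\<^bsub>Q.H2\<^esub>"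
proof -
  from assms obtain a where a: "P.perm_cocycle a" "\<xi> = P.cls (P.mono2 a)" unfolding transferred_def by blast
  have "Q.mono2 (\<lambda>p \<tau>. a p (ac \<tau> e0)) \<in> Q.B2"
    unfolding Q.mono2_in_B2_iff
  \<comment> \<open>The contracting homotopy of Z[G]; the claim is the cocycle identity with third
    argument (g1 g2)^-1 \<open>\<tau>\<close>. This cochain depends on \<open>\<tau>\<close> and not
    just on its coset, so it does not trivialise the class in Z[G/H].\<close>
  proof (rule exI[of _ "\<lambda>g \<tau>. a (g, inv g \<otimes> \<tau>) (ac \<tau> e0)"], rule exI[of _ "\<lambda>g h. 0"], intro ballI)
    fix g1 g2 \<tau> assume g: "g1 \<in> carrier G" "g2 \<in> carrier G" "\<tau> \<in> carrier G"
    have "g2 \<otimes> (inv g2 \<otimes> (inv g1 \<otimes> \<tau>)) = inv g1 \<otimes> \<tau>" using g by (simp flip: P.m_assoc)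
    then show "a (g1, g2) (ac \<tau> e0) = a (g2, inv g2 \<otimes> (inv g1 \<otimes> \<tau>)) (ac (inv g1 \<otimes> \<tau>) e0) -
       a (g1 \<otimes> g2, inv (g1 \<otimes> g2) \<otimes> \<tau>) (ac \<tau> e0) + a (g1, inv g1 \<otimes> \<tau>) (ac \<tau> e0) + 0"
      using P.perm_cocycleD[OF a(1) g(1,2), of "inv g2 \<otimes> (inv g1 \<otimes> \<tau>)" "ac \<tau> e0"] g
      by (simp add: P.ac_mult P.inv_mult_group P.m_assoc)
  qed
  then show ?thesis using norm_map_mono2[OF P.mono2_cocycle[OF a(1)]] a(2) by simp
qed

text \<open>Restrict to the cyclic group generated by h, which fixes both e0 and x e0. Triviality
  there gives one \<open>\<omega>\<close> that governs b at both points, and b h at x e0 is the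
  value of \<open>\<chi>\<close> at x^-1 h x.\<close>

lemma transferred_conj:
  assumes t: "transferred \<chi> \<xi>" and sha: "\<xi> \<in> carrier P.Sha"
    and h: "h \<in> stab" "x \<in> carrier G" "inv x \<otimes> h \<otimes> x \<in> stab"
  shows "\<chi> (inv x \<otimes> h \<otimes> x) = \<chi> h"
proof -
  from t obtain b a where b: "P.rat_cobd b a" "\<And>h. h \<in> stab \<Longrightarrow> \<chi> h = qz (b h e0)" "\<xi> = P.cls (P.mono2 a)" 
    unfolding transferred_iff by blast
  note hG = stabD[OF h(1)]
  define S where "S = generate G {h}"
  have S: "subgroup S G" unfolding S_def using hG by (intro P.generate_is_subgroup) auto
  interpret S: permutation_quotient "G\<lparr>carrier := S\<rparr>" M act E ac mono by (rule P.subgroup_quotient[OF S])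
  note mem = subgroup.mem_carrier[OF S]
  have "P.res S (P.mono2 a) \<in> S.B2"
    using sha P.cls_in_Sha_iff[OF P.mono2_cocycle[OF P.rat_cobd_cocycle[OF b(1)]]] hG by (simp add: b(3) S_def)
  moreover have "P.res S (P.mono2 a) = S.mono2 a"
    using mem by (auto simp: P.mono2_def S.mono2_def intro!: restrict_ext)
  ultimately have tr: "S.mono2 a \<in> S.B2" by simp
  have bS: "S.rat_cobd b a"
    unfolding S.rat_cobd_def using P.rat_cobdD[OF b(1)] mem by (simp add: P.m_inv_consistent[OF S])
  obtain \<omega> where \<omega>: "\<And>g \<sigma>. \<lbrakk>g \<in> carrier (G\<lparr>carrier := S\<rparr>); \<sigma> \<in> E; ac g \<sigma> = \<sigma>\<rbrakk> \<Longrightarrow> b g \<sigma> - \<omega> g \<in> \<int>"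
  proof (rule S.mono2_trivial_imp[OF bS tr])
    fix \<omega> :: "'g \<Rightarrow> rat" assume "\<And>g \<sigma>. \<lbrakk>g \<in> carrier (G\<lparr>carrier := S\<rparr>); \<sigma> \<in> E; ac g \<sigma> = \<sigma>\<rbrakk> \<Longrightarrow> b g \<sigma> - \<omega> g \<in> \<int>"
    then show thesis by (intro that[of \<omega>]) simp
  qed
  have hS: "h \<in> S" unfolding S_def by (rule generate.incl) simp
  have fx: "ac h (ac x e0) = ac x e0"
  proof -
    have "ac x (ac (inv x \<otimes> h \<otimes> x) e0) = ac x e0" using h(3) by (simp add: stab_def)
    then show ?thesis using h(2) hG by (simp add: P.ac_mult)
  qed
  have "qz (b h e0) = qz (\<omega> h)" using \<omega>[of h e0] hS h(1) by (simp add: qz_eq_iff stab_def)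
  moreover have "qz (b h (ac x e0)) = qz (\<omega> h)" using \<omega>[of h "ac x e0"] hS fx h(2) by (simp add: qz_eq_iff)
  moreover have "qz (b h (ac x e0)) = qz (b (inv x \<otimes> h \<otimes> x) e0)"
    using P.rat_cobd_conj[OF b(1) hG h(2) e0 fx] by (simp add: qz_eq_iff)
  ultimately show ?thesis using b(2) h by simp
qed

text \<open>On a cyclic subgroup S the cochain b gives a character on the stabiliser of each point.
  Invariance of \<open>\<chi>\<close> under conjugation makes these agree wherever two stabilisers
  meet, \<open>cyclic_glue\<close> joins them to a character of S, and \<open>mono2_trivialI\<close>
  makes the class trivial on S.\<close>

lemma transferred_exists:
  assumes \<chi>: "\<chi> \<in> hom GH QmodZ"
    and conj: "\<And>h x. \<lbrakk>h \<in> stab; x \<in> carrier G; inv x \<otimes> h \<otimes> x \<in> stab\<rbrakk> \<Longrightarrow> \<chi> (inv x \<otimes> h \<otimes> x) = \<chi> h"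
  obtains \<xi> where "\<xi> \<in> carrier P.Sha" "transferred \<chi> \<xi>"
proof -
  have \<chi>c: "\<chi> h \<in> carrier QmodZ" if "h \<in> stab" for h using \<chi> that by (auto simp: hom_def)
  have \<chi>m: "\<chi> (g \<otimes> h) = \<chi> g \<otimes>\<^bsub>QmodZ\<^esub> \<chi> h" if "g \<in> stab" "h \<in> stab" for g h using \<chi> that by (auto simp: hom_def)
  obtain s0 where s0: "\<And>\<sigma>. \<sigma> \<in> E \<Longrightarrow> s0 \<sigma> \<in> carrier G" "\<And>\<sigma>. \<sigma> \<in> E \<Longrightarrow> ac (s0 \<sigma>) e0 = \<sigma>" using trans by metis
  \<comment> \<open>With 1 as the representative of e0 the element \<open>hh h e0\<close> is h
    itself for h in the stabiliser, so that b restricts there to \<open>\<chi>\<close> on the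
    nose.\<close>
  define s where "s \<sigma> = (if \<sigma> = e0 then \<one> else s0 \<sigma>)" for \<sigma>
  have s: "s \<sigma> \<in> carrier G" "ac (s \<sigma>) e0 = \<sigma>" if "\<sigma> \<in> E" for \<sigma> using s0 that by (auto simp: s_def)
  \<comment> \<open>The Shapiro cocycle of \<open>\<chi>\<close> for the coset representatives \<open>s\<close>.\<close>
  define hh where "hh g \<sigma> = inv (s \<sigma>) \<otimes> g \<otimes> s (ac (inv g) \<sigma>)" for g \<sigma>
  have hhs: "hh g \<sigma> \<in> stab" if "g \<in> carrier G" "\<sigma> \<in> E" for g \<sigma>
  proof -
    have "ac (inv (s \<sigma>)) \<sigma> = e0" using P.ac_inv_cancel(1)[OF s(1)[OF that(2)] e0] s(2)[OF that(2)] by simp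
    then show ?thesis using s[OF that(2)] s[of "ac (inv g) \<sigma>"] that by (simp add: hh_def stab_def P.ac_mult)
  qed
  have hhm: "hh (g1 \<otimes> g2) \<sigma> = hh g1 \<sigma> \<otimes> hh g2 (ac (inv g1) \<sigma>)" if g: "g1 \<in> carrier G" "g2 \<in> carrier G" "\<sigma> \<in> E" for g1 g2 \<sigma>
  proof -
    define \<sigma>' where "\<sigma>' = ac (inv g1) \<sigma>"
    have s': "\<sigma>' \<in> E" "ac (inv g2) \<sigma>' \<in> E" using g by (auto simp: \<sigma>'_def)
    have "s \<sigma>' \<otimes> (inv (s \<sigma>') \<otimes> (g2 \<otimes> s (ac (inv g2) \<sigma>'))) = g2 \<otimes> s (ac (inv g2) \<sigma>')"
      using g s(1)[OF s'(1)] s(1)[OF s'(2)] by (simp flip: P.m_assoc)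
    then show ?thesis using g s(1)[OF s'(1)] s(1)[OF s'(2)] s(1)[OF g(3)]
      by (simp add: hh_def P.ac_inv_mult \<sigma>'_def[symmetric] P.m_assoc)
  qed
  define b where "b g \<sigma> = qz_rep (\<chi> (hh g \<sigma>))" for g \<sigma>
  have bq: "qz (b g \<sigma>) = \<chi> (hh g \<sigma>)" if "g \<in> carrier G" "\<sigma> \<in> E" for g \<sigma>
    using \<chi>c[OF hhs[OF that]] by (simp add: b_def)
  define a where "a p \<sigma> = \<lfloor>b (snd p) (ac (inv (fst p)) \<sigma>) - b (fst p \<otimes> snd p) \<sigma> + b (fst p) \<sigma>\<rfloor>" for p \<sigma>
  have ba: "P.rat_cobd b a"
    unfolding P.rat_cobd_def
  proof (intro ballI)
    fix g1 g2 \<sigma> assume g: "g1 \<in> carrier G" "g2 \<in> carrier G" "\<sigma> \<in> E"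
    have "qz (b g1 \<sigma> + b g2 (ac (inv g1) \<sigma>)) = qz (b (g1 \<otimes> g2) \<sigma>)"
      using g hhs by (simp add: bq hhm \<chi>m flip: qz_mult)
    then have "b g2 (ac (inv g1) \<sigma>) - b (g1 \<otimes> g2) \<sigma> + b g1 \<sigma> \<in> \<int>" by (simp add: qz_eq_iff algebra_simps)
    then show "rat_of_int (a (g1, g2) \<sigma>) = b g2 (ac (inv g1) \<sigma>) - b (g1 \<otimes> g2) \<sigma> + b g1 \<sigma>"
      unfolding a_def by (metis Ints_cases floor_of_int fst_conv snd_conv)
  qed
  have bh: "qz (b h e0) = \<chi> h" if "h \<in> stab" for h
    using that stabD[OF that] by (simp add: bq hh_def stab_inv_fixed s_def)
  have t: "transferred \<chi> (P.cls (P.mono2 a))"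
    unfolding transferred_iff using ba bh by metis
  have aZ: "P.mono2 a \<in> P.Z2" by (rule P.mono2_cocycle[OF P.rat_cobd_cocycle[OF ba]])
  have bfix: "qz (b g (ac x e0)) = \<chi> (inv x \<otimes> g \<otimes> x) \<and> inv x \<otimes> g \<otimes> x \<in> stab" 
    if g: "g \<in> carrier G" "x \<in> carrier G" "ac g (ac x e0) = ac x e0" for g x
  proof -
    have st: "inv x \<otimes> g \<otimes> x \<in> stab" using g by (simp add: stab_def P.ac_mult)
    then show ?thesis using P.rat_cobd_conj[OF ba g(1,2) e0 g(3)] bh by (simp add: qz_eq_iff[symmetric])
  qed
  have indep: "qz (b g \<sigma>) = qz (b g \<sigma>')" 
    if g: "g \<in> carrier G" "\<sigma> \<in> E" "\<sigma>' \<in> E" "ac g \<sigma> = \<sigma>" "ac g \<sigma>' = \<sigma>'" for g \<sigma> \<sigma>'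
  proof -
    obtain x where x: "x \<in> carrier G" "\<sigma> = ac x e0" using trans g by blast
    obtain y where y: "y \<in> carrier G" "\<sigma>' = ac y e0" using trans g by blast
    have 1: "qz (b g \<sigma>) = \<chi> (inv x \<otimes> g \<otimes> x)" "inv x \<otimes> g \<otimes> x \<in> stab" using bfix[OF g(1) x(1)] g x by auto
    have 2: "qz (b g \<sigma>') = \<chi> (inv y \<otimes> g \<otimes> y)" "inv y \<otimes> g \<otimes> y \<in> stab" using bfix[OF g(1) y(1)] g y by auto
    \<comment> \<open>The two elements of the stabiliser at which \<open>\<chi>\<close> is compared
      are conjugate by x^-1 y, so the hypothesis on \<open>\<chi>\<close> applies.\<close>
    have 3: "inv (inv x \<otimes> y) \<otimes> (inv x \<otimes> g \<otimes> x) \<otimes> (inv x \<otimes> y) = inv y \<otimes> g \<otimes> y"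
    proof -
      have "x \<otimes> (inv x \<otimes> (g \<otimes> (x \<otimes> (inv x \<otimes> y)))) = g \<otimes> y" using x(1) y(1) g(1) by (simp flip: P.m_assoc)
      then show ?thesis using x(1) y(1) g(1) by (simp add: P.inv_mult_group P.m_assoc)
    qed
    show ?thesis using conj[of "inv x \<otimes> g \<otimes> x" "inv x \<otimes> y"] 1 2 3 x y by simp
  qed
  have "P.cls (P.mono2 a) \<in> carrier P.Sha"
    unfolding P.cls_in_Sha_iff[OF aZ]
  proof
    fix g assume g: "g \<in> carrier G"
    define S where "S = generate G {g}"
    have S: "subgroup S G" unfolding S_def using g by (intro P.generate_is_subgroup) auto
    interpret S: permutation_quotient "G\<lparr>carrier := S\<rparr>" M act E ac mono by (rule P.subgroup_quotient[OF S])
    note mem = subgroup.mem_carrier[OF S]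
    have gS: "g \<in> S" unfolding S_def by (rule generate.incl) simp
    have bS: "S.rat_cobd b a"
      unfolding S.rat_cobd_def using P.rat_cobdD[OF ba] mem by (simp add: P.m_inv_consistent[OF S])
    \<comment> \<open>One function for all stabilisers: by \<open>indep\<close> the fixed point
      chosen does not matter. An element without fixed points lies in no stabiliser, so its value is
      arbitrary.\<close>
    define F where "F t = qz (b t (SOME \<sigma>. \<sigma> \<in> E \<and> ac t \<sigma> = \<sigma>))" for t
    have F: "F t = qz (b t \<sigma>)" if "t \<in> S" "\<sigma> \<in> E" "ac t \<sigma> = \<sigma>" for t \<sigma>
    proof -
      have "(SOME \<sigma>. \<sigma> \<in> E \<and> ac t \<sigma> = \<sigma>) \<in> E \<and> ac t (SOME \<sigma>. \<sigma> \<in> E \<and> ac t \<sigma> = \<sigma>) = (SOME \<sigma>. \<sigma> \<in> E \<and> ac t \<sigma> = \<sigma>)"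
        by (rule someI[of _ \<sigma>]) (use that in auto)
      then show ?thesis unfolding F_def using that mem by (intro indep) auto
    qed
    define \<S> where "\<S> = (\<lambda>\<sigma>. {t \<in> S. ac t \<sigma> = \<sigma>}) ` E"
    have finE: "finite E"
    proof -
      have "E \<subseteq> (\<lambda>g. ac g e0) ` carrier G" using trans by blast
      then show ?thesis using P.fin finite_surj by blast
    qed
    obtain \<psi> where \<psi>: "\<psi> \<in> hom (G\<lparr>carrier := S\<rparr>) QmodZ" "\<And>A t. \<lbrakk>A \<in> \<S>; t \<in> A\<rbrakk> \<Longrightarrow> \<psi> t = F t"
    proof (rule S.cyclic_glue[of g \<S> F])
      show "finite (carrier (G\<lparr>carrier := S\<rparr>))" by (rule S.fin)
      show "g \<in> carrier (G\<lparr>carrier := S\<rparr>)" using gS by simp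
      show "carrier (G\<lparr>carrier := S\<rparr>) = generate (G\<lparr>carrier := S\<rparr>) {g}"
        using P.generate_consistent[of "{g}" S] S gS by (simp add: S_def)
      show "finite \<S>" "\<S> \<noteq> {}" using finE P.E_nonempty by (auto simp: \<S>_def)
      fix A assume "A \<in> \<S>"
      then obtain \<sigma> where \<sigma>: "\<sigma> \<in> E" "A = {t \<in> S. ac t \<sigma> = \<sigma>}" by (auto simp: \<S>_def)
      show "subgroup A (G\<lparr>carrier := S\<rparr>)"
        unfolding \<sigma>(2) using \<sigma>(1) subgroup.one_closed[OF S]
        by (intro S.subgroupI) (auto simp: mem P.ac_mult subgroup.m_closed[OF S] subgroup.m_inv_closed[OF S] P.m_inv_consistent[OF S] P.ac_inv_fixed intro!: exI[of _ \<one>])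
      show "F \<in> hom (G\<lparr>carrier := S, carrier := A\<rparr>) QmodZ"
      proof (rule homI)
        fix t assume t: "t \<in> carrier (G\<lparr>carrier := S, carrier := A\<rparr>)"
        then have tA: "t \<in> S" "ac t \<sigma> = \<sigma>" using \<sigma>(2) by auto
        show "F t \<in> carrier QmodZ" by (simp add: F_def)
        fix v assume v: "v \<in> carrier (G\<lparr>carrier := S, carrier := A\<rparr>)"
        then have vA: "v \<in> S" "ac v \<sigma> = \<sigma>" using \<sigma>(2) by auto
        have "b t \<sigma> + b v \<sigma> - b (t \<otimes> v) \<sigma> \<in> \<int>"
          using P.rat_cobd_add[OF ba, of t v \<sigma>] mem tA vA \<sigma>(1) P.ac_inv_fixed by simp
        moreover have "F (t \<otimes> v) = qz (b (t \<otimes> v) \<sigma>)"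
          using tA vA \<sigma>(1) mem by (intro F) (auto simp: P.ac_mult subgroup.m_closed[OF S])
        ultimately show "F (t \<otimes>\<^bsub>G\<lparr>carrier := S, carrier := A\<rparr>\<^esub> v) = F t \<otimes>\<^bsub>QmodZ\<^esub> F v"
          using F[OF tA(1) \<sigma>(1) tA(2)] F[OF vA(1) \<sigma>(1) vA(2)] by (simp flip: qz_eq_iff)
      qed
    qed auto
    have \<psi>c: "\<psi> t \<in> carrier QmodZ" if "t \<in> S" for t using \<psi>(1) that by (auto simp: hom_def)
    have "S.mono2 a \<in> S.B2"
    proof (rule S.mono2_trivialI[OF bS])
      fix t v assume t: "t \<in> carrier (G\<lparr>carrier := S\<rparr>)" "v \<in> carrier (G\<lparr>carrier := S\<rparr>)"
      then have "\<psi> (t \<otimes> v) = \<psi> t \<otimes>\<^bsub>QmodZ\<^esub> \<psi> v" "t \<otimes> v \<in> S" using \<psi>(1) subgroup.m_closed[OF S] by (auto simp: hom_def)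
      then have "qz (qz_rep (\<psi> t) + qz_rep (\<psi> v)) = qz (qz_rep (\<psi> (t \<otimes> v)))"
        using t \<psi>c by (simp flip: qz_mult)
      then show "qz_rep (\<psi> t) + qz_rep (\<psi> v) - qz_rep (\<psi> (t \<otimes>\<^bsub>G\<lparr>carrier := S\<rparr>\<^esub> v)) \<in> \<int>"
        by (simp add: qz_eq_iff)
    next
      fix t \<sigma> assume t: "t \<in> carrier (G\<lparr>carrier := S\<rparr>)" "\<sigma> \<in> E" "ac t \<sigma> = \<sigma>"
      then have "\<psi> t = F t" by (intro \<psi>(2)[of "{t \<in> S. ac t \<sigma> = \<sigma>}"]) (auto simp: \<S>_def)
      also have "\<dots> = qz (b t \<sigma>)" using t F by simp
      finally have "qz (b t \<sigma>) = qz (qz_rep (\<psi> t))" using \<psi>c t by simp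
      then show "b t \<sigma> - qz_rep (\<psi> t) \<in> \<int>" by (simp only: qz_eq_iff)
    qed
    moreover have "P.res S (P.mono2 a) = S.mono2 a"
      using mem by (auto simp: P.mono2_def S.mono2_def intro!: restrict_ext)
    ultimately show "P.res (generate G {g}) (P.mono2 a) \<in> coboundaries2 (G\<lparr>carrier := generate G {g}\<rparr>) M act"
      by (simp add: S_def)
  qed
  then show thesis using that t by blast
qed

end

section \<open>Duality\<close>

context norm_tower begin

abbreviation "Phi \<equiv> focal_subgroup G stab"
abbreviation "HD \<equiv> stab \<inter> derived G (carrier G)"
abbreviation "GN \<equiv> G\<lparr>carrier := HD\<rparr>"
abbreviation "D \<equiv> QZ_dual P.Sha"

definition dual_image :: "(('g \<times> 'g \<Rightarrow> 'm) set \<Rightarrow> rat set) set" where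
  "dual_image = (\<lambda>l. \<lambda>\<xi> \<in> carrier P.Sha. l (norm_map \<xi>)) ` carrier (QZ_dual Q.Sha)"

lemma comm_group_D: "comm_group D"
  by (rule comm_group_QZ_dual[OF comm_group.axioms(2)[OF P.comm_group_Sha]])

lemma D_closed: "\<lbrakk>l \<in> carrier D; \<xi> \<in> carrier P.Sha\<rbrakk> \<Longrightarrow> l \<xi> \<in> carrier QmodZ"
  by (auto simp: carrier_QZ_dual hom_def)

lemma D_hom: "l \<in> carrier D \<Longrightarrow> l \<in> hom P.Sha QmodZ"
  by (simp add: carrier_QZ_dual)

lemma D_mult: "\<lbrakk>l \<in> carrier D; \<xi> \<in> carrier P.Sha; \<eta> \<in> carrier P.Sha\<rbrakk> \<Longrightarrow> l (\<xi> \<otimes>\<^bsub>P.H2\<^esub> \<eta>) = l \<xi> \<otimes>\<^bsub>QmodZ\<^esub> l \<eta>"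
  using hom_mult[OF D_hom] by (simp add: P.mult_Sha)

lemma D_inv:
  assumes "l \<in> carrier D" shows "inv\<^bsub>D\<^esub> l = (\<lambda>\<xi>\<in>carrier P.Sha. inv\<^bsub>QmodZ\<^esub> l \<xi>)"
proof -
  interpret D: comm_group D by (rule comm_group_D)
  have "(\<lambda>\<xi>. inv\<^bsub>QmodZ\<^esub> l \<xi>) \<in> hom P.Sha QmodZ"
    using D_closed[OF assms] D_mult[OF assms] by (intro homI) (auto simp: P.mult_Sha QZ.inv_mult)
  then have "(\<lambda>\<xi>\<in>carrier P.Sha. inv\<^bsub>QmodZ\<^esub> l \<xi>) \<in> carrier D"
    by (rule restrict_in_QZ_dual[OF comm_group.axioms(2)[OF P.comm_group_Sha]])
  moreover have "(\<lambda>\<xi>\<in>carrier P.Sha. inv\<^bsub>QmodZ\<^esub> l \<xi>) \<otimes>\<^bsub>D\<^esub> l = \<one>\<^bsub>D\<^esub>"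
    using D_closed[OF assms] by (auto simp: mult_QZ_dual one_QZ_dual intro!: restrict_ext)
  ultimately show ?thesis using D.inv_equality assms by blast
qed

text \<open>A functional that vanishes on the kernel of the norm map descends to its image, from
  which injectivity of Q/Z extends it. Hence the cokernel is the dual of that kernel.\<close>

lemma dual_image_eq: 
  "dual_image = {l \<in> carrier D. \<forall>\<xi>\<in>carrier P.Sha. norm_map \<xi> = \<one>\<^bsub>Q.H2\<^esub> \<longrightarrow> l \<xi> = \<one>\<^bsub>QmodZ\<^esub>}"
proof (intro equalityI subsetI)
  interpret QS: comm_group Q.Sha by (rule Q.comm_group_Sha)
  interpret PS: comm_group P.Sha by (rule P.comm_group_Sha)
  fix l assume "l \<in> dual_image"
  then obtain l0 where l0: "l0 \<in> carrier (QZ_dual Q.Sha)" "l = (\<lambda>\<xi> \<in> carrier P.Sha. l0 (norm_map \<xi>))"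
    by (auto simp: dual_image_def)
  have h0: "l0 \<in> hom Q.Sha QmodZ" using l0 by (simp add: carrier_QZ_dual)
  have "l0 \<circ> norm_map \<in> hom P.Sha QmodZ" using hom_compose[OF Sha_map_hom h0] .
  then have "l \<in> carrier D" using restrict_in_QZ_dual[OF PS.is_group] by (simp add: l0(2) comp_def)
  moreover have "l0 \<one>\<^bsub>Q.H2\<^esub> = \<one>\<^bsub>QmodZ\<^esub>" using hom_one[OF h0 QS.is_group QZ.is_group] by (simp add: Q.one_Sha)
  ultimately show "l \<in> {l \<in> carrier D. \<forall>\<xi>\<in>carrier P.Sha. norm_map \<xi> = \<one>\<^bsub>Q.H2\<^esub> \<longrightarrow> l \<xi> = \<one>\<^bsub>QmodZ\<^esub>}"
    by (simp add: l0(2))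
next
  interpret QS: comm_group Q.Sha by (rule Q.comm_group_Sha)
  interpret PS: comm_group P.Sha by (rule P.comm_group_Sha)
  fix l assume "l \<in> {l \<in> carrier D. \<forall>\<xi>\<in>carrier P.Sha. norm_map \<xi> = \<one>\<^bsub>Q.H2\<^esub> \<longrightarrow> l \<xi> = \<one>\<^bsub>QmodZ\<^esub>}"
  then have l: "l \<in> carrier D" "\<And>\<xi>. \<lbrakk>\<xi> \<in> carrier P.Sha; norm_map \<xi> = \<one>\<^bsub>Q.Sha\<^esub>\<rbrakk> \<Longrightarrow> l \<xi> = \<one>\<^bsub>QmodZ\<^esub>" 
    by (auto simp: Q.one_Sha)
  obtain l' where l': "l' \<in> hom Q.Sha QmodZ" "\<forall>\<xi>\<in>carrier P.Sha. l' (norm_map \<xi>) = l \<xi>"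
  proof (rule QmodZ_injective[OF PS.is_group QS.comm_group_axioms Sha_map_hom D_hom[OF l(1)] l(2)])
    fix l' assume "l' \<in> hom Q.Sha QmodZ" "\<And>\<xi>. \<xi> \<in> carrier P.Sha \<Longrightarrow> l' (norm_map \<xi>) = l \<xi>"
    then show thesis by (intro that[of l']) auto
  qed
  define l0 where "l0 = restrict l' (carrier Q.Sha)"
  have "l0 \<in> carrier (QZ_dual Q.Sha)" unfolding l0_def by (rule restrict_in_QZ_dual[OF QS.is_group l'(1)])
  moreover have "l = (\<lambda>\<xi> \<in> carrier P.Sha. l0 (norm_map \<xi>))"
  proof (rule extensionalityI[of _ "carrier P.Sha"])
    show "l \<in> extensional (carrier P.Sha)" using l(1) by (simp add: carrier_QZ_dual)
    show "(\<lambda>\<xi>\<in>carrier P.Sha. l0 (norm_map \<xi>)) \<in> extensional (carrier P.Sha)" by simp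
    fix \<xi> assume \<xi>: "\<xi> \<in> carrier P.Sha"
    then have "norm_map \<xi> \<in> carrier Q.Sha" using Sha_map_hom by (auto simp: hom_def)
    then show "l \<xi> = (\<lambda>\<xi>\<in>carrier P.Sha. l0 (norm_map \<xi>)) \<xi>" using \<xi> l'(2) by (simp add: l0_def)
  qed
  ultimately show "l \<in> dual_image" unfolding dual_image_def by blast
qed

lemma subgroup_dual_image: "subgroup dual_image D"
proof -
  interpret D: comm_group D by (rule comm_group_D)
  show ?thesis
  proof (rule D.subgroupI)
    show "dual_image \<subseteq> carrier D" by (auto simp: dual_image_eq)
    have "\<one>\<^bsub>D\<^esub> \<in> dual_image" unfolding dual_image_eq using D.one_closed by (auto simp: one_QZ_dual)
    then show "dual_image \<noteq> {}" by blast
    show "inv\<^bsub>D\<^esub> l \<in> dual_image" if "l \<in> dual_image" for l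
      using that D.inv_closed[of l] by (auto simp: dual_image_eq D_inv)
    show "l \<otimes>\<^bsub>D\<^esub> l' \<in> dual_image" if "l \<in> dual_image" "l' \<in> dual_image" for l l'
      using that D.m_closed[of l l'] by (auto simp: dual_image_eq mult_QZ_dual)
  qed
qed

text \<open>On a generator h1^-1 h2 the character takes the quotient of its values at two conjugate
  elements. With \<open>chi_conj_if_kills_focal\<close>, invariance under fusion in G and triviality
  on the focal subgroup are the same condition.\<close>

lemma stab_chi_kills_focal:
  assumes \<chi>: "\<chi> \<in> hom GH QmodZ" 
    and conj: "\<And>h x. \<lbrakk>h \<in> stab; x \<in> carrier G; inv x \<otimes> h \<otimes> x \<in> stab\<rbrakk> \<Longrightarrow> \<chi> (inv x \<otimes> h \<otimes> x) = \<chi> h"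
    and f: "f \<in> Phi"
  shows "\<chi> f = \<one>\<^bsub>QmodZ\<^esub>"
proof -
  interpret GH: group GH by (rule P.subgroup_imp_group[OF stab_subgroup])
  interpret h: group_hom GH QmodZ \<chi> using \<chi> by unfold_locales
  have "subgroup (kernel GH QmodZ \<chi>) G"
    by (rule P.incl_subgroup[OF stab_subgroup h.subgroup_kernel])
  moreover have "{inv h1 \<otimes> h2 | h1 h2. h1 \<in> stab \<and> h2 \<in> stab \<and> (\<exists>x \<in> carrier G. h2 = inv x \<otimes> h1 \<otimes> x)} \<subseteq> kernel GH QmodZ \<chi>"
  proof
    fix y assume "y \<in> {inv h1 \<otimes> h2 | h1 h2. h1 \<in> stab \<and> h2 \<in> stab \<and> (\<exists>x \<in> carrier G. h2 = inv x \<otimes> h1 \<otimes> x)}"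
    then obtain h1 x where h: "h1 \<in> stab" "inv x \<otimes> h1 \<otimes> x \<in> stab" "x \<in> carrier G" "y = inv h1 \<otimes> (inv x \<otimes> h1 \<otimes> x)" by blast
    have "\<chi> y = inv\<^bsub>QmodZ\<^esub> \<chi> h1 \<otimes>\<^bsub>QmodZ\<^esub> \<chi> (inv x \<otimes> h1 \<otimes> x)"
      using h h.hom_mult[of "inv h1" "inv x \<otimes> h1 \<otimes> x"] h.hom_inv[of h1] P.m_inv_consistent[OF stab_subgroup h(1)]
        subgroup.m_inv_closed[OF stab_subgroup h(1)] by simp
    also have "\<dots> = \<one>\<^bsub>QmodZ\<^esub>" using conj[OF h(1,3,2)] h.hom_closed[of h1] h(1) by simp
    finally show "y \<in> kernel GH QmodZ \<chi>"
      using h subgroup.m_closed[OF stab_subgroup] subgroup.m_inv_closed[OF stab_subgroup] by (simp add: kernel_def)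
  qed
  ultimately have "Phi \<subseteq> kernel GH QmodZ \<chi>"
    unfolding focal_subgroup_def by (intro P.generate_subgroup_incl)
  then show ?thesis using f by (auto simp: kernel_def)
qed

lemma chi_conj_if_kills_focal:
  assumes \<chi>: "\<chi> \<in> hom GH QmodZ" and kill: "\<And>f. f \<in> Phi \<Longrightarrow> \<chi> f = \<one>\<^bsub>QmodZ\<^esub>"
    and h: "h \<in> stab" "x \<in> carrier G" "inv x \<otimes> h \<otimes> x \<in> stab"
  shows "\<chi> (inv x \<otimes> h \<otimes> x) = \<chi> h"
proof -
  interpret GH: group GH by (rule P.subgroup_imp_group[OF stab_subgroup])
  interpret h: group_hom GH QmodZ \<chi> using \<chi> by unfold_locales
  have "\<one>\<^bsub>QmodZ\<^esub> = \<chi> (inv h \<otimes> (inv x \<otimes> h \<otimes> x))"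
    using kill P.focal_gen[OF stab_subgroup h(1,3,2)] by simp
  also have "\<dots> = inv\<^bsub>QmodZ\<^esub> \<chi> h \<otimes>\<^bsub>QmodZ\<^esub> \<chi> (inv x \<otimes> h \<otimes> x)"
    using h h.hom_mult[of "inv h" "inv x \<otimes> h \<otimes> x"] h.hom_inv[of h] P.m_inv_consistent[OF stab_subgroup h(1)]
      subgroup.m_inv_closed[OF stab_subgroup h(1)] by simp
  finally show ?thesis using h.hom_closed[of h] h.hom_closed[of "inv x \<otimes> h \<otimes> x"] h
    by (metis GH.is_group QZ.inv_closed QZ.inv_equality QZ.inv_inv QZ.m_comm partial_object.select_convs(1) partial_object.update_convs(1) partial_object.surjective)
qed

lemma transferred_kills_focal:
  assumes "\<chi> \<in> hom GH QmodZ" "transferred \<chi> \<xi>" "\<xi> \<in> carrier P.Sha" "f \<in> Phi"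
  shows "\<chi> f = \<one>\<^bsub>QmodZ\<^esub>"
  using stab_chi_kills_focal[OF assms(1) transferred_conj[OF assms(2,3)] assms(4)] by blast

section \<open>The finite quotient by the focal subgroup and its characters\<close>

lemma HD_subgroup: "subgroup HD G" by (rule P.subgroup_H_derived[OF stab_subgroup])

lemma group_GN: "group GN" by (rule P.subgroup_imp_group[OF HD_subgroup])

lemma Phi_HD: "Phi \<subseteq> HD" by (rule P.focal_subset[OF stab_subgroup])

abbreviation "A \<equiv> GN Mod Phi"

lemma comm_group_A: "comm_group A"
  using P.comm_group_mod_focal[OF stab_subgroup HD_subgroup Phi_HD] by simp

lemma finite_A: "finite (carrier A)"
proof -
  have "finite HD" using P.fin finite_subset[OF subgroup.subset[OF HD_subgroup]] by simp
  then show ?thesis by (simp add: carrier_FactGroup)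
qed

lemma HD_coset_hom: "(\<lambda>x. Phi #> x) \<in> hom GN A"
  using P.coset_hom[OF stab_subgroup HD_subgroup Phi_HD] by simp

lemma HD_coset_one: "x \<in> HD \<Longrightarrow> Phi #> x = Phi \<longleftrightarrow> x \<in> Phi"
  using P.coset_one_iff[OF stab_subgroup HD_subgroup Phi_HD] by simp

lemma A_cases: assumes "X' \<in> carrier A" obtains h where "h \<in> HD" "X' = Phi #> h"
  using assms by (auto simp: carrier_FactGroup)

text \<open>H modulo the focal subgroup is abelian, so \<open>\<alpha>\<close> extends to it from
  its subgroup A. Pulled back to H, the extension kills the focal subgroup and therefore has a class
  in Sha. It is not unique, but its restriction to \<open>HD\<close> is fixed.\<close>

lemma character_lift:
  assumes \<alpha>: "\<alpha> \<in> carrier (QZ_dual A)"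
  obtains \<chi> \<xi> where "\<chi> \<in> carrier (QZ_dual GH)" "\<And>h. h \<in> HD \<Longrightarrow> \<chi> h = \<alpha> (Phi #> h)"
    "\<xi> \<in> carrier P.Sha" "transferred \<chi> \<xi>"
proof -
  have ah: "\<alpha> \<in> hom A QmodZ" using \<alpha> by (simp add: carrier_QZ_dual)
  have stab: "subgroup stab G" "Phi \<subseteq> stab" "stab \<subseteq> stab" using stab_subgroup Phi_HD by auto
  have comm: "comm_group (GH Mod Phi)" by (rule P.comm_group_mod_focal[OF stab_subgroup stab])
  have ch: "(\<lambda>x. Phi #> x) \<in> hom GH (GH Mod Phi)" by (rule P.coset_hom[OF stab_subgroup stab])
  then have f: "(\<lambda>x. Phi #> x) \<in> hom GN (GH Mod Phi)" by (auto simp: hom_def)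
  have l: "(\<lambda>h. \<alpha> (Phi #> h)) \<in> hom GN QmodZ" using hom_compose[OF HD_coset_hom ah] by (simp add: comp_def)
  have ker: "\<alpha> (Phi #> h) = \<one>\<^bsub>QmodZ\<^esub>" if "h \<in> carrier GN" "Phi #> h = \<one>\<^bsub>GH Mod Phi\<^esub>" for h
    using that hom_one[OF ah comm_group.axioms(2)[OF comm_group_A] QZ.is_group] by simp
  obtain l' where l': "l' \<in> hom (GH Mod Phi) QmodZ" "\<forall>h\<in>HD. l' (Phi #> h) = \<alpha> (Phi #> h)"
  proof (rule QmodZ_injective[OF group_GN comm f l ker])
    fix l' assume "l' \<in> hom (GH Mod Phi) QmodZ" "\<And>h. h \<in> carrier GN \<Longrightarrow> l' (Phi #> h) = \<alpha> (Phi #> h)"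
    then show thesis by (intro that[of l']) auto
  qed
  have \<chi>0: "(\<lambda>h. l' (Phi #> h)) \<in> hom GH QmodZ" using hom_compose[OF ch l'(1)] by (simp add: comp_def)
  define \<chi> where "\<chi> = (\<lambda>h\<in>carrier GH. l' (Phi #> h))"
  have \<chi>: "\<chi> \<in> carrier (QZ_dual GH)"
    unfolding \<chi>_def by (rule restrict_in_QZ_dual[OF P.subgroup_imp_group[OF stab_subgroup] \<chi>0])
  then have \<chi>h: "\<chi> \<in> hom GH QmodZ" by (simp add: carrier_QZ_dual)
  have kill: "\<chi> f = \<one>\<^bsub>QmodZ\<^esub>" if f: "f \<in> Phi" for f
  proof -
    have "Phi #> f = Phi" using P.coset_one_iff[OF stab_subgroup stab, of f] f stab by blast
    then show ?thesis using f stab hom_one[OF l'(1) comm_group.axioms(2)[OF comm] QZ.is_group] by (auto simp: \<chi>_def)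
  qed
  obtain \<xi> where "\<xi> \<in> carrier P.Sha" "transferred \<chi> \<xi>"
    using transferred_exists[OF \<chi>h chi_conj_if_kills_focal[OF \<chi>h kill]] by blast
  moreover have "\<chi> h = \<alpha> (Phi #> h)" if "h \<in> HD" for h
    using that l'(2) by (auto simp: \<chi>_def)
  ultimately show thesis using that \<chi> by blast
qed

lemma transferred_unique:
  assumes \<chi>: "transferred \<chi> \<xi>" "transferred \<chi>' \<xi>" "\<chi> \<in> hom GH QmodZ" "\<chi>' \<in> hom GH QmodZ" 
    and \<xi>: "\<xi> \<in> carrier P.H2" and h: "h \<in> HD"
  shows "\<chi> h = \<chi>' h"
proof -
  interpret H2: comm_group P.H2 by (rule P.comm_group_H2)
  have "transferred (\<lambda>h. \<chi> h \<otimes>\<^bsub>QmodZ\<^esub> inv\<^bsub>QmodZ\<^esub> \<chi>' h) \<one>\<^bsub>P.H2\<^esub>"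
    using transferred_mult[OF \<chi>(1) transferred_inv[OF \<chi>(2)]] \<xi> by simp
  then have 1: "\<chi> h \<otimes>\<^bsub>QmodZ\<^esub> inv\<^bsub>QmodZ\<^esub> \<chi>' h = \<one>\<^bsub>QmodZ\<^esub>" using transferred_one_imp h by blast
  have "\<chi> h \<in> carrier QmodZ" "\<chi>' h \<in> carrier QmodZ" using \<chi>(3,4) h by (auto simp: hom_def)
  with 1 show ?thesis by (metis QZ.inv_closed QZ.inv_equality QZ.inv_inv)
qed

text \<open>The quotient of the two characters is trivial on \<open>HD\<close>, so the quotient of
  the classes is trivial. Together with \<open>transferred_unique\<close>, a transferred class and
  the restriction of its character to \<open>HD\<close> determine each other.\<close>

lemma transferred_class_unique:
  assumes t: "transferred \<chi> \<xi>" "transferred \<chi>' \<xi>'" and \<chi>: "\<chi> \<in> hom GH QmodZ" "\<chi>' \<in> hom GH QmodZ" 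
    and \<xi>: "\<xi> \<in> carrier P.H2" "\<xi>' \<in> carrier P.H2" and eq: "\<And>h. h \<in> HD \<Longrightarrow> \<chi> h = \<chi>' h"
  shows "\<xi> = \<xi>'"
proof -
  interpret H2: comm_group P.H2 by (rule P.comm_group_H2)
  have mem: "\<chi> h \<in> carrier QmodZ" "\<chi>' h \<in> carrier QmodZ" if "h \<in> stab" for h using that \<chi> by (auto simp: hom_def)
  have hom: "(\<lambda>h. \<chi> h \<otimes>\<^bsub>QmodZ\<^esub> inv\<^bsub>QmodZ\<^esub> \<chi>' h) \<in> hom GH QmodZ"
    by (rule homI) (use \<chi> mem subgroup.m_closed[OF stab_subgroup] in \<open>auto simp: hom_def QZ.inv_mult QZ.m_ac\<close>)
  have "\<xi> \<otimes>\<^bsub>P.H2\<^esub> inv\<^bsub>P.H2\<^esub> \<xi>' = \<one>\<^bsub>P.H2\<^esub>"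
    by (rule transferred_trivialI[OF transferred_mult[OF t(1) transferred_inv[OF t(2)]] hom])
       (use eq mem in auto)
  then show ?thesis using \<xi> by (metis H2.inv_closed H2.inv_equality H2.inv_inv)
qed

lemma Sha_H2: "\<xi> \<in> carrier P.Sha \<Longrightarrow> \<xi> \<in> carrier P.H2"
  using subgroup.mem_carrier[OF P.subgroup_Sha] .

text \<open>The image of h under the isomorphism, given by its property rather than by a choice,
  which makes the map canonical. It will turn out to be a coset of \<open>dual_image\<close>, that
  is, an element of the cokernel.\<close>

definition pairing_set :: "'g \<Rightarrow> (('g \<times> 'g \<Rightarrow> 'm) set \<Rightarrow> rat set) set" where
  "pairing_set h = {l \<in> carrier D. \<forall>\<chi>\<in>carrier (QZ_dual GH). \<forall>\<xi>\<in>carrier P.Sha. transferred \<chi> \<xi> \<longrightarrow> l \<xi> = \<chi> h}"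

text \<open>On the kernel C of the norm map the value at a class is forced to be that of its
  character at h. By \<open>transferred_unique\<close> this is well defined and additive for h in
  \<open>HD\<close>; injectivity of Q/Z extends it from C to Sha.\<close>

lemma pairing_set_nonempty:
  assumes h: "h \<in> HD" obtains l where "l \<in> pairing_set h"
proof -
  interpret PS: comm_group P.Sha by (rule P.comm_group_Sha)
  interpret NS: comm_group Q.Sha by (rule Q.comm_group_Sha)
  interpret nm: group_hom P.Sha Q.Sha norm_map using Sha_map_hom by unfold_locales
  define C where "C = kernel P.Sha Q.Sha norm_map"
  have C: "subgroup C P.Sha" unfolding C_def by (rule nm.subgroup_kernel)
  have "\<exists>\<chi>. \<chi> \<in> carrier (QZ_dual GH) \<and> transferred \<chi> \<xi>" if "\<xi> \<in> C" for \<xi>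
    using that kernel_transferred[OF Sha_H2, of \<xi>] by (auto simp: C_def kernel_def Q.one_Sha)
  \<comment> \<open>The choice of characters is not multiplicative, but its evaluation at h is,
    since h lies in [G, G].\<close>
  then obtain X' where X': "\<And>\<xi>. \<xi> \<in> C \<Longrightarrow> X' \<xi> \<in> carrier (QZ_dual GH)" "\<And>\<xi>. \<xi> \<in> C \<Longrightarrow> transferred (X' \<xi>) \<xi>" by metis
  have X'h: "X' \<xi> \<in> hom GH QmodZ" if "\<xi> \<in> C" for \<xi> using X'(1)[OF that] by (simp add: carrier_QZ_dual)
  have hs: "h \<in> stab" using h by simp
  note mem = subgroup.mem_carrier[OF C]
  have val: "(\<lambda>\<xi>. X' \<xi> h) \<in> hom (P.Sha\<lparr>carrier := C\<rparr>) QmodZ"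
  proof (rule homI)
    fix \<xi> assume "\<xi> \<in> carrier (P.Sha\<lparr>carrier := C\<rparr>)"
    then have \<xi>: "\<xi> \<in> C" by simp
    then show "X' \<xi> h \<in> carrier QmodZ" using X'h hs by (auto simp: hom_def)
    fix \<eta> assume "\<eta> \<in> carrier (P.Sha\<lparr>carrier := C\<rparr>)"
    then have \<eta>: "\<eta> \<in> C" by simp
    have \<xi>\<eta>: "\<xi> \<otimes>\<^bsub>P.Sha\<^esub> \<eta> \<in> C" using \<xi> \<eta> C by (rule subgroup.m_closed[rotated])
    have X'c: "X' \<zeta> k \<in> carrier QmodZ" if "\<zeta> \<in> C" "k \<in> stab" for \<zeta> k using X'h that by (auto simp: hom_def)
    have hm: "(\<lambda>k. X' \<xi> k \<otimes>\<^bsub>QmodZ\<^esub> X' \<eta> k) \<in> hom GH QmodZ"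
      by (rule homI) (use \<xi> \<eta> X'c hom_mult[OF X'h[OF \<xi>]] hom_mult[OF X'h[OF \<eta>]] in \<open>auto simp: QZ.m_ac\<close>)
    have "X' (\<xi> \<otimes>\<^bsub>P.Sha\<^esub> \<eta>) h = X' \<xi> h \<otimes>\<^bsub>QmodZ\<^esub> X' \<eta> h"
      by (rule transferred_unique[OF X'(2)[OF \<xi>\<eta>] _ X'h[OF \<xi>\<eta>] hm Sha_H2[OF mem[OF \<xi>\<eta>]] h])
         (use transferred_mult[OF X'(2)[OF \<xi>] X'(2)[OF \<eta>]] in \<open>simp add: P.mult_Sha\<close>)
    then show "X' (\<xi> \<otimes>\<^bsub>P.Sha\<lparr>carrier := C\<rparr>\<^esub> \<eta>) h = X' \<xi> h \<otimes>\<^bsub>QmodZ\<^esub> X' \<eta> h" by simp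
  qed
  have grp: "group (P.Sha\<lparr>carrier := C\<rparr>)" by (rule PS.subgroup_imp_group[OF C])
  have id: "(\<lambda>\<xi>. \<xi>) \<in> hom (P.Sha\<lparr>carrier := C\<rparr>) P.Sha" by (rule homI) (use mem in auto)
  have ker: "X' \<xi> h = \<one>\<^bsub>QmodZ\<^esub>" if "\<xi> \<in> carrier (P.Sha\<lparr>carrier := C\<rparr>)" "\<xi> = \<one>\<^bsub>P.Sha\<^esub>" for \<xi>
    using hom_one[OF val grp QZ.is_group] that by simp
  obtain l where l: "l \<in> hom P.Sha QmodZ" "\<forall>\<xi>\<in>C. l \<xi> = X' \<xi> h"
  proof (rule QmodZ_injective[OF grp PS.comm_group_axioms id val ker])
    fix l assume "l \<in> hom P.Sha QmodZ" "\<And>\<xi>. \<xi> \<in> carrier (P.Sha\<lparr>carrier := C\<rparr>) \<Longrightarrow> l \<xi> = X' \<xi> h"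
    then show thesis by (intro that[of l]) auto
  qed
  have "restrict l (carrier P.Sha) \<in> pairing_set h"
    unfolding pairing_set_def
  proof (intro CollectI conjI ballI impI)
    show "restrict l (carrier P.Sha) \<in> carrier D" by (rule restrict_in_QZ_dual[OF PS.is_group l(1)])
    fix \<chi> \<xi> assume *: "\<chi> \<in> carrier (QZ_dual GH)" "\<xi> \<in> carrier P.Sha" "transferred \<chi> \<xi>"
    have \<xi>: "\<xi> \<in> C" using transferred_kernel[OF *(3)] *(2) by (simp add: C_def kernel_def Q.one_Sha)
    have "X' \<xi> h = \<chi> h"
      by (rule transferred_unique[OF X'(2)[OF \<xi>] *(3) X'h[OF \<xi>] _ Sha_H2[OF *(2)] h])
         (use *(1) in \<open>simp add: carrier_QZ_dual\<close>)
    then show "restrict l (carrier P.Sha) \<xi> = \<chi> h" using l(2) \<xi> *(2) by simp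
  qed
  then show thesis by (rule that)
qed

lemma pairing_set_D: "l \<in> pairing_set h \<Longrightarrow> l \<in> carrier D"
  by (simp add: pairing_set_def)

lemma pairing_setD: "\<lbrakk>l \<in> pairing_set h; \<chi> \<in> carrier (QZ_dual GH); \<xi> \<in> carrier P.Sha; transferred \<chi> \<xi>\<rbrakk> \<Longrightarrow> l \<xi> = \<chi> h"
  by (simp add: pairing_set_def)

lemma dual_image_kills:
  assumes "l \<in> dual_image" "transferred \<chi> \<xi>" "\<xi> \<in> carrier P.Sha" shows "l \<xi> = \<one>\<^bsub>QmodZ\<^esub>"
  using assms transferred_kernel[OF assms(2)] by (simp add: dual_image_eq)

text \<open>Two functionals with the prescribed values agree on the kernel of the norm map, hence
  differ by an element of \<open>dual_image\<close>, which in turn vanishes on all transferred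
  classes.\<close>

lemma pairing_set_coset:
  assumes l: "l \<in> pairing_set h" and h: "h \<in> HD"
  shows "pairing_set h = dual_image #>\<^bsub>D\<^esub> l"
proof (intro equalityI subsetI)
  interpret D: comm_group D by (rule comm_group_D)
  note lD = pairing_set_D[OF l]
  {
    fix l' assume l': "l' \<in> pairing_set h"
    note l'D = pairing_set_D[OF l']
    have "l' \<otimes>\<^bsub>D\<^esub> inv\<^bsub>D\<^esub> l \<in> dual_image"
      unfolding dual_image_eq
    proof (intro CollectI conjI ballI impI)
      show "l' \<otimes>\<^bsub>D\<^esub> inv\<^bsub>D\<^esub> l \<in> carrier D" using lD l'D by simp
      fix \<xi> assume \<xi>: "\<xi> \<in> carrier P.Sha" "norm_map \<xi> = \<one>\<^bsub>Q.H2\<^esub>"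
      obtain \<chi> where \<chi>: "\<chi> \<in> carrier (QZ_dual GH)" "transferred \<chi> \<xi>" using kernel_transferred[OF Sha_H2[OF \<xi>(1)] \<xi>(2)] .
      have "l \<xi> = l' \<xi>" using pairing_setD[OF l \<chi>(1) \<xi>(1) \<chi>(2)] pairing_setD[OF l' \<chi>(1) \<xi>(1) \<chi>(2)] by simp
      then show "(l' \<otimes>\<^bsub>D\<^esub> inv\<^bsub>D\<^esub> l) \<xi> = \<one>\<^bsub>QmodZ\<^esub>"
        using \<xi> D_closed[OF lD \<xi>(1)] by (simp add: mult_QZ_dual D_inv[OF lD])
    qed
    moreover have "l' = (l' \<otimes>\<^bsub>D\<^esub> inv\<^bsub>D\<^esub> l) \<otimes>\<^bsub>D\<^esub> l" using lD l'D by (simp add: D.m_assoc)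
    ultimately show "l' \<in> dual_image #>\<^bsub>D\<^esub> l" unfolding r_coset_def by blast
  next
    fix l' assume "l' \<in> dual_image #>\<^bsub>D\<^esub> l"
    then obtain i where i: "i \<in> dual_image" "l' = i \<otimes>\<^bsub>D\<^esub> l" by (auto simp: r_coset_def)
    have iD: "i \<in> carrier D" using i(1) by (simp add: dual_image_eq)
    show "l' \<in> pairing_set h"
      unfolding pairing_set_def
    proof (intro CollectI conjI ballI impI)
      show "l' \<in> carrier D" using iD lD i by simp
      fix \<chi> \<xi> assume *: "\<chi> \<in> carrier (QZ_dual GH)" "\<xi> \<in> carrier P.Sha" "transferred \<chi> \<xi>"
      show "l' \<xi> = \<chi> h"
        using dual_image_kills[OF i(1) *(3,2)] pairing_setD[OF l *] D_closed[OF lD *(2)] *(2) pairing_setD[OF l *]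
        by (simp add: i(2) mult_QZ_dual)
    qed
  }
qed

lemma pairing_set_mult:
  assumes "l \<in> pairing_set h" "l' \<in> pairing_set h'" "h \<in> HD" "h' \<in> HD"
  shows "l \<otimes>\<^bsub>D\<^esub> l' \<in> pairing_set (h \<otimes> h')"
  unfolding pairing_set_def
proof (intro CollectI conjI ballI impI)
  interpret D: comm_group D by (rule comm_group_D)
  show "l \<otimes>\<^bsub>D\<^esub> l' \<in> carrier D" using assms by (auto simp: pairing_set_D)
  fix \<chi> \<xi> assume *: "\<chi> \<in> carrier (QZ_dual GH)" "\<xi> \<in> carrier P.Sha" "transferred \<chi> \<xi>"
  have "\<chi> (h \<otimes> h') = \<chi> h \<otimes>\<^bsub>QmodZ\<^esub> \<chi> h'" using *(1) assms by (auto simp: carrier_QZ_dual hom_def)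
  then show "(l \<otimes>\<^bsub>D\<^esub> l') \<xi> = \<chi> (h \<otimes> h')"
    using pairing_setD[OF assms(1) *] pairing_setD[OF assms(2) *] *(2) by (simp add: mult_QZ_dual)
qed

lemma pairing_hom: "pairing_set \<in> hom GN (D Mod dual_image)"
proof (rule homI)
  interpret D: comm_group D by (rule comm_group_D)
  interpret I: normal dual_image D by (rule D.subgroup_imp_normal[OF subgroup_dual_image])
  fix h assume "h \<in> carrier GN"
  then have h: "h \<in> HD" by simp
  obtain l where l: "l \<in> pairing_set h" using pairing_set_nonempty[OF h] .
  show "pairing_set h \<in> carrier (D Mod dual_image)"
    unfolding carrier_FactGroup pairing_set_coset[OF l h] using pairing_set_D[OF l] by blast
  fix h' assume "h' \<in> carrier GN"
  then have h': "h' \<in> HD" by simp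
  obtain l' where l': "l' \<in> pairing_set h'" using pairing_set_nonempty[OF h'] .
  have hh: "h \<otimes> h' \<in> HD" by (rule subgroup.m_closed[OF HD_subgroup h h'])
  show "pairing_set (h \<otimes>\<^bsub>GN\<^esub> h') = pairing_set h \<otimes>\<^bsub>D Mod dual_image\<^esub> pairing_set h'"
    using pairing_set_coset[OF pairing_set_mult[OF l l' h h'] hh] I.rcos_sum[of l l'] pairing_set_D[OF l] pairing_set_D[OF l']
    by (simp add: pairing_set_coset[OF l h] pairing_set_coset[OF l' h'])
qed

text \<open>Lifting a character of A to a class in Sha and applying l gives a character of the dual
  of A. By biduality it is the evaluation at a coset of some h, and this h has l in its
  \<open>pairing_set\<close>.\<close>

lemma pairing_surj:
  assumes l: "l \<in> carrier D" obtains h where "h \<in> HD" "l \<in> pairing_set h"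
proof -
  interpret A: comm_group A by (rule comm_group_A)
  have "\<forall>\<alpha>\<in>carrier (QZ_dual A). \<exists>p. fst p \<in> carrier (QZ_dual GH) \<and> (\<forall>h\<in>HD. fst p h = \<alpha> (Phi #> h)) \<and>
     snd p \<in> carrier P.Sha \<and> transferred (fst p) (snd p)"
  proof
    fix \<alpha> assume "\<alpha> \<in> carrier (QZ_dual A)"
    then obtain \<chi> \<xi> where "\<chi> \<in> carrier (QZ_dual GH)" "\<forall>h\<in>HD. \<chi> h = \<alpha> (Phi #> h)"
      "\<xi> \<in> carrier P.Sha" "transferred \<chi> \<xi>"
      using character_lift by metis
    then show "\<exists>p. fst p \<in> carrier (QZ_dual GH) \<and> (\<forall>h\<in>HD. fst p h = \<alpha> (Phi #> h)) \<and>
      snd p \<in> carrier P.Sha \<and> transferred (fst p) (snd p)" by (intro exI[of _ "(\<chi>, \<xi>)"]) simp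
  qed
  from bchoice[OF this] obtain f where f: "\<And>\<alpha>. \<alpha> \<in> carrier (QZ_dual A) \<Longrightarrow> fst (f \<alpha>) \<in> carrier (QZ_dual GH) \<and>
     (\<forall>h\<in>HD. fst (f \<alpha>) h = \<alpha> (Phi #> h)) \<and> snd (f \<alpha>) \<in> carrier P.Sha \<and> transferred (fst (f \<alpha>)) (snd (f \<alpha>))" by blast
  define ch where "ch \<alpha> = fst (f \<alpha>)" for \<alpha>
  define xi where "xi \<alpha> = snd (f \<alpha>)" for \<alpha>
  have lift: "ch \<alpha> \<in> carrier (QZ_dual GH)" "h \<in> HD \<Longrightarrow> ch \<alpha> h = \<alpha> (Phi #> h)"
      "xi \<alpha> \<in> carrier P.Sha" "transferred (ch \<alpha>) (xi \<alpha>)" if "\<alpha> \<in> carrier (QZ_dual A)" for \<alpha> h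
    using f[OF that] by (auto simp: ch_def xi_def)
  have chh: "ch \<alpha> \<in> hom GH QmodZ" if "\<alpha> \<in> carrier (QZ_dual A)" for \<alpha>
    using lift(1)[OF that] by (simp add: carrier_QZ_dual)
  interpret DA: comm_group "QZ_dual A" by (rule comm_group_QZ_dual[OF A.is_group])
  \<comment> \<open>Although the lifts are arbitrary, their classes depend only on the restrictions
    to \<open>HD\<close>, which are multiplicative in \<open>\<alpha>\<close>.\<close>
  have mult: "xi (\<alpha> \<otimes>\<^bsub>QZ_dual A\<^esub> \<beta>) = xi \<alpha> \<otimes>\<^bsub>P.H2\<^esub> xi \<beta>" 
    if a: "\<alpha> \<in> carrier (QZ_dual A)" and b: "\<beta> \<in> carrier (QZ_dual A)" for \<alpha> \<beta>
  proof -
    have ab: "\<alpha> \<otimes>\<^bsub>QZ_dual A\<^esub> \<beta> \<in> carrier (QZ_dual A)" using a b by simp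
    have c: "ch \<zeta> k \<in> carrier QmodZ" if "\<zeta> \<in> carrier (QZ_dual A)" "k \<in> stab" for \<zeta> k 
      using chh that by (auto simp: hom_def)
    have hm: "(\<lambda>k. ch \<alpha> k \<otimes>\<^bsub>QmodZ\<^esub> ch \<beta> k) \<in> hom GH QmodZ"
      by (rule homI) (use a b c hom_mult[OF chh[OF a]] hom_mult[OF chh[OF b]] in \<open>auto simp: QZ.m_ac\<close>)
    have cl: "xi \<alpha> \<otimes>\<^bsub>P.H2\<^esub> xi \<beta> \<in> carrier P.H2"
      using Sha_H2[OF lift(3)[OF a]] Sha_H2[OF lift(3)[OF b]] comm_group.axioms(2)[OF P.comm_group_H2]
      by (simp add: group.is_monoid monoid.m_closed)
    show ?thesis
    proof (rule transferred_class_unique[OF lift(4)[OF ab] transferred_mult[OF lift(4)[OF a] lift(4)[OF b]] chh[OF ab] hm Sha_H2[OF lift(3)[OF ab]] cl])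
      fix h assume h: "h \<in> HD"
      then have "Phi #> h \<in> carrier A" using HD_coset_hom by (auto simp: hom_def)
      then show "ch (\<alpha> \<otimes>\<^bsub>QZ_dual A\<^esub> \<beta>) h = ch \<alpha> h \<otimes>\<^bsub>QmodZ\<^esub> ch \<beta> h"
        unfolding lift(2)[OF ab h] lift(2)[OF a h] lift(2)[OF b h] by (simp only: mult_QZ_dual restrict_apply')
    qed
  qed
  have "(\<lambda>\<alpha>. l (xi \<alpha>)) \<in> hom (QZ_dual A) QmodZ"
    by (rule homI) (use lift(3) D_closed[OF l] D_mult[OF l] mult in auto)
  then obtain a where a: "a \<in> carrier A" "\<And>\<alpha>. \<alpha> \<in> carrier (QZ_dual A) \<Longrightarrow> l (xi \<alpha>) = \<alpha> a"
    using QZ_bidual[OF comm_group_A finite_A] by blast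
  obtain h where h: "h \<in> HD" "a = Phi #> h" using A_cases[OF a(1)] .
  have "l \<in> pairing_set h"
    unfolding pairing_set_def
  proof (intro CollectI conjI ballI impI l)
    fix \<chi> \<xi> assume *: "\<chi> \<in> carrier (QZ_dual GH)" "\<xi> \<in> carrier P.Sha" "transferred \<chi> \<xi>"
    have \<chi>: "\<chi> \<in> hom GH QmodZ" using *(1) by (simp add: carrier_QZ_dual)
    then have \<chi>N: "\<chi> \<in> hom GN QmodZ" by (auto simp: hom_def)
    \<comment> \<open>A character with a class in Sha kills the focal subgroup, so on
      \<open>HD\<close> it comes from a character \<open>\<alpha>\<close> of A, and uniqueness
      identifies its class with \<open>xi \<alpha>\<close>.\<close>
    have ker: "\<chi> h = \<one>\<^bsub>QmodZ\<^esub>" if "h \<in> carrier GN" "Phi #> h = \<one>\<^bsub>A\<^esub>" for h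
      using transferred_kills_focal[OF \<chi> *(3,2)] HD_coset_one that by auto
    obtain \<alpha>0 where \<alpha>0: "\<alpha>0 \<in> hom A QmodZ" "\<forall>h\<in>HD. \<alpha>0 (Phi #> h) = \<chi> h"
    proof (rule QmodZ_injective[OF group_GN comm_group_A HD_coset_hom \<chi>N ker])
      fix l assume "l \<in> hom A QmodZ" "\<And>h. h \<in> carrier GN \<Longrightarrow> l (Phi #> h) = \<chi> h"
      then show thesis by (intro that[of l]) auto
    qed
    define \<alpha> where "\<alpha> = restrict \<alpha>0 (carrier A)"
    have \<alpha>: "\<alpha> \<in> carrier (QZ_dual A)" unfolding \<alpha>_def by (rule restrict_in_QZ_dual[OF A.is_group \<alpha>0(1)])
    have \<alpha>h: "\<alpha> (Phi #> h) = \<chi> h" if "h \<in> HD" for h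
    proof -
      have "Phi #> h \<in> carrier A" using that HD_coset_hom by (auto simp: hom_def)
      then show ?thesis using \<alpha>0(2) that by (simp only: \<alpha>_def restrict_apply if_True)
    qed
    have "xi \<alpha> = \<xi>"
      by (rule transferred_class_unique[OF lift(4)[OF \<alpha>] *(3) chh[OF \<alpha>] \<chi> Sha_H2[OF lift(3)[OF \<alpha>]] Sha_H2[OF *(2)]])
         (simp only: lift(2)[OF \<alpha>] \<alpha>h)
    then show "l \<xi> = \<chi> h" using a(2)[OF \<alpha>] \<alpha>h[OF h(1)] h(2) by simp
  qed
  then show thesis using that h by blast
qed

text \<open>For h outside the focal subgroup some character of A is nontrivial at its coset, and the
  class to which it lifts shows that \<open>pairing_set h\<close> is not the trivial coset. For h
  inside, the trivial functional has the prescribed values.\<close>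

lemma pairing_kernel: "kernel GN (D Mod dual_image) pairing_set = Phi"
proof (intro equalityI subsetI)
  interpret D: comm_group D by (rule comm_group_D)
  fix h assume "h \<in> kernel GN (D Mod dual_image) pairing_set"
  then have h: "h \<in> HD" "pairing_set h = dual_image" by (auto simp: kernel_def)
  show "h \<in> Phi"
  proof (rule ccontr)
    assume "h \<notin> Phi"
    then have "Phi #> h \<noteq> \<one>\<^bsub>A\<^esub>" using HD_coset_one[OF h(1)] by simp
    moreover have "Phi #> h \<in> carrier A" using h(1) HD_coset_hom by (auto simp: hom_def)
    ultimately obtain \<alpha> where \<alpha>: "\<alpha> \<in> carrier (QZ_dual A)" "\<alpha> (Phi #> h) \<noteq> \<one>\<^bsub>QmodZ\<^esub>"
      using QZ_dual_separates[OF comm_group_A finite_A] by metis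
    obtain \<chi> \<xi> where *: "\<chi> \<in> carrier (QZ_dual GH)" "\<forall>h\<in>HD. \<chi> h = \<alpha> (Phi #> h)"
      "\<xi> \<in> carrier P.Sha" "transferred \<chi> \<xi>"
      using character_lift[OF \<alpha>(1)] by metis
    obtain l where l: "l \<in> pairing_set h" using pairing_set_nonempty[OF h(1)] .
    have "\<chi> h = l \<xi>" using pairing_setD[OF l *(1,3,4)] by simp
    also have "\<dots> = \<one>\<^bsub>QmodZ\<^esub>" using dual_image_kills[OF _ *(4,3)] l h(2) by blast
    finally show False using \<alpha>(2) *(2) h(1) by simp
  qed
next
  interpret D: comm_group D by (rule comm_group_D)
  fix h assume h: "h \<in> Phi"
  then have hN: "h \<in> HD" using Phi_HD by blast
  have "\<one>\<^bsub>D\<^esub> \<in> pairing_set h"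
    unfolding pairing_set_def
  proof (intro CollectI conjI ballI impI)
    show "\<one>\<^bsub>D\<^esub> \<in> carrier D" by simp
    fix \<chi> \<xi> assume *: "\<chi> \<in> carrier (QZ_dual GH)" "\<xi> \<in> carrier P.Sha" "transferred \<chi> \<xi>"
    have "\<chi> \<in> hom GH QmodZ" using *(1) by (simp add: carrier_QZ_dual)
    then show "\<one>\<^bsub>D\<^esub> \<xi> = \<chi> h" using transferred_kills_focal[OF _ *(3,2) h] *(2) by (simp add: one_QZ_dual)
  qed
  then have "pairing_set h = dual_image #>\<^bsub>D\<^esub> \<one>\<^bsub>D\<^esub>" by (rule pairing_set_coset[OF _ hN])
  also have "\<dots> = dual_image" by (rule D.coset_mult_one[OF subgroup.subset[OF subgroup_dual_image]])
  finally have "pairing_set h = dual_image" .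
  then show "h \<in> kernel GN (D Mod dual_image) pairing_set" using hN by (simp add: kernel_def)
qed

theorem duality:
  "\<exists>\<psi> \<in> iso A (D Mod dual_image). \<forall>h\<in>HD. \<forall>\<chi>\<in>carrier (QZ_dual GH). \<forall>\<xi>\<in>carrier P.Sha.
     transferred \<chi> \<xi> \<longrightarrow> (\<forall>l \<in> \<psi> (Phi #> h). l \<xi> = \<chi> h)"
proof -
  interpret GN: group GN by (rule group_GN)
  interpret D: comm_group D by (rule comm_group_D)
  interpret DI: comm_group "D Mod dual_image" by (rule D.abelian_FactGroup[OF subgroup_dual_image])
  interpret h: group_hom GN "D Mod dual_image" pairing_set using pairing_hom by unfold_locales
  have surj: "pairing_set ` carrier GN = carrier (D Mod dual_image)"
  proof
    show "pairing_set ` carrier GN \<subseteq> carrier (D Mod dual_image)" using h.hom_closed by blast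
    show "carrier (D Mod dual_image) \<subseteq> pairing_set ` carrier GN"
    proof
      fix X' assume "X' \<in> carrier (D Mod dual_image)"
      then obtain l where l: "l \<in> carrier D" "X' = dual_image #>\<^bsub>D\<^esub> l" by (auto simp: carrier_FactGroup)
      obtain h where "h \<in> HD" "l \<in> pairing_set h" using pairing_surj[OF l(1)] .
      then show "X' \<in> pairing_set ` carrier GN" using pairing_set_coset l(2) by auto
    qed
  qed
  define \<psi> where "\<psi> X' = the_elem (pairing_set ` X')" for X'
  have iso: "\<psi> \<in> iso A (D Mod dual_image)"
    using h.FactGroup_iso_set[OF surj] by (simp add: pairing_kernel \<psi>_def[abs_def])
  \<comment> \<open>\<open>pairing_set\<close> is constant on the coset, so \<open>the_elem\<close>
    returns this common value and the isomorphism inherits the description of the pairing.\<close>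
  have \<psi>: "\<psi> (Phi #> h) = pairing_set h" if h: "h \<in> HD" for h
  proof -
    have "pairing_set (f \<otimes> h) = pairing_set h" if f: "f \<in> Phi" for f
    proof -
      have fN: "f \<in> HD" using f Phi_HD by blast
      have "pairing_set f = \<one>\<^bsub>D Mod dual_image\<^esub>" using f pairing_kernel by (auto simp: kernel_def)
      moreover have "pairing_set (f \<otimes> h) = pairing_set f \<otimes>\<^bsub>D Mod dual_image\<^esub> pairing_set h"
        using hom_mult[OF pairing_hom, of f h] fN h by (simp del: mult_FactGroup)
      moreover have "pairing_set h \<in> carrier (D Mod dual_image)" using h.hom_closed[of h] h by simp
      ultimately show ?thesis by (simp del: mult_FactGroup one_FactGroup)
    qed
    then have "pairing_set ` (Phi #> h) = {pairing_set h}"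
      using subgroup.one_closed[OF P.subgroup_focal[OF stab_subgroup]] by (auto simp: r_coset_def)
    then show ?thesis by (simp add: \<psi>_def)
  qed
  show ?thesis
    by (rule bexI[OF _ iso]) (use \<psi> pairing_setD in auto)
qed

end

section \<open>Galois groups\<close>

lemma ambient_simps [simp]:
  "carrier ambient = UNIV" "x \<otimes>\<^bsub>ambient\<^esub> y = x * y" "\<one>\<^bsub>ambient\<^esub> = 1" "\<zero>\<^bsub>ambient\<^esub> = 0" "x \<oplus>\<^bsub>ambient\<^esub> y = x + y"
  by (simp_all add: ring_of_type_algebra_def)

lemma field_ambient: "field (ambient :: 'a::field_char_0 ring)"
  by (rule field_from_type_algebra)

lemma ambient_pow: "(x :: 'a::field_char_0) [^]\<^bsub>ambient\<^esub> (n::nat) = x ^ n"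
  by (induction n) (simp_all add: nat_pow_def mult.commute)

lemma ambient_inv:
  assumes "(x :: 'a::field_char_0) \<noteq> 0" shows "inv\<^bsub>ambient\<^esub> x = inverse x"
proof -
  interpret amb: field "ambient :: 'a ring" by (rule field_ambient)
  show ?thesis by (rule amb.comm_inv_char) (use assms in auto)
qed

lemma ambient_minus: "\<ominus>\<^bsub>ambient\<^esub> (x :: 'a::field_char_0) = - x"
proof -
  interpret amb: field "ambient :: 'a ring" by (rule field_ambient)
  show ?thesis by (rule amb.minus_equality) auto
qed

lemma subfield_closed:
  fixes F :: "'a::field_char_0 set"
  assumes F: "subfield F ambient"
  shows "0 \<in> F" "1 \<in> F" "x \<in> F \<Longrightarrow> y \<in> F \<Longrightarrow> x + y \<in> F" "x \<in> F \<Longrightarrow> y \<in> F \<Longrightarrow> x * y \<in> F"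
    "x \<in> F \<Longrightarrow> - x \<in> F" "x \<in> F \<Longrightarrow> inverse x \<in> F"
proof -
  interpret amb: field "ambient :: 'a ring" by (rule field_ambient)
  note s = subringE[OF subfieldE(1)[OF F]]
  show "0 \<in> F" "1 \<in> F" using s(2,3) by auto
  show "x \<in> F \<Longrightarrow> y \<in> F \<Longrightarrow> x + y \<in> F" using s(7)[of x y] by simp
  show "x \<in> F \<Longrightarrow> y \<in> F \<Longrightarrow> x * y \<in> F" using s(6)[of x y] by simp
  show "x \<in> F \<Longrightarrow> - x \<in> F" using s(5)[of x] by (simp add: ambient_minus)
  show "x \<in> F \<Longrightarrow> inverse x \<in> F"
    using amb.subfield_m_inv(1)[OF F, of x] \<open>0 \<in> F\<close> by (cases "x = 0") (auto simp: ambient_inv)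
qed

lemma subfield_more:
  fixes F :: "'a::field_char_0 set"
  assumes F: "subfield F ambient"
  shows "x \<in> F \<Longrightarrow> y \<in> F \<Longrightarrow> x - y \<in> F" "x \<in> F \<Longrightarrow> x ^ n \<in> F" "of_nat n \<in> F" "of_int i \<in> F"
    "x \<in> F \<Longrightarrow> x powi i \<in> F" "(\<And>j. j \<in> J \<Longrightarrow> f j \<in> F) \<Longrightarrow> sum f J \<in> F" "(\<And>j. j \<in> J \<Longrightarrow> f j \<in> F) \<Longrightarrow> prod f J \<in> F"
proof -
  note c = subfield_closed[OF F]
  show "x \<in> F \<Longrightarrow> y \<in> F \<Longrightarrow> x - y \<in> F" using c(3)[of x "- y"] c(5) by simp
  have pow: "x ^ n \<in> F" if "x \<in> F" for x n by (induction n) (use c that in auto)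
  then show "x \<in> F \<Longrightarrow> x ^ n \<in> F" by blast
  show n: "of_nat n \<in> F" for n by (induction n) (use c in auto)
  show "of_int i \<in> F" by (cases i) (use n c(5)[OF n] in \<open>auto simp del: of_nat_Suc\<close>)
  show "x \<in> F \<Longrightarrow> x powi i \<in> F" by (simp add: power_int_def pow c(6))
  show "(\<And>j. j \<in> J \<Longrightarrow> f j \<in> F) \<Longrightarrow> sum f J \<in> F"
    by (induction J rule: infinite_finite_induct) (use c in auto)
  show "(\<And>j. j \<in> J \<Longrightarrow> f j \<in> F) \<Longrightarrow> prod f J \<in> F"
    by (induction J rule: infinite_finite_induct) (use c in auto)
qed

lemma Rats_subset_subfield:
  assumes F: "subfield (F :: 'a::field_char_0 set) ambient" shows "\<rat> \<subseteq> F"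
proof
  fix x :: 'a assume "x \<in> \<rat>"
  then obtain a b where "x = of_int a / of_int b" by (rule Rats_cases')
  then show "x \<in> F" using subfield_closed[OF F] subfield_more(4)[OF F] by (auto simp: divide_inverse)
qed

section \<open>Embeddings of subfields\<close>

lemma embeddings_iff:
  "\<sigma> \<in> embeddings k K L \<longleftrightarrow> \<sigma> \<in> extensional K \<and> (\<forall>x\<in>K. \<sigma> x \<in> L) \<and> (\<forall>x\<in>K. \<forall>y\<in>K. \<sigma> (x * y) = \<sigma> x * \<sigma> y) \<and>
     (\<forall>x\<in>K. \<forall>y\<in>K. \<sigma> (x + y) = \<sigma> x + \<sigma> y) \<and> \<sigma> 1 = 1 \<and> (\<forall>x\<in>k. \<sigma> x = x)"
  by (auto simp: embeddings_def ring_hom_def)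

context
  fixes k K L :: "'a::field_char_0 set" and \<sigma>
  assumes K: "subfield K ambient" and \<sigma>: "\<sigma> \<in> embeddings k K L"
begin

lemma emb_closed: "x \<in> K \<Longrightarrow> \<sigma> x \<in> L" and emb_mult: "x \<in> K \<Longrightarrow> y \<in> K \<Longrightarrow> \<sigma> (x * y) = \<sigma> x * \<sigma> y"
  and emb_add: "x \<in> K \<Longrightarrow> y \<in> K \<Longrightarrow> \<sigma> (x + y) = \<sigma> x + \<sigma> y" and emb_one: "\<sigma> 1 = 1" and emb_fix: "x \<in> k \<Longrightarrow> \<sigma> x = x"
  and emb_ext: "\<sigma> \<in> extensional K"
  using \<sigma> by (auto simp: embeddings_iff)

lemma emb_zero: "\<sigma> 0 = 0"
  using emb_add[of 0 0] subfield_closed(1)[OF K] by simp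

lemma emb_minus: "x \<in> K \<Longrightarrow> \<sigma> (- x) = - \<sigma> x"
  using emb_add[of x "- x"] subfield_closed(5)[OF K] emb_zero by (simp add: eq_neg_iff_add_eq_0 add.commute)

lemma emb_diff: "x \<in> K \<Longrightarrow> y \<in> K \<Longrightarrow> \<sigma> (x - y) = \<sigma> x - \<sigma> y"
  using emb_add[of x "- y"] subfield_closed(5)[OF K] emb_minus by simp

lemma emb_nonzero: "x \<in> K \<Longrightarrow> x \<noteq> 0 \<Longrightarrow> \<sigma> x \<noteq> 0"
  using emb_mult[of x "inverse x"] subfield_closed(6)[OF K] emb_one by auto

lemma emb_inverse: "x \<in> K \<Longrightarrow> \<sigma> (inverse x) = inverse (\<sigma> x)"
  using emb_mult[of x "inverse x"] subfield_closed(6)[OF K] emb_one emb_zero emb_nonzero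
  by (cases "x = 0") (auto simp: field_simps)

lemma emb_inj: "inj_on \<sigma> K"
proof (rule inj_onI)
  fix x y assume xy: "x \<in> K" "y \<in> K" "\<sigma> x = \<sigma> y"
  then have "\<sigma> (x - y) = 0" by (simp add: emb_diff)
  then show "x = y" using emb_nonzero[of "x - y"] subfield_more(1)[OF K xy(1,2)] by auto
qed

lemma emb_power: "x \<in> K \<Longrightarrow> \<sigma> (x ^ n) = \<sigma> x ^ n"
  by (induction n) (use emb_one emb_mult subfield_more(2)[OF K] in auto)

lemma emb_powi: "x \<in> K \<Longrightarrow> \<sigma> (x powi i) = \<sigma> x powi i"
  using emb_power emb_inverse subfield_closed(6)[OF K] by (simp add: power_int_def)

lemma emb_sum: "(\<And>j. j \<in> J \<Longrightarrow> f j \<in> K) \<Longrightarrow> \<sigma> (sum f J) = (\<Sum>j\<in>J. \<sigma> (f j))"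
proof (induction J rule: infinite_finite_induct)
  case (insert j J)
  then show ?case using emb_add[OF insert.prems[OF insertI1] subfield_more(6)[OF K, of J f]] by simp
qed (use emb_zero in auto)

lemma emb_prod: "(\<And>j. j \<in> J \<Longrightarrow> f j \<in> K) \<Longrightarrow> \<sigma> (prod f J) = (\<Prod>j\<in>J. \<sigma> (f j))"
proof (induction J rule: infinite_finite_induct)
  case (insert j J)
  then show ?case using emb_mult[OF insert.prems[OF insertI1] subfield_more(7)[OF K, of J f]] by simp
qed (use emb_one in auto)

lemma emb_of_nat: "\<sigma> (of_nat n) = of_nat n"
  by (induction n) (use emb_zero emb_one emb_add subfield_more(3)[OF K] subfield_closed(2)[OF K] in auto)

lemma emb_of_int: "\<sigma> (of_int i) = of_int i"
  by (cases i) (use emb_of_nat emb_minus[OF subfield_more(3)[OF K]] in \<open>auto simp del: of_nat_Suc\<close>)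

lemma emb_Rats: "x \<in> \<rat> \<Longrightarrow> \<sigma> x = x"
proof -
  assume "x \<in> \<rat>"
  then obtain a b where "x = of_int a / of_int b" by (rule Rats_cases')
  then show ?thesis
    using emb_mult[of "of_int a" "inverse (of_int b)"] subfield_more(4)[OF K] subfield_closed(6)[OF K] emb_inverse emb_of_int
    by (simp add: divide_inverse)
qed

end

lemma embeddings_compose:
  assumes "\<sigma> \<in> embeddings k K L" "\<tau> \<in> embeddings k L M" "subfield K ambient" "k \<subseteq> K"
  shows "compose K \<tau> \<sigma> \<in> embeddings k K M"
  using assms subfield_closed[of K] by (auto simp: embeddings_iff compose_def subset_iff)

lemma embeddings_restrict:
  assumes "\<sigma> \<in> embeddings k L M" "K \<subseteq> L" "subfield K ambient" "k \<subseteq> K"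
  shows "restrict \<sigma> K \<in> embeddings k K M"
  using assms subfield_closed[of K] by (auto simp: embeddings_iff subset_iff)

section \<open>Galois groups and conjugate polynomials\<close>

lemma carrier_Gal: "carrier (Gal L k) = Bij L \<inter> embeddings k L L"
  by (simp add: Gal_def)

lemma group_Gal:
  assumes L: "subfield L ambient" and kL: "k \<subseteq> L" shows "group (Gal L k)"
proof -
  interpret B: group "BijGroup L" by (rule group_BijGroup)
  have "subgroup (Bij L \<inter> embeddings k L L) (BijGroup L)"
  proof (rule B.subgroupI)
    show "Bij L \<inter> embeddings k L L \<subseteq> carrier (BijGroup L)" by (auto simp: BijGroup_def)
    have "(\<lambda>x\<in>L. x) \<in> Bij L \<inter> embeddings k L L"
      using id_Bij subfield_closed[OF L] kL by (auto simp: embeddings_iff)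
    then show "Bij L \<inter> embeddings k L L \<noteq> {}" by blast
  next
    fix g assume g: "g \<in> Bij L \<inter> embeddings k L L"
    then have gB: "g \<in> Bij L" and ge: "g \<in> embeddings k L L" by auto
    have bij: "bij_betw g L L" using gB by (simp add: Bij_def)
    define g' where "g' = restrict (inv_into L g) L"
    have 1: "g' x \<in> L" "g (g' x) = x" if "x \<in> L" for x
      using that bij by (auto simp: g'_def bij_betw_def inv_into_into f_inv_into_f)
    have 2: "g' (g x) = x" if "x \<in> L" for x
      using that bij emb_closed[OF L ge] by (auto simp: g'_def bij_betw_def)
    have eq: "g' y = x" if "x \<in> L" "g x = y" for x y using 2 that by auto
    have "g' \<in> embeddings k L L"
      unfolding embeddings_iff
    proof (intro conjI ballI)
      show "g' \<in> extensional L" by (simp add: g'_def)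
      show "g' x \<in> L" if "x \<in> L" for x using 1 that by blast
      show "g' (x * y) = g' x * g' y" if "x \<in> L" "y \<in> L" for x y
        by (rule eq) (use that 1 emb_mult[OF L ge] subfield_closed[OF L] in auto)
      show "g' (x + y) = g' x + g' y" if "x \<in> L" "y \<in> L" for x y
        by (rule eq) (use that 1 emb_add[OF L ge] subfield_closed[OF L] in auto)
      show "g' 1 = 1" by (rule eq) (use emb_one[OF L ge] subfield_closed[OF L] in auto)
      show "g' x = x" if "x \<in> k" for x by (rule eq) (use that kL emb_fix[OF L ge] in auto)
    qed
    then show "inv\<^bsub>BijGroup L\<^esub> g \<in> Bij L \<inter> embeddings k L L"
      using restrict_inv_into_Bij[OF gB] by (simp add: inv_BijGroup[OF gB] g'_def)
  next
    fix g h assume "g \<in> Bij L \<inter> embeddings k L L" "h \<in> Bij L \<inter> embeddings k L L"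
    then show "g \<otimes>\<^bsub>BijGroup L\<^esub> h \<in> Bij L \<inter> embeddings k L L"
      using embeddings_compose[OF _ _ L kL] by (auto simp: BijGroup_def compose_Bij)
  qed
  then show ?thesis unfolding Gal_def by (rule B.subgroup_imp_group)
qed

lemma mult_Gal:
  assumes "g \<in> carrier (Gal L k)" "h \<in> carrier (Gal L k)"
  shows "g \<otimes>\<^bsub>Gal L k\<^esub> h = compose L g h"
  using assms by (simp add: Gal_def BijGroup_def)

lemma one_Gal: "\<one>\<^bsub>Gal L k\<^esub> = (\<lambda>x\<in>L. x)"
  by (simp add: Gal_def BijGroup_def)

text \<open>Applying g to the coefficients of a product of linear factors moves its roots by g.
  Needed to see that an orbit polynomial is fixed by the Galois group.\<close>

lemma map_poly_prod_linear:
  assumes L: "subfield L ambient" and g: "g \<in> embeddings k L M" and T: "finite T" "T \<subseteq> L"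
  shows "(\<forall>n. poly.coeff (\<Prod>t\<in>T. [:- t, 1:]) n \<in> L) \<and> 
     (\<forall>n. poly.coeff (\<Prod>t\<in>T. [:- g t, 1:]) n = g (poly.coeff (\<Prod>t\<in>T. [:- t, 1:]) n))"
  using T
proof (induction T)
  case empty
  then show ?case using subfield_closed[OF L] emb_one[OF L g] emb_zero[OF L g] by simp
next
  case (insert t T)
  define q where "q = (\<Prod>t\<in>T. [:- t, 1:])"
  define q' where "q' = (\<Prod>t\<in>T. [:- g t, 1:])"
  have t: "t \<in> L" and qL: "poly.coeff q n \<in> L" and q': "poly.coeff q' n = g (poly.coeff q n)" for n
    using insert by (auto simp: q_def q'_def)
  have p: "poly.coeff (pCons 0 q) n \<in> L" "poly.coeff (pCons 0 q') n = g (poly.coeff (pCons 0 q) n)" for n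
    using qL q' subfield_closed(1)[OF L] emb_zero[OF L g] by (cases n; simp)+
  have "poly.coeff ([:- t, 1:] * q) n \<in> L \<and> poly.coeff ([:- g t, 1:] * q') n = g (poly.coeff ([:- t, 1:] * q) n)" for n
    using t qL[of n] q'[of n] p[of n] subfield_closed(4)[OF L] subfield_more(1)[OF L] emb_diff[OF L g] emb_mult[OF L g] by simp
  then show ?case using insert.hyps by (simp add: q_def q'_def)
qed

text \<open>
  A vector space over an infinite field is not a finite union of proper subspaces; here the subspaces
  are those where \<open>\<sigma>\<close> agrees with some \<open>\<tau>\<close> in \<open>R\<close>.
\<close>

lemma embedding_among:
  assumes K: "subfield K ambient" and \<sigma>: "\<sigma> \<in> embeddings k K L" 
    and R: "finite R" "R \<subseteq> embeddings k K L" and ex: "\<And>x. x \<in> K \<Longrightarrow> \<exists>\<tau>\<in>R. \<sigma> x = \<tau> x"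
  shows "\<sigma> \<in> R"
  using R ex
proof (induction R)
  case empty
  then show ?case using subfield_closed(1)[OF K] by blast
next
  case (insert \<tau> R)
  show ?case
  proof (cases "\<sigma> = \<tau>")
    case False
    have \<tau>: "\<tau> \<in> embeddings k K L" using insert by blast
    obtain u where u: "u \<in> K" "\<sigma> u \<noteq> \<tau> u"
      using False extensionalityI[OF emb_ext[OF K \<sigma>] emb_ext[OF K \<tau>]] by blast
    have "\<exists>\<tau>'\<in>R. \<sigma> w = \<tau>' w" if w: "w \<in> K" for w
    proof (rule ccontr)
      assume no: "\<not> (\<exists>\<tau>'\<in>R. \<sigma> w = \<tau>' w)"
      then have w\<tau>: "\<sigma> w = \<tau> w" using insert.prems(2)[OF w] by auto
      have val: "\<rho> (u + of_nat n * w) = \<rho> u + of_nat n * \<rho> w" if "\<rho> \<in> embeddings k K L" for \<rho> n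
        using that u(1) w subfield_closed[OF K] subfield_more(3)[OF K]
        by (simp add: emb_add[OF K that] emb_mult[OF K that] emb_of_nat[OF K that])
      \<comment> \<open>On the line u + n w the maps \<open>\<sigma>\<close> and
        \<open>\<tau>\<close> agree nowhere. Since R is finite, one of its members agrees with
        \<open>\<sigma>\<close> at two points of the line, and as both are affine in n it agrees
        with \<open>\<sigma>\<close> at w.\<close>
      have "\<exists>\<tau>'\<in>R. \<sigma> (u + of_nat n * w) = \<tau>' (u + of_nat n * w)" for n
      proof -
        have "u + of_nat n * w \<in> K" using u(1) w subfield_closed[OF K] subfield_more(3)[OF K] by simp
        then obtain \<rho> where \<rho>: "\<rho> \<in> insert \<tau> R" "\<sigma> (u + of_nat n * w) = \<rho> (u + of_nat n * w)"
          using insert.prems(2) by blast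
        have "\<rho> \<noteq> \<tau>" using \<rho>(2) u(2) w\<tau> val[OF \<sigma>] val[OF \<tau>] by auto
        then show ?thesis using \<rho> by blast
      qed
      then obtain f where f: "\<And>n. f n \<in> R" "\<And>n. \<sigma> (u + of_nat n * w) = f n (u + of_nat n * w)" by metis
      have "\<not> inj f"
      proof
        assume "inj f"
        then have "infinite (range f)" by (rule range_inj_infinite)
        moreover have "range f \<subseteq> R" using f(1) by blast
        ultimately show False using insert.hyps(1) finite_subset by blast
      qed
      then obtain m n where mn: "m \<noteq> n" "f m = f n" by (auto simp: inj_def)
      have fn: "f n \<in> embeddings k K L" using f(1) insert.prems(1) by blast
      have "\<sigma> u + of_nat n * \<sigma> w = f n u + of_nat n * f n w" using f(2)[of n] val[OF \<sigma>] val[OF fn] by simp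
      moreover have "\<sigma> u + of_nat m * \<sigma> w = f n u + of_nat m * f n w" using f(2)[of m] val[OF \<sigma>] val[OF fn] mn by simp
      ultimately have e: "\<sigma> u - f n u = of_nat n * (f n w - \<sigma> w)" "\<sigma> u - f n u = of_nat m * (f n w - \<sigma> w)"
        by (simp_all add: algebra_simps)
      have "(of_nat n - of_nat m) * (f n w - \<sigma> w) = 0"
        unfolding left_diff_distrib e[symmetric] by simp
      then have "\<sigma> w = f n w" using mn(1) by simp
      then show False using no f(1) by blast
    qed
    then have "\<sigma> \<in> R" using insert by blast
    then show ?thesis by simp
  qed simp
qed

section \<open>Automorphisms and embeddings in a Galois tower\<close>

locale galois_tower =
  fixes k K L :: "'a::field_char_0 set"
  assumes k_nf: "number_field k" and K_nf: "number_field K" and L_nf: "number_field L"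
    and kK: "k \<subseteq> K" and KL: "K \<subseteq> L" and gal: "galois_ext L k"
begin

lemma subfield_K: "subfield K ambient" and subfield_L: "subfield L ambient"
  using K_nf L_nf by (auto simp: number_field_def)

lemma kL: "k \<subseteq> L" using kK KL by blast

abbreviation "G \<equiv> Gal L k"

sublocale G: group G by (rule group_Gal[OF subfield_L kL])

lemma G_emb: "g \<in> carrier G \<Longrightarrow> g \<in> embeddings k L L" by (simp add: carrier_Gal)

lemma G_closed: "g \<in> carrier G \<Longrightarrow> x \<in> L \<Longrightarrow> g x \<in> L"
  using emb_closed[OF subfield_L G_emb] .

lemma G_mult_apply: "\<lbrakk>g \<in> carrier G; h \<in> carrier G; x \<in> L\<rbrakk> \<Longrightarrow> (g \<otimes>\<^bsub>G\<^esub> h) x = g (h x)"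
  by (simp add: mult_Gal compose_def)

lemma G_inv_apply: 
  assumes "g \<in> carrier G" "x \<in> L" shows "(inv\<^bsub>G\<^esub> g) (g x) = x" "g ((inv\<^bsub>G\<^esub> g) x) = x"
  using G_mult_apply[of "inv\<^bsub>G\<^esub> g" g x] G_mult_apply[of g "inv\<^bsub>G\<^esub> g" x] assms by (simp_all add: one_Gal)

text \<open>An automorphism sends each basis element of L over the rationals to a root of the same
  nonzero rational polynomial, and it is determined by the images of the basis.\<close>

lemma finite_G: "finite (carrier G)"
proof -
  interpret amb: field "ambient :: 'a ring" by (rule field_ambient)
  have Q: "subfield (\<rat> :: 'a set) ambient"
    by (rule amb.subfieldI'[OF amb.subringI]) (auto simp: ambient_inv ambient_minus)
  have fd: "amb.finite_dimension \<rat> L" using L_nf by (simp add: number_field_def)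
  then obtain n where n: "amb.dimension n \<rat> L" by (auto simp: amb.finite_dimension_def)
  obtain Vs where Vs: "set Vs \<subseteq> carrier ambient" "amb.Span \<rat> Vs = L"
    using amb.exists_base[OF Q n] by blast
  have VL: "set Vs \<subseteq> L" using amb.Span_base_incl[OF Q Vs(1)] Vs(2) by simp
  have alg: "\<exists>p. p \<in> carrier (\<rat>[X]\<^bsub>ambient\<^esub>) \<and> p \<noteq> [] \<and> amb.eval p v = 0" if "v \<in> L" for v
  proof -
    have a: "(amb.algebraic over \<rat>) v"
      by (rule amb.finite_dimension_imp_algebraic[OF Q subfieldE(1)[OF subfield_L] fd that])
    have "v \<in> carrier ambient" by simp
    then obtain p where "p \<in> carrier (\<rat>[X]\<^bsub>ambient\<^esub>)" "p \<noteq> []" "amb.eval p v = \<zero>\<^bsub>ambient\<^esub>"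
      by (rule amb.algebraicE[OF subfieldE(1)[OF Q] _ a])
    then show ?thesis by auto
  qed
  then obtain p where p: "\<And>v. v \<in> L \<Longrightarrow> p v \<in> carrier (\<rat>[X]\<^bsub>ambient\<^esub>)" "\<And>v. v \<in> L \<Longrightarrow> p v \<noteq> []" "\<And>v. v \<in> L \<Longrightarrow> amb.eval (p v) v = 0"
    by metis
  define Z where "Z = (\<Union>v\<in>set Vs. {y. amb.is_root (p v) y})"
  have pc: "q \<in> carrier (poly_ring ambient)" if "q \<in> carrier (\<rat>[X]\<^bsub>ambient\<^esub>)" for q :: "'a list"
    using that by (auto simp: univ_poly_def polynomial_def)
  have "finite Z" unfolding Z_def using amb.finite_number_of_roots[OF pc] p(1) VL by (intro finite_UN_I) auto
  have ev: "amb.eval q (g v) = g (amb.eval q v) \<and> amb.eval q v \<in> L" if g: "g \<in> carrier G" and v: "v \<in> L" and q: "set q \<subseteq> \<rat>" for g v and q :: "'a list"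
    using q
  proof (induction q)
    case Nil then show ?case using emb_zero[OF subfield_L G_emb[OF g]] subfield_closed(1)[OF subfield_L] by simp
  next
    case (Cons c q)
    have cL: "c \<in> L" using Cons.prems Rats_subset_subfield[OF subfield_L] by auto
    have vp: "v ^ length q \<in> L" using v subfield_more(2)[OF subfield_L] by blast
    have gc: "g c = c" using emb_Rats[OF subfield_L G_emb[OF g]] Cons.prems by auto
    show ?case using Cons cL vp gc v emb_add[OF subfield_L G_emb[OF g]] emb_mult[OF subfield_L G_emb[OF g]] emb_power[OF subfield_L G_emb[OF g]] subfield_closed[OF subfield_L]
      by (simp add: ambient_pow)
  qed
  have "map g Vs \<in> {xs. set xs \<subseteq> Z \<and> length xs = length Vs}" if g: "g \<in> carrier G" for g
  proof -
    have "g v \<in> Z" if v: "v \<in> set Vs" for v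
    proof -
      have vL: "v \<in> L" using v VL by blast
      have "set (p v) \<subseteq> \<rat>" using p(1)[OF vL] by (auto simp: univ_poly_def polynomial_def)
      then have "amb.eval (p v) (g v) = 0" using ev[OF g vL] p(3)[OF vL] emb_zero[OF subfield_L G_emb[OF g]] by simp
      then have "amb.is_root (p v) (g v)" using p(2)[OF vL] by (simp add: amb.is_root_def)
      then show ?thesis using v by (auto simp: Z_def)
    qed
    then show ?thesis by auto
  qed
  then have "(\<lambda>g. map g Vs) ` carrier G \<subseteq> {xs. set xs \<subseteq> Z \<and> length xs = length Vs}" by blast
  then have fin: "finite ((\<lambda>g. map g Vs) ` carrier G)"
    using finite_lists_length_eq[OF \<open>finite Z\<close>] by (rule finite_subset)
  have "inj_on (\<lambda>g. map g Vs) (carrier G)"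
  proof (rule inj_onI)
    fix g h assume g: "g \<in> carrier G" and h: "h \<in> carrier G" and eq: "map g Vs = map h Vs"
    have comb: "amb.combine Ks Us \<in> L \<and> f (amb.combine Ks Us) = amb.combine Ks (map f Us)" 
      if f: "f \<in> carrier G" and "set Ks \<subseteq> \<rat>" "set Us \<subseteq> L" for f Ks Us
      using that(2,3)
    proof (induction Ks Us rule: amb.combine.induct)
      case (1 c Ks u Us)
      have cL: "c \<in> L" using 1 Rats_subset_subfield[OF subfield_L] by auto
      have gc: "f c = c" using emb_Rats[OF subfield_L G_emb[OF f]] 1 by auto
      show ?case using 1 cL gc emb_add[OF subfield_L G_emb[OF f]] emb_mult[OF subfield_L G_emb[OF f]] subfield_closed[OF subfield_L] by simp
    qed (use emb_zero[OF subfield_L G_emb[OF f]] subfield_closed(1)[OF subfield_L] in auto)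
    show "g = h"
    proof (rule extensionalityI[of _ L])
      show "g \<in> extensional L" "h \<in> extensional L" using emb_ext[OF subfield_L G_emb] g h by auto
      fix x assume "x \<in> L"
      then obtain Ks where "x = amb.combine Ks Vs" "set Ks \<subseteq> \<rat>"
        using amb.Span_eq_combine_set[OF Q Vs(1)] Vs(2) by auto
      then show "g x = h x" using comb[OF g _ VL] comb[OF h _ VL] eq by auto
    qed
  qed
  then show ?thesis using fin finite_imageD by blast
qed

lemma fixed_in_k: "x \<in> L \<Longrightarrow> (\<And>g. g \<in> carrier G \<Longrightarrow> g x = x) \<Longrightarrow> x \<in> k"
  using gal by (auto simp: galois_ext_def)

text \<open>For each x, the value \<open>\<sigma> x\<close> is a root of the orbit polynomial of x,
  hence equals g x for some g that may depend on x. In place of a primitive element,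
  \<open>embedding_among\<close> yields one g for all x.\<close>

lemma embedding_extends:
  assumes F: "subfield F ambient" "k \<subseteq> F" "F \<subseteq> L" and \<sigma>: "\<sigma> \<in> embeddings k F L"
  obtains g where "g \<in> carrier G" "\<sigma> = restrict g F"
proof -
  define R where "R = (\<lambda>g. restrict g F) ` carrier G"
  have "\<exists>\<tau>\<in>R. \<sigma> x = \<tau> x" if x: "x \<in> F" for x
  proof -
    have xL: "x \<in> L" using x F by blast
    define T where "T = (\<lambda>g. g x) ` carrier G"
    have T: "finite T" "T \<subseteq> L" unfolding T_def using finite_G G_closed xL by auto
    \<comment> \<open>The orbit polynomial, with each conjugate counted once. G permutes its roots,
      so its coefficients are fixed by G and lie in k, where \<open>\<sigma>\<close> is the
      identity.\<close>
    define P where "P = (\<Prod>t\<in>T. [:- t, 1:])"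
    have gT: "g ` T = T" if g: "g \<in> carrier G" for g
    proof
      show "g ` T \<subseteq> T" unfolding T_def using g xL by (auto simp flip: G_mult_apply)
      show "T \<subseteq> g ` T"
      proof
        fix t assume "t \<in> T"
        then obtain h where h: "h \<in> carrier G" "t = h x" by (auto simp: T_def)
        then have "t = g ((inv\<^bsub>G\<^esub> g \<otimes>\<^bsub>G\<^esub> h) x)" using g xL by (simp add: G_mult_apply G_inv_apply G_closed)
        then show "t \<in> g ` T" unfolding T_def using g h by blast
      qed
    qed
    have cL: "poly.coeff P n \<in> L" for n
      using map_poly_prod_linear[OF subfield_L G_emb[OF G.one_closed] T] by (simp add: P_def)
    have ck: "poly.coeff P n \<in> k" for n
    proof (rule fixed_in_k[OF cL])
      fix g assume g: "g \<in> carrier G"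
      have inj: "inj_on g T" using emb_inj[OF subfield_L G_emb[OF g]] T(2) by (rule inj_on_subset)
      have "(\<Prod>t\<in>T. [:- g t, 1:]) = (\<Prod>t\<in>g ` T. [:- t, 1:])" by (simp add: prod.reindex[OF inj])
      also have "\<dots> = P" by (simp add: gT[OF g] P_def)
      finally show "g (poly.coeff P n) = poly.coeff P n"
        using map_poly_prod_linear[OF subfield_L G_emb[OF g] T] by (simp add: P_def)
    qed
    have "\<one>\<^bsub>G\<^esub> x = x" using xL by (simp add: one_Gal)
    then have "x \<in> T" unfolding T_def using G.one_closed by (metis image_eqI)
    then have "poly P x = 0" using T(1) by (auto simp: P_def poly_prod)
    moreover have "\<sigma> (poly P x) = poly P (\<sigma> x)"
      unfolding poly_altdef using x ck F subfield_closed[OF F(1)] subfield_more(2)[OF F(1)]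
      by (subst emb_sum[OF F(1) \<sigma>]) (auto simp: emb_mult[OF F(1) \<sigma>] emb_power[OF F(1) \<sigma>] emb_fix[OF F(1) \<sigma>] subset_iff intro!: sum.cong)
    ultimately have "poly P (\<sigma> x) = 0" using emb_zero[OF F(1) \<sigma>] by simp
    then have "\<sigma> x \<in> T" using T(1) by (auto simp: P_def poly_prod)
    then show ?thesis using x by (auto simp: T_def R_def)
  qed
  moreover have "R \<subseteq> embeddings k F L" using embeddings_restrict[OF G_emb F(3,1,2)] by (auto simp: R_def)
  moreover have "finite R" using finite_G by (simp add: R_def)
  ultimately have "\<sigma> \<in> R" using embedding_among[OF F(1) \<sigma>] by blast
  then show thesis using that by (auto simp: R_def)
qed

text \<open>Surjectivity of an endomorphism of L over k comes from \<open>embedding_extends\<close>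
  with F = L. So the torus of L/k has its coordinates indexed by G.\<close>

lemma embeddings_L_L: "embeddings k L L = carrier G"
proof
  show "carrier G \<subseteq> embeddings k L L" by (auto simp: carrier_Gal)
  show "embeddings k L L \<subseteq> carrier G"
  proof
    fix \<sigma> assume \<sigma>: "\<sigma> \<in> embeddings k L L"
    then obtain g where g: "g \<in> carrier G" "\<sigma> = restrict g L" using embedding_extends[OF subfield_L kL subset_refl] by blast
    then have "\<sigma> = g" using emb_ext[OF subfield_L G_emb[OF g(1)]] by (simp add: extensional_restrict)
    then show "\<sigma> \<in> carrier G" using g by simp
  qed
qed

section \<open>The embeddings of K as a transitive G-set\<close>

definition e0 :: "'a \<Rightarrow> 'a" where "e0 = (\<lambda>x\<in>K. x)"

lemma e0_emb: "e0 \<in> embeddings k K L"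
  using subfield_closed[OF subfield_K] kK KL by (auto simp: e0_def embeddings_iff)

lemma compose_e0: "compose K g e0 = restrict g K"
  by (auto simp: compose_def e0_def)

lemma emb_trans: "\<sigma> \<in> embeddings k K L \<Longrightarrow> \<exists>g\<in>carrier G. \<sigma> = compose K g e0"
  using embedding_extends[OF subfield_K kK KL] by (metis compose_e0)

lemma emb_act_closed: "\<lbrakk>g \<in> carrier G; \<sigma> \<in> embeddings k K L\<rbrakk> \<Longrightarrow> compose K g \<sigma> \<in> embeddings k K L"
  using embeddings_compose[OF _ G_emb subfield_K kK] by blast

lemma emb_act_mult: 
  assumes "g \<in> carrier G" "h \<in> carrier G" "\<sigma> \<in> embeddings k K L" 
  shows "compose K (g \<otimes>\<^bsub>G\<^esub> h) \<sigma> = compose K g (compose K h \<sigma>)"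
  using assms emb_closed[OF subfield_K assms(3)] by (auto simp: compose_def G_mult_apply intro!: restrict_ext)

lemma emb_act_one: "\<sigma> \<in> embeddings k K L \<Longrightarrow> compose K \<one>\<^bsub>G\<^esub> \<sigma> = \<sigma>"
  using emb_closed[OF subfield_K] emb_ext[OF subfield_K]
  by (intro extensionalityI[of _ K]) (auto simp: compose_def one_Gal)

lemma finite_embeddings: "finite (embeddings k K L)"
proof -
  have "embeddings k K L \<subseteq> (\<lambda>g. compose K g e0) ` carrier G" using emb_trans by blast
  then show ?thesis using finite_G finite_surj by blast
qed

lemma Gal_L_K: "carrier (Gal L K) = {h \<in> carrier G. compose K h e0 = e0}"
proof -
  have "compose K h e0 = e0 \<longleftrightarrow> (\<forall>x\<in>K. h x = x)" for h
    by (auto simp: e0_def compose_def restrict_def fun_eq_iff)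
  then show ?thesis using kK by (auto simp: carrier_Gal embeddings_iff)
qed

lemma Gal_L_K_eq: "Gal L K = G\<lparr>carrier := carrier (Gal L K)\<rparr>"
  by (simp add: Gal_def)

end

section \<open>Characters of norm one tori\<close>

text \<open>Dedekind's induction on the number of terms: subtract \<open>\<psi>1 z\<close> times the
  relation at y from the relation at the product of y and z. The term of \<open>\<psi>1\<close>
  cancels, and the coefficient of \<open>\<chi>\<close> is multiplied by
  \<open>\<chi> z - \<psi>1 z\<close>, nonzero for a suitable z. The list may contain the same
  function several times, as only \<open>\<chi>\<close> has to differ from its entries.\<close>

lemma dedekind_independence:
  fixes \<chi> :: "'b \<Rightarrow> 'a::field" and xs :: "('a \<times> ('b \<Rightarrow> 'a)) list"
  assumes closed: "\<And>y z. y \<in> T \<Longrightarrow> z \<in> T \<Longrightarrow> mul y z \<in> T"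
    and \<chi>: "\<And>y z. y \<in> T \<Longrightarrow> z \<in> T \<Longrightarrow> \<chi> (mul y z) = \<chi> y * \<chi> z" and nz: "y0 \<in> T" "\<chi> y0 \<noteq> 0"
    and \<psi>: "\<And>c \<psi> y z. (c, \<psi>) \<in> set xs \<Longrightarrow> y \<in> T \<Longrightarrow> z \<in> T \<Longrightarrow> \<psi> (mul y z) = \<psi> y * \<psi> z"
    and distinct: "\<And>c \<psi>. (c, \<psi>) \<in> set xs \<Longrightarrow> \<exists>z\<in>T. \<chi> z \<noteq> \<psi> z"
    and eq: "\<And>y. y \<in> T \<Longrightarrow> a * \<chi> y = (\<Sum>(c, \<psi>)\<leftarrow>xs. c * \<psi> y)"
  shows "a = 0"
  using \<psi> distinct eq
proof (induction "length xs" arbitrary: xs a)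
  case 0
  then show ?case using nz by fastforce
next
  case (Suc n)
  obtain c1 \<psi>1 xs' where p: "xs = (c1, \<psi>1) # xs'" and n: "n = length xs'"
    using Suc.hyps(2) by (cases xs) auto
  obtain z where z: "z \<in> T" "\<chi> z \<noteq> \<psi>1 z" using Suc.prems(2)[of c1 \<psi>1] by (auto simp: p)
  define ys where "ys = map (\<lambda>(c, \<psi>). (c * (\<psi> z - \<psi>1 z), \<psi>)) xs'"
  have ysD: "\<exists>c. (c, \<psi>) \<in> set xs'" if "(d, \<psi>) \<in> set ys" for d \<psi> using that by (auto simp: ys_def)
  have mulp: "\<psi> (mul y z) = \<psi> y * \<psi> z" if "(c, \<psi>) \<in> set xs" "y \<in> T" for c \<psi> y
    using Suc.prems(1) that z by blast
  have "a * (\<chi> z - \<psi>1 z) = 0"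
  proof (rule Suc.hyps(1))
    show "n = length ys" by (simp add: ys_def n)
    show "\<psi> (mul y z) = \<psi> y * \<psi> z" if "(d, \<psi>) \<in> set ys" "y \<in> T" "z \<in> T" for d \<psi> y z
      using ysD[OF that(1)] Suc.prems(1) that by (metis p list.set_intros(2))
    show "\<exists>z\<in>T. \<chi> z \<noteq> \<psi> z" if "(d, \<psi>) \<in> set ys" for d \<psi>
      using ysD[OF that] Suc.prems(2) by (metis p list.set_intros(2))
    fix y assume y: "y \<in> T"
    have tail: "(\<Sum>(c, \<psi>)\<leftarrow>xs'. c * \<psi> (mul y z)) - \<psi>1 z * (\<Sum>(c, \<psi>)\<leftarrow>xs'. c * \<psi> y) = (\<Sum>(c, \<psi>)\<leftarrow>ys. c * \<psi> y)"
    proof -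
      have "(\<Sum>(c, \<psi>)\<leftarrow>zs. c * \<psi> (mul y z)) - \<psi>1 z * (\<Sum>(c, \<psi>)\<leftarrow>zs. c * \<psi> y) 
        = (\<Sum>(c, \<psi>)\<leftarrow>map (\<lambda>(c, \<psi>). (c * (\<psi> z - \<psi>1 z), \<psi>)) zs. c * \<psi> y)" if "set zs \<subseteq> set xs'" for zs
        using that
      proof (induction zs)
        case (Cons q zs)
        obtain c \<psi> where q: "q = (c, \<psi>)" by force
        have "\<psi> (mul y z) = \<psi> y * \<psi> z" using mulp[of c \<psi> y] Cons.prems y by (auto simp: q p)
        then show ?case using Cons by (simp add: q algebra_simps)
      qed simp
      then show ?thesis by (simp add: ys_def)
    qed
    have 1: "a * (\<chi> y * \<chi> z) = c1 * (\<psi>1 y * \<psi>1 z) + (\<Sum>(c, \<psi>)\<leftarrow>xs'. c * \<psi> (mul y z))"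
      using Suc.prems(3)[OF closed[OF y z(1)]] \<chi>[OF y z(1)] mulp[of c1 \<psi>1 y] y by (simp add: p)
    have 2: "a * \<chi> y = c1 * \<psi>1 y + (\<Sum>(c, \<psi>)\<leftarrow>xs'. c * \<psi> y)"
      using Suc.prems(3)[OF y] by (simp add: p)
    have "a * (\<chi> z - \<psi>1 z) * \<chi> y = a * (\<chi> y * \<chi> z) - \<psi>1 z * (a * \<chi> y)" by (simp add: algebra_simps)
    also have "\<dots> = (\<Sum>(c, \<psi>)\<leftarrow>ys. c * \<psi> y)"
      unfolding 1 2 tail[symmetric] by (simp add: algebra_simps)
    finally show "a * (\<chi> z - \<psi>1 z) * \<chi> y = (\<Sum>(c, \<psi>)\<leftarrow>ys. c * \<psi> y)" .
  qed
  then show ?case using z by simp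
qed

lemma prod_powi: "(\<Prod>j\<in>J. f j) powi i = (\<Prod>j\<in>J. (f j :: 'a::field) powi i)"
  by (induction J rule: infinite_finite_induct) (auto simp: power_int_mult_distrib)

lemma two_powi_eq_1:
  assumes "(2 :: 'a::field_char_0) powi i = 1" shows "i = 0"
proof -
  have aux: "n = 0" if "(2 :: 'a) ^ n = 1" for n
  proof -
    have "of_nat (2 ^ n) = (of_nat 1 :: 'a)" using that by simp
    then have "(2::nat) ^ n = 1" by (simp only: of_nat_eq_iff)
    then show ?thesis by simp
  qed
  show ?thesis
  proof (cases i)
    case (nonneg n)
    then show ?thesis using assms aux by simp
  next
    case (neg n)
    then have "inverse ((2 :: 'a) ^ Suc n) = 1"
      using assms by (simp only: power_int_minus power_int_of_nat)
    then have "(2 :: 'a) ^ Suc n = 1" by (metis inverse_1 inverse_inverse_eq)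
    then show ?thesis using aux by blast
  qed
qed

section \<open>Points and monomials of the norm one torus\<close>

context galois_tower begin

abbreviation "E \<equiv> embeddings k K L"
abbreviation "T \<equiv> norm_one_torus k K L"
abbreviation "M \<equiv> torus_characters k K L"
abbreviation "mono_char \<equiv> monomial_character k K L"

lemma carrier_mult_group: "carrier (mult_group L) = L - {0}"
  using subfield.subfield_Units[OF subfield_L] by (simp add: units_of_carrier)

lemma mult_mult_group: "x \<otimes>\<^bsub>mult_group L\<^esub> y = x * y" and one_mult_group: "\<one>\<^bsub>mult_group L\<^esub> = 1"
  by (simp_all add: units_of_mult units_of_one)

lemma T_iff: "y \<in> carrier T \<longleftrightarrow> y \<in> extensional E \<and> (\<forall>\<sigma>\<in>E. y \<sigma> \<in> L \<and> y \<sigma> \<noteq> 0) \<and> (\<Prod>\<sigma>\<in>E. y \<sigma>) = 1"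
  by (auto simp: norm_one_torus_def kernel_def res_Gm_def carrier_mult_group one_mult_group PiE_iff)

lemma T_mult: "y \<otimes>\<^bsub>T\<^esub> z = (\<lambda>\<sigma>\<in>E. y \<sigma> * z \<sigma>)"
  by (simp add: norm_one_torus_def res_Gm_def mult_mult_group)

lemma T_closed: "y \<in> carrier T \<Longrightarrow> z \<in> carrier T \<Longrightarrow> y \<otimes>\<^bsub>T\<^esub> z \<in> carrier T"
  using subfield_closed(4)[OF subfield_L] by (auto simp: T_iff T_mult prod.distrib)

text \<open>\<open>monomial_character\<close> before its restriction to the torus, since the
  elements of \<open>regular_functions\<close> are functions of all points.\<close>

definition monomial :: "(('a \<Rightarrow> 'a) \<Rightarrow> int) \<Rightarrow> (('a \<Rightarrow> 'a) \<Rightarrow> 'a) \<Rightarrow> 'a" where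
  "monomial m y = (\<Prod>\<sigma>\<in>E. y \<sigma> powi m \<sigma>)"

lemma mono_eq: "mono_char m = restrict (monomial m) (carrier T)"
  by (auto simp: monomial_character_def monomial_def restrict_def fun_eq_iff)

lemma monomial_in_L: "y \<in> carrier T \<Longrightarrow> monomial m y \<in> L - {0}"
proof -
  assume y: "y \<in> carrier T"
  have "monomial m y \<in> L" unfolding monomial_def
    by (rule subfield_more(7)[OF subfield_L], rule subfield_more(5)[OF subfield_L]) (use y in \<open>simp add: T_iff\<close>)
  then show ?thesis using y finite_embeddings by (auto simp: monomial_def T_iff)
qed

lemma monomial_mult: 
  assumes "y \<in> carrier T" "z \<in> carrier T" shows "monomial m (y \<otimes>\<^bsub>T\<^esub> z) = monomial m y * monomial m z"
  by (simp add: monomial_def T_mult power_int_mult_distrib prod.distrib)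

lemma monomial_add: "y \<in> carrier T \<Longrightarrow> monomial (\<lambda>\<sigma>. m \<sigma> + m' \<sigma>) y = monomial m y * monomial m' y"
  by (auto simp: monomial_def power_int_add T_iff simp flip: prod.distrib intro!: prod.cong)

lemma regular_prod:
  assumes "\<And>j. j \<in> J \<Longrightarrow> f j \<in> regular_functions k K L"
  shows "(\<lambda>y. \<Prod>j\<in>J. f j y) \<in> regular_functions k K L"
  using assms
proof (induction J rule: infinite_finite_induct)
  case (insert j J)
  then show ?case using regular_functions.mult[of "f j" k K L "\<lambda>y. \<Prod>j\<in>J. f j y"] by simp
qed (use regular_functions.const[of 1 L] subfield_closed(2)[OF subfield_L] in auto)

lemma regular_monomial: "monomial m \<in> regular_functions k K L"
proof -
  \<comment> \<open>An integer power has to be spelled out as a product of coordinates or of inverse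
    coordinates, from which \<open>regular_functions\<close> is generated.\<close>
  have "(\<lambda>y. \<Prod>\<sigma>\<in>E. if m \<sigma> \<ge> 0 then (\<Prod>i<nat (m \<sigma>). y \<sigma>) else (\<Prod>i<nat (- m \<sigma>). inverse (y \<sigma>))) \<in> regular_functions k K L"
  proof (rule regular_prod)
    fix \<sigma> assume \<sigma>: "\<sigma> \<in> E"
    show "(\<lambda>y. if m \<sigma> \<ge> 0 then (\<Prod>i<nat (m \<sigma>). y \<sigma>) else (\<Prod>i<nat (- m \<sigma>). inverse (y \<sigma>))) \<in> regular_functions k K L"
      by (cases "m \<sigma> \<ge> 0") (simp_all only: if_True if_False, auto intro!: regular_prod regular_functions.intros \<sigma> simp del: prod_constant)
  qed
  moreover have "monomial m = (\<lambda>y. \<Prod>\<sigma>\<in>E. if m \<sigma> \<ge> 0 then (\<Prod>i<nat (m \<sigma>). y \<sigma>) else (\<Prod>i<nat (- m \<sigma>). inverse (y \<sigma>)))"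
    by (auto simp: monomial_def power_int_def fun_eq_iff intro!: prod.cong)
  ultimately show ?thesis by simp
qed

lemma M_iff: "\<chi> \<in> carrier M \<longleftrightarrow> \<chi> \<in> extensional (carrier T) \<and> (\<forall>y\<in>carrier T. \<chi> y \<in> L - {0}) \<and>
    (\<forall>y\<in>carrier T. \<forall>z\<in>carrier T. \<chi> (y \<otimes>\<^bsub>T\<^esub> z) = \<chi> y * \<chi> z) \<and> (\<exists>f\<in>regular_functions k K L. \<forall>y\<in>carrier T. \<chi> y = f y)"
  by (auto simp: torus_characters_def hom_def carrier_mult_group mult_mult_group Pi_iff)

lemma M_mult: "\<chi> \<otimes>\<^bsub>M\<^esub> \<psi> = (\<lambda>y\<in>carrier T. \<chi> y * \<psi> y)"
  by (simp add: torus_characters_def mult_mult_group)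

lemma M_one: "\<one>\<^bsub>M\<^esub> = (\<lambda>y\<in>carrier T. 1)"
  by (simp add: torus_characters_def one_mult_group)

lemma mono_closed: "mono_char m \<in> carrier M"
  unfolding M_iff mono_eq using monomial_in_L monomial_mult T_closed regular_monomial by auto

text \<open>Linear combinations of monomials on the points of the torus. The coefficients range over
  the ambient field, over which independence of characters is applied.\<close>

definition laurent :: "((('a \<Rightarrow> 'a) \<Rightarrow> 'a) \<Rightarrow> 'a) \<Rightarrow> bool" where
  "laurent f \<longleftrightarrow> (\<exists>xs. \<forall>y\<in>carrier T. f y = (\<Sum>(c, m)\<leftarrow>xs. c * monomial m y))"

lemma laurent_monomial: "laurent (\<lambda>y. c * monomial m y)"
  unfolding laurent_def by (intro exI[of _ "[(c, m)]"]) simp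

lemma laurent_add: 
  assumes "laurent f" "laurent g" shows "laurent (\<lambda>y. f y + g y)"
proof -
  obtain xs ys where "\<forall>y\<in>carrier T. f y = (\<Sum>(c, m)\<leftarrow>xs. c * monomial m y)"
    "\<forall>y\<in>carrier T. g y = (\<Sum>(c, m)\<leftarrow>ys. c * monomial m y)" using assms unfolding laurent_def by blast
  then show ?thesis unfolding laurent_def by (intro exI[of _ "xs @ ys"]) simp
qed

lemma laurent_cong: "laurent f \<Longrightarrow> (\<And>y. y \<in> carrier T \<Longrightarrow> f y = g y) \<Longrightarrow> laurent g"
  unfolding laurent_def by simp

lemma laurent_monomial_mult:
  assumes "laurent g" shows "laurent (\<lambda>y. c * monomial m y * g y)"
proof -
  obtain ys where ys: "\<forall>y\<in>carrier T. g y = (\<Sum>(c, m)\<leftarrow>ys. c * monomial m y)" using assms unfolding laurent_def by blast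
  have eq: "c * monomial m y * (\<Sum>(c, m)\<leftarrow>ys. c * monomial m y) = 
     (\<Sum>(c, m)\<leftarrow>map (\<lambda>(c', m'). (c * c', \<lambda>\<sigma>. m \<sigma> + m' \<sigma>)) ys. c * monomial m y)" if "y \<in> carrier T" for y
    by (induction ys) (auto simp: algebra_simps monomial_add[OF that])
  show ?thesis unfolding laurent_def
  proof (intro exI ballI)
    fix y assume y: "y \<in> carrier T"
    show "c * monomial m y * g y = (\<Sum>(c, m)\<leftarrow>map (\<lambda>(c', m'). (c * c', \<lambda>\<sigma>. m \<sigma> + m' \<sigma>)) ys. c * monomial m y)"
      unfolding eq[OF y, symmetric] using ys y by metis
  qed
qed

lemma laurent_mult:
  assumes f: "laurent f" and g: "laurent g" shows "laurent (\<lambda>y. f y * g y)"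
proof -
  have l: "laurent (\<lambda>y. (\<Sum>(c, m)\<leftarrow>xs. c * monomial m y) * g y)" for xs
  proof (induction xs)
    case Nil then show ?case unfolding laurent_def by (intro exI[of _ "[]"]) simp
  next
    case (Cons p xs)
    obtain c m where "p = (c, m)" by force
    then show ?case using laurent_add[OF laurent_monomial_mult[OF g] Cons] by (simp add: algebra_simps)
  qed
  obtain xs where xs: "\<forall>y\<in>carrier T. f y = (\<Sum>(c, m)\<leftarrow>xs. c * monomial m y)" using f unfolding laurent_def by blast
  show ?thesis by (rule laurent_cong[OF l[of xs]]) (use xs in simp)
qed

lemma monomial_single: "\<sigma> \<in> E \<Longrightarrow> monomial (\<lambda>\<rho>. if \<rho> = \<sigma> then i else 0) y = y \<sigma> powi i"
proof -
  assume \<sigma>: "\<sigma> \<in> E"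
  have "monomial (\<lambda>\<rho>. if \<rho> = \<sigma> then i else 0) y = (\<Prod>\<rho>\<in>E. if \<rho> = \<sigma> then y \<sigma> powi i else 1)"
    unfolding monomial_def by (rule prod.cong) auto
  then show ?thesis using \<sigma> finite_embeddings by simp
qed

lemma regular_laurent: "f \<in> regular_functions k K L \<Longrightarrow> laurent f"
proof (induction rule: regular_functions.induct)
  case (const c)
  show ?case by (rule laurent_cong[OF laurent_monomial[of c "\<lambda>_. 0"]]) (simp add: monomial_def)
next
  case (coord \<sigma>)
  show ?case by (rule laurent_cong[OF laurent_monomial[of 1 "\<lambda>\<rho>. if \<rho> = \<sigma> then 1 else 0"]])
    (simp add: monomial_single[OF coord])
next
  case (inv_coord \<sigma>)
  show ?case by (rule laurent_cong[OF laurent_monomial[of 1 "\<lambda>\<rho>. if \<rho> = \<sigma> then -1 else 0"]])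
    (simp add: monomial_single[OF inv_coord] power_int_minus)
qed (auto intro: laurent_add laurent_mult)

lemma T_one: "(\<lambda>\<sigma>\<in>E. 1) \<in> carrier T"
  using subfield_closed(2)[OF subfield_L] by (simp add: T_iff)

text \<open>A character is a linear combination of monomials, which are themselves multiplicative on
  points. Were it different from all monomials, independence would make its own coefficient 1
  vanish.\<close>

lemma mono_surj:
  assumes \<chi>: "\<chi> \<in> carrier M" obtains m where "\<chi> = mono_char m"
proof -
  note c = \<chi>[unfolded M_iff]
  note \<chi>T = conjunct1[OF c] conjunct1[OF conjunct2[OF c]] conjunct1[OF conjunct2[OF conjunct2[OF c]]]
    conjunct2[OF conjunct2[OF conjunct2[OF c]]]
  obtain f where f: "f \<in> regular_functions k K L" "\<forall>y\<in>carrier T. \<chi> y = f y" using \<chi>T(4) by (elim bexE)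
  obtain xs where xs: "\<forall>y\<in>carrier T. f y = (\<Sum>(c, m)\<leftarrow>xs. c * monomial m y)"
    using regular_laurent[OF f(1)] unfolding laurent_def by (elim exE)
  have "\<exists>m. \<forall>y\<in>carrier T. \<chi> y = monomial m y"
  proof (rule ccontr)
    assume no: "\<not> (\<exists>m. \<forall>y\<in>carrier T. \<chi> y = monomial m y)"
    have "(1 :: 'a) = 0"
    proof (rule dedekind_independence[where T = "carrier T" and mul = "\<lambda>y z. y \<otimes>\<^bsub>T\<^esub> z" and \<chi> = \<chi> and xs = "map (\<lambda>(c, m). (c, monomial m)) xs", OF T_closed _ T_one])
      show "\<chi> (\<lambda>\<sigma>\<in>E. 1) \<noteq> 0" using \<chi>T(2) T_one by (metis DiffD2 singletonI)
      show "\<chi> (y \<otimes>\<^bsub>T\<^esub> z) = \<chi> y * \<chi> z" if "y \<in> carrier T" "z \<in> carrier T" for y z using \<chi>T(3) that by blast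
      show "\<psi> (y \<otimes>\<^bsub>T\<^esub> z) = \<psi> y * \<psi> z" if "(c, \<psi>) \<in> set (map (\<lambda>(c, m). (c, monomial m)) xs)" "y \<in> carrier T" "z \<in> carrier T" for c \<psi> y z
        using that monomial_mult by auto
      show "\<exists>z\<in>carrier T. \<chi> z \<noteq> \<psi> z" if "(c, \<psi>) \<in> set (map (\<lambda>(c, m). (c, monomial m)) xs)" for c \<psi>
        using that no by auto
      show "1 * \<chi> y = (\<Sum>(c, \<psi>)\<leftarrow>map (\<lambda>(c, m). (c, monomial m)) xs. c * \<psi> y)" if "y \<in> carrier T" for y
        using bspec[OF xs that] bspec[OF f(2) that] by (simp add: comp_def case_prod_unfold)
    qed
    then show False by simp
  qed
  then obtain m where "\<forall>y\<in>carrier T. \<chi> y = monomial m y" by blast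
  then have "\<chi> = mono_char m" using \<chi>T(1) unfolding mono_eq by (intro extensionalityI[of _ "carrier T"]) auto
  then show thesis by (rule that)
qed

lemma mono_add: "mono_char (\<lambda>\<sigma>. m \<sigma> + m' \<sigma>) = mono_char m \<otimes>\<^bsub>M\<^esub> mono_char m'"
  by (auto simp: mono_eq M_mult monomial_add intro!: restrict_ext)

lemma mono_cong: "(\<And>\<sigma>. \<sigma> \<in> E \<Longrightarrow> m \<sigma> = m' \<sigma>) \<Longrightarrow> mono_char m = mono_char m'"
  by (auto simp: mono_eq monomial_def intro!: restrict_ext prod.cong)

lemma mono_const: "mono_char (\<lambda>_. z) = \<one>\<^bsub>M\<^esub>"
  by (auto simp: mono_eq monomial_def M_one T_iff simp flip: prod_powi intro!: restrict_ext)

text \<open>Constant exponents give a power of the norm, which is 1 on the torus. That nothing else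
  is trivial identifies the character module with the integer functions on E modulo
  constants.\<close>

lemma mono_one_iff: "mono_char m = \<one>\<^bsub>M\<^esub> \<longleftrightarrow> (\<exists>z. \<forall>\<sigma>\<in>E. m \<sigma> = z)"
proof
  assume "\<exists>z. \<forall>\<sigma>\<in>E. m \<sigma> = z"
  then obtain z where "\<forall>\<sigma>\<in>E. m \<sigma> = z" by blast
  then have "mono_char m = mono_char (\<lambda>_. z)" by (intro mono_cong) auto
  then show "mono_char m = \<one>\<^bsub>M\<^esub>" by (simp add: mono_const)
next
  assume one: "mono_char m = \<one>\<^bsub>M\<^esub>"
  have "m \<sigma> = m \<tau>" if st: "\<sigma> \<in> E" "\<tau> \<in> E" "\<sigma> \<noteq> \<tau>" for \<sigma> \<tau>
  proof -
    \<comment> \<open>A point of norm one on which the monomial takes the value 2^(m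
      \<open>\<sigma>\<close> - m \<open>\<tau>\<close>); in characteristic zero 2 has infinite
      order.\<close>
    define y where "y = (\<lambda>\<rho>\<in>E. if \<rho> = \<sigma> then 2 else if \<rho> = \<tau> then inverse 2 else (1::'a))"
    have two: "(2::'a) \<in> L" using subfield_more(3)[OF subfield_L, of 2] by simp
    have pr: "(\<Prod>\<rho>\<in>E. if \<rho> = \<sigma> then a else if \<rho> = \<tau> then b else 1) = a * b" for a b :: 'a
    proof -
      have "(\<Prod>\<rho>\<in>E. if \<rho> = \<sigma> then a else if \<rho> = \<tau> then b else 1) 
          = (\<Prod>\<rho>\<in>E. (if \<rho> = \<sigma> then a else 1) * (if \<rho> = \<tau> then b else 1))"
        using st(3) by (intro prod.cong) auto
      then show ?thesis using st finite_embeddings by (simp add: prod.distrib)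
    qed
    have "(\<Prod>\<rho>\<in>E. y \<rho>) = 1" using pr[of 2 "inverse 2"] by (simp add: y_def cong: prod.cong)
    moreover have "(1::'a) / 2 \<in> L" using subfield_closed(6)[OF subfield_L two] by (simp add: inverse_eq_divide)
    ultimately have yT: "y \<in> carrier T"
      using two subfield_closed[OF subfield_L] by (auto simp: T_iff y_def)
    have "monomial m y = (\<Prod>\<rho>\<in>E. if \<rho> = \<sigma> then 2 powi m \<sigma> else if \<rho> = \<tau> then inverse 2 powi m \<tau> else 1)"
      unfolding monomial_def by (intro prod.cong) (auto simp: y_def)
    also have "\<dots> = 2 powi m \<sigma> / 2 powi m \<tau>"
      by (simp only: pr power_int_inverse divide_inverse)
    also have "\<dots> = 2 powi (m \<sigma> - m \<tau>)" by (rule power_int_diff[symmetric]) simp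
    also have "monomial m y = 1" using fun_cong[OF one, of y] yT by (simp add: mono_eq M_one)
    finally show ?thesis using two_powi_eq_1[of "m \<sigma> - m \<tau>"] by simp
  qed
  then have "\<forall>\<sigma>\<in>E. m \<sigma> = m e0" using e0_emb by blast
  then show "\<exists>z. \<forall>\<sigma>\<in>E. m \<sigma> = z" by blast
qed

lemma emb_act_inv:
  assumes "g \<in> carrier G" "\<sigma> \<in> E"
  shows "compose K (inv\<^bsub>G\<^esub> g) (compose K g \<sigma>) = \<sigma>" "compose K g (compose K (inv\<^bsub>G\<^esub> g) \<sigma>) = \<sigma>"
  using emb_act_mult[of "inv\<^bsub>G\<^esub> g" g \<sigma>] emb_act_mult[of g "inv\<^bsub>G\<^esub> g" \<sigma>] assms by (simp_all add: emb_act_one)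

lemma prod_emb_act:
  assumes "g \<in> carrier G" shows "(\<Prod>\<sigma>\<in>E. f (compose K g \<sigma>)) = (\<Prod>\<sigma>\<in>E. f \<sigma>)"
  by (rule prod.reindex_bij_witness[of _ "compose K (inv\<^bsub>G\<^esub> g)" "compose K g"])
     (use assms emb_act_inv emb_act_closed in auto)

text \<open>The descent datum applies g^-1 to the coordinates and permutes them. The outer g cancels
  the former, so only the permutation of the exponents remains.\<close>

lemma mono_act:
  assumes g: "g \<in> carrier G"
  shows "character_act k K L g (mono_char m) = mono_char (\<lambda>\<sigma>. m (compose K (inv\<^bsub>G\<^esub> g) \<sigma>))"
proof -
  have gi: "inv\<^bsub>G\<^esub> g \<in> carrier G" using g by simp
  have "g (mono_char m (galois_point k K L (inv\<^bsub>G\<^esub> g) y)) = monomial (\<lambda>\<sigma>. m (compose K (inv\<^bsub>G\<^esub> g) \<sigma>)) y" if y: "y \<in> carrier T" for y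
  proof -
    have yL: "y \<sigma> \<in> L" "y \<sigma> \<noteq> 0" if "\<sigma> \<in> E" for \<sigma> using y that by (auto simp: T_iff)
    have pt: "galois_point k K L (inv\<^bsub>G\<^esub> g) y = (\<lambda>\<sigma>\<in>E. (inv\<^bsub>G\<^esub> g) (y (compose K g \<sigma>)))"
      using g by (simp add: galois_point_def)
    have mem: "(inv\<^bsub>G\<^esub> g) (y (compose K g \<sigma>)) \<in> L" "(inv\<^bsub>G\<^esub> g) (y (compose K g \<sigma>)) \<noteq> 0" if "\<sigma> \<in> E" for \<sigma>
      using yL[OF emb_act_closed[OF g that]] G_closed[OF gi] emb_nonzero[OF subfield_L G_emb[OF gi]] by auto
    have "(\<Prod>\<sigma>\<in>E. (inv\<^bsub>G\<^esub> g) (y (compose K g \<sigma>))) = (inv\<^bsub>G\<^esub> g) (\<Prod>\<sigma>\<in>E. y (compose K g \<sigma>))"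
      using yL emb_act_closed[OF g] by (intro emb_prod[OF subfield_L G_emb[OF gi], symmetric]) auto
    also have "\<dots> = 1" using prod_emb_act[OF g, of y] y emb_one[OF subfield_L G_emb[OF gi]] by (simp add: T_iff)
    finally have ptT: "galois_point k K L (inv\<^bsub>G\<^esub> g) y \<in> carrier T"
      unfolding pt T_iff using mem by simp
    have "mono_char m (galois_point k K L (inv\<^bsub>G\<^esub> g) y) = (\<Prod>\<sigma>\<in>E. (inv\<^bsub>G\<^esub> g) (y (compose K g \<sigma>)) powi m \<sigma>)"
      using ptT by (simp add: mono_eq monomial_def) (simp add: pt)
    also have "g \<dots> = (\<Prod>\<sigma>\<in>E. g ((inv\<^bsub>G\<^esub> g) (y (compose K g \<sigma>)) powi m \<sigma>))"
      using mem(1) subfield_more(5)[OF subfield_L] by (intro emb_prod[OF subfield_L G_emb[OF g]]) auto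
    also have "\<dots> = (\<Prod>\<sigma>\<in>E. y (compose K g \<sigma>) powi m \<sigma>)"
      by (rule prod.cong) (use mem(1) emb_powi[OF subfield_L G_emb[OF g]] G_inv_apply[OF g] yL emb_act_closed[OF g] in auto)
    \<comment> \<open>Written as a function of \<open>compose K g \<sigma>\<close> alone, the factor
      can be reindexed by \<open>prod_emb_act\<close>.\<close>
    also have "\<dots> = (\<Prod>\<sigma>\<in>E. y (compose K g \<sigma>) powi m (compose K (inv\<^bsub>G\<^esub> g) (compose K g \<sigma>)))"
      by (rule prod.cong) (use emb_act_inv[OF g] in auto)
    also have "\<dots> = monomial (\<lambda>\<sigma>. m (compose K (inv\<^bsub>G\<^esub> g) \<sigma>)) y"
      unfolding monomial_def by (rule prod_emb_act[OF g, of "\<lambda>\<sigma>. y \<sigma> powi m (compose K (inv\<^bsub>G\<^esub> g) \<sigma>)"])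
    finally show ?thesis .
  qed
  then show ?thesis unfolding character_act_def by (simp add: mono_eq cong: restrict_cong)
qed

section \<open>The character modules as permutation modules modulo constants\<close>

lemma comm_group_M: "comm_group M"
proof (rule comm_groupI)
  fix \<chi> \<psi> assume "\<chi> \<in> carrier M" "\<psi> \<in> carrier M"
  then obtain m m' where m: "\<chi> = mono_char m" "\<psi> = mono_char m'" using mono_surj by metis
  show "\<chi> \<otimes>\<^bsub>M\<^esub> \<psi> \<in> carrier M" unfolding m mono_add[symmetric] by (rule mono_closed)
  show "\<chi> \<otimes>\<^bsub>M\<^esub> \<psi> = \<psi> \<otimes>\<^bsub>M\<^esub> \<chi>" by (simp add: M_mult mult.commute)
next
  show "\<one>\<^bsub>M\<^esub> \<in> carrier M" unfolding mono_const[of 0, symmetric] by (rule mono_closed)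
  show "\<chi> \<otimes>\<^bsub>M\<^esub> \<psi> \<otimes>\<^bsub>M\<^esub> \<rho> = \<chi> \<otimes>\<^bsub>M\<^esub> (\<psi> \<otimes>\<^bsub>M\<^esub> \<rho>)" for \<chi> \<psi> \<rho>
    by (auto simp: M_mult mult.assoc intro!: restrict_ext)
next
  fix \<chi> assume "\<chi> \<in> carrier M"
  then obtain m where m: "\<chi> = mono_char m" using mono_surj by metis
  show "\<one>\<^bsub>M\<^esub> \<otimes>\<^bsub>M\<^esub> \<chi> = \<chi>" unfolding mono_const[of 0, symmetric] m mono_add[symmetric] by simp
  show "\<exists>y\<in>carrier M. y \<otimes>\<^bsub>M\<^esub> \<chi> = \<one>\<^bsub>M\<^esub>"
    by (rule bexI[OF _ mono_closed[of "\<lambda>\<sigma>. - m \<sigma>"]]) (simp add: m mono_const flip: mono_add)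
qed

lemma perm_quotient: "permutation_quotient G M (character_act k K L) E (compose K) mono_char"
proof -
  interpret M: comm_group M by (rule comm_group_M)
  show ?thesis
  proof unfold_locales
    fix g assume g: "g \<in> carrier G"
    show "character_act k K L g \<in> hom M M"
    proof (rule homI)
      fix \<chi> \<psi> assume "\<chi> \<in> carrier M" "\<psi> \<in> carrier M"
      then obtain m m' where m: "\<chi> = mono_char m" "\<psi> = mono_char m'" using mono_surj by metis
      show "character_act k K L g \<chi> \<in> carrier M" by (simp add: m mono_act[OF g] mono_closed)
      show "character_act k K L g (\<chi> \<otimes>\<^bsub>M\<^esub> \<psi>) = character_act k K L g \<chi> \<otimes>\<^bsub>M\<^esub> character_act k K L g \<psi>"
        unfolding m mono_add[symmetric] mono_act[OF g] ..
    qed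
    fix h assume h: "h \<in> carrier G"
    fix \<chi> assume "\<chi> \<in> carrier M"
    then obtain m where m: "\<chi> = mono_char m" using mono_surj by metis
    show "character_act k K L (g \<otimes>\<^bsub>G\<^esub> h) \<chi> = character_act k K L g (character_act k K L h \<chi>)"
      unfolding m mono_act[OF g] mono_act[OF h] mono_act[OF G.m_closed[OF g h]]
      by (rule mono_cong) (use g h in \<open>simp add: G.inv_mult_group emb_act_mult\<close>)
  next
    show "E \<noteq> {}" using e0_emb by blast
  qed (use finite_G emb_act_closed emb_act_mult emb_act_one mono_closed mono_add mono_one_iff mono_act in \<open>auto elim: mono_surj\<close>)
qed

text \<open>The torus of L/k is the case K = L, so all that holds for the characters of the torus of
  K/k is available for it.\<close>

lemma galois_tower_top: "galois_tower k L L"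
  using k_nf L_nf kL gal by unfold_locales auto

interpretation top: galois_tower k L L by (rule galois_tower_top)

lemma norm_points_closed:
  assumes y: "y \<in> carrier top.T" shows "norm_points k K L y \<in> carrier T"
proof -
  have yL: "y \<tau> \<in> L" "y \<tau> \<noteq> 0" if "\<tau> \<in> embeddings k L L" for \<tau> using y that by (auto simp: top.T_iff)
  have "(\<Prod>\<sigma>\<in>E. \<Prod>\<tau> | \<tau> \<in> embeddings k L L \<and> restrict \<tau> K = \<sigma>. y \<tau>) = (\<Prod>\<tau>\<in>embeddings k L L. y \<tau>)"
    by (rule prod.group[OF top.finite_embeddings finite_embeddings])
       (use embeddings_restrict[OF _ KL subfield_K kK] in auto)
  moreover have "(\<Prod>\<tau> | \<tau> \<in> embeddings k L L \<and> restrict \<tau> K = \<sigma>. y \<tau>) \<in> L - {0}" for \<sigma>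
  proof
    show "(\<Prod>\<tau> | \<tau> \<in> embeddings k L L \<and> restrict \<tau> K = \<sigma>. y \<tau>) \<in> L"
      by (rule subfield_more(7)[OF subfield_L]) (use yL in auto)
  qed (use yL top.finite_embeddings in auto)
  ultimately show ?thesis using y by (auto simp: T_iff top.T_iff norm_points_def)
qed

text \<open>The norm multiplies up the fibres of restriction to K, so the coordinate at
  \<open>\<tau>\<close> receives the exponent belonging to the restriction of \<open>\<tau>\<close>.
  This is the assumption \<open>phi_mono\<close> of \<open>norm_tower\<close>.\<close>

lemma norm_mono: "norm_on_characters k K L (mono_char m) = top.mono_char (\<lambda>\<tau>. m (compose K \<tau> e0))"
proof -
  have "mono_char m (norm_points k K L y) = top.monomial (\<lambda>\<tau>. m (compose K \<tau> e0)) y" if y: "y \<in> carrier top.T" for y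
  proof -
    have "mono_char m (norm_points k K L y) = (\<Prod>\<sigma>\<in>E. (\<Prod>\<tau> | \<tau> \<in> embeddings k L L \<and> restrict \<tau> K = \<sigma>. y \<tau>) powi m \<sigma>)"
      using norm_points_closed[OF y] by (simp add: mono_eq monomial_def) (simp add: norm_points_def)
    also have "\<dots> = (\<Prod>\<sigma>\<in>E. \<Prod>\<tau> | \<tau> \<in> embeddings k L L \<and> restrict \<tau> K = \<sigma>. y \<tau> powi m (restrict \<tau> K))"
      by (auto simp: prod_powi intro!: prod.cong)
    also have "\<dots> = (\<Prod>\<tau>\<in>embeddings k L L. y \<tau> powi m (restrict \<tau> K))"
      by (rule prod.group[OF top.finite_embeddings finite_embeddings])
         (use embeddings_restrict[OF _ KL subfield_K kK] in auto)
    finally show ?thesis by (simp add: top.monomial_def compose_e0)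
  qed
  then show ?thesis unfolding norm_on_characters_def top.mono_eq by (simp cong: restrict_cong)
qed

text \<open>With \<open>embeddings_L_L\<close> the index set becomes G and composition becomes left
  multiplication, the shape that \<open>norm_tower\<close> asks of its second module.\<close>

lemma perm_quotient_top:
  "permutation_quotient G top.M (character_act k L L) (carrier G) (\<lambda>g h. g \<otimes>\<^bsub>G\<^esub> h) top.mono_char"
proof -
  interpret Q: permutation_quotient G top.M "character_act k L L" "embeddings k L L" "compose L" top.mono_char
    by (rule top.perm_quotient)
  show ?thesis
  proof unfold_locales
    fix m show "(top.mono_char m = \<one>\<^bsub>top.M\<^esub>) = (\<exists>z. \<forall>\<sigma>\<in>carrier G. m \<sigma> = z)"
      using top.mono_one_iff by (simp add: embeddings_L_L)
    fix g assume g: "g \<in> carrier G"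
    show "character_act k L L g (top.mono_char m) = top.mono_char (\<lambda>\<sigma>. m (inv\<^bsub>G\<^esub> g \<otimes>\<^bsub>G\<^esub> \<sigma>))"
      unfolding top.mono_act[OF g] by (rule top.mono_cong) (use g in \<open>simp add: embeddings_L_L mult_Gal\<close>)
  qed (use finite_G G.one_closed top.mono_add Q.mono_surj in \<open>auto simp: G.m_assoc\<close>)
qed

lemma tower: "norm_tower G M (character_act k K L) E (compose K) mono_char top.M (character_act k L L) top.mono_char
   (norm_on_characters k K L) e0"
proof -
  interpret P: permutation_quotient G M "character_act k K L" E "compose K" mono_char by (rule perm_quotient)
  interpret Q: permutation_quotient G top.M "character_act k L L" "carrier G" "\<lambda>g h. g \<otimes>\<^bsub>G\<^esub> h" top.mono_char
    by (rule perm_quotient_top)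
  show ?thesis by unfold_locales (use e0_emb emb_trans norm_mono in auto)
qed

section \<open>The duality for the tower of number fields\<close>

interpretation NT: norm_tower G M "character_act k K L" E "compose K" mono_char top.M "character_act k L L" top.mono_char
   "norm_on_characters k K L" e0
  by (rule tower)

lemma NT_stab: "NT.stab = carrier (Gal L K)"
  by (simp add: NT.stab_def Gal_L_K)

lemma NT_GH: "NT.GH = Gal L K"
  by (simp add: NT_stab Gal_L_K_eq[symmetric])

lemma F_nr_eq: "F_nr k K L = NT.D Mod NT.dual_image"
  by (simp add: F_nr_def NT.dual_image_def f_norm_def[abs_def] Sha_torus_def Sha_norm_def)

text \<open>The relation is a premise in the description of the isomorphism, so this implication
  carries the abstract description over to the one in terms of fields.\<close>

lemma transferred_class_imp:
  assumes "transferred_class k K L \<chi> \<xi>" shows "NT.transferred \<chi> \<xi>"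
proof -
  obtain q a where a: "a \<in> cocycles2 G (permutation_module k K L) (permutation_act k K L)"
    and q: "\<forall>h \<in> carrier (Gal L K). \<chi> h = \<int> #>\<^bsub>rational_group\<^esub> q h"
      "\<forall>h1 \<in> carrier (Gal L K). \<forall>h2 \<in> carrier (Gal L K).
           of_int (a (h1, h2) (\<lambda>x\<in>K. x)) = q h1 + q h2 - q (h1 \<otimes>\<^bsub>Gal L K\<^esub> h2)"
    and \<xi>: "\<xi> = cohom2_class G M (character_act k K L) (\<lambda>p \<in> carrier G \<times> carrier G. mono_char (a p))"
    using assms unfolding transferred_class_def by blast
  have "NT.P.perm_cocycle a"
    unfolding NT.P.perm_cocycle_def
  proof (intro ballI)
    fix g1 g2 g3 \<sigma> assume g: "g1 \<in> carrier G" "g2 \<in> carrier G" "g3 \<in> carrier G" and \<sigma>: "\<sigma> \<in> E"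
    have "permutation_act k K L g1 (a (g2, g3)) \<otimes>\<^bsub>permutation_module k K L\<^esub> a (g1, g2 \<otimes>\<^bsub>G\<^esub> g3)
        = a (g1 \<otimes>\<^bsub>G\<^esub> g2, g3) \<otimes>\<^bsub>permutation_module k K L\<^esub> a (g1, g2)"
      using a g by (auto simp: cocycles2_def)
    from fun_cong[OF this, of \<sigma>] \<sigma>
    show "a (g2, g3) (compose K (inv\<^bsub>G\<^esub> g1) \<sigma>) + a (g1, g2 \<otimes>\<^bsub>G\<^esub> g3) \<sigma> = a (g1 \<otimes>\<^bsub>G\<^esub> g2, g3) \<sigma> + a (g1, g2) \<sigma>"
      by (simp add: permutation_module_def permutation_act_def)
  qed
  moreover have "\<forall>h\<in>NT.stab. \<chi> h = qz (q h)"
    using q(1) by (simp add: NT_stab qz_def)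
  moreover have eq: "h1 \<otimes>\<^bsub>Gal L K\<^esub> h2 = h1 \<otimes>\<^bsub>G\<^esub> h2" for h1 h2 by (subst Gal_L_K_eq) simp
  have "\<forall>h1\<in>NT.stab. \<forall>h2\<in>NT.stab. of_int (a (h1, h2) e0) = q h1 + q h2 - q (h1 \<otimes>\<^bsub>G\<^esub> h2)"
    using q(2) unfolding e0_def[symmetric] eq NT_stab .
  moreover have "\<xi> = NT.P.cls (NT.P.mono2 a)"
    by (simp only: \<xi> NT.P.mono2_def)
  ultimately show ?thesis
    unfolding NT.transferred_def by blast
qed

theorem first_obstruction:
  "\<exists>\<psi> \<in> iso ((G\<lparr>carrier := carrier (Gal L K) \<inter> derived G (carrier G)\<rparr>) Mod focal_subgroup G (carrier (Gal L K))) (F_nr k K L).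
     \<forall>h \<in> carrier (Gal L K) \<inter> derived G (carrier G). \<forall>\<chi> \<in> carrier (QZ_dual (Gal L K)).
       \<forall>\<xi> \<in> carrier (Sha_torus k K L). transferred_class k K L \<chi> \<xi> \<longrightarrow>
         (\<forall>l \<in> \<psi> (focal_subgroup G (carrier (Gal L K)) #>\<^bsub>G\<^esub> h). l \<xi> = \<chi> h)"
proof -
  note d = NT.duality[folded F_nr_eq Sha_torus_def, unfolded NT_GH, unfolded NT_stab]
  obtain \<psi> where \<psi>: "\<psi> \<in> iso ((G\<lparr>carrier := carrier (Gal L K) \<inter> derived G (carrier G)\<rparr>) Mod focal_subgroup G (carrier (Gal L K))) (F_nr k K L)"
    "\<forall>h \<in> carrier (Gal L K) \<inter> derived G (carrier G). \<forall>\<chi> \<in> carrier (QZ_dual (Gal L K)).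
       \<forall>\<xi> \<in> carrier (Sha_torus k K L). NT.transferred \<chi> \<xi> \<longrightarrow>
         (\<forall>l \<in> \<psi> (focal_subgroup G (carrier (Gal L K)) #>\<^bsub>G\<^esub> h). l \<xi> = \<chi> h)"
    using d by (elim bexE)
  show ?thesis
    by (rule bexI[OF _ \<psi>(1)], intro ballI impI, rule \<psi>(2)[rule_format, OF _ _ _ transferred_class_imp])
qed

end

theorem theorem1p1:
  fixes k K L :: "'a::field_char_0 set"
    and G :: "('a \<Rightarrow> 'a) monoid" and H :: "('a \<Rightarrow> 'a) set"
  assumes "number_field k" and "number_field K" and "number_field L"
    and "k \<subseteq> K" and "K \<subseteq> L"
    and "galois_ext L k"
    and G_def: "G = Gal L k" and H_def: "H = carrier (Gal L K)"
  shows "\<exists>\<psi> \<in> iso ((G\<lparr>carrier := H \<inter> derived G (carrier G)\<rparr>) Mod focal_subgroup G H)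
                 (F_nr k K L).
           \<forall>h \<in> H \<inter> derived G (carrier G). \<forall>\<chi> \<in> carrier (QZ_dual (Gal L K)).
             \<forall>\<xi> \<in> carrier (Sha_torus k K L). transferred_class k K L \<chi> \<xi> \<longrightarrow>
               (\<forall>l \<in> \<psi> (focal_subgroup G H #>\<^bsub>G\<^esub> h). l \<xi> = \<chi> h)"
proof -
  interpret galois_tower k K L using assms by unfold_locales
  show ?thesis unfolding G_def H_def by (rule first_obstruction)
qed

end
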